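(* Consider the matrix completion model with true matrix $M_0\in\mathbb{R}^{m\times p}$, noise variance $\sigma^2>0$, $n$ observations, the factorized Gaussian prior with parameters $K\in\{1,\dots,m\wedge p\}$, $a>0$, $b>0$, and the mean-field variational approximation $\tilde\pi_{n,\alpha}$, $\alpha\in(0,1)$, all defined in the context. Let $B>0$, assume $M_0=\bar{U}\bar{V}^t$ for some $(\bar{U},\bar{V})\in \mathcal{M}(r,B)$ with $1\le r\le K$, and take $b=B^2/\{512 (nmp)^4 [(m\vee p) K]^2\}$. Then $$\mathbb{P}\left[ \int d_{\alpha,\sigma}(M,M_0)\, \tilde{\pi}_{n,\alpha}(\mathrm{d}M|X_1^n) \leq \frac{2(\alpha+1)}{1-\alpha}\, \varepsilon_n \right] \geq 1-\frac{2}{n\varepsilon_n},$$ where, for some constant $\mathcal{D}(a,\sigma^2,B)$ depending only on $a$, $\sigma^2$ and $B$, $$\varepsilon_n = \frac{\mathcal{D}(a,\sigma^2,B)\, r(m+p)\log(nmp)}{n} .$$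
   Context: Model. $m,p,n\ge1$. For a matrix $M\in\mathbb{R}^{m\times p}$, under $P_M$ an observation is $X_k=((i_k,j_k),Y_k)$ with $(i_k,j_k)$ uniform on $\{1,\dots,m\}\times\{1,\dots,p\}$ and $Y_k=M_{i_k,j_k}+\xi_k$, $\xi_k\sim\mathcal{N}(0,\sigma^2)$ independent of $(i_k,j_k)$, $\sigma^2$ known. $X_1^n=(X_1,\dots,X_n)$ are i.i.d. from $P_{M_0}$; $\mathbb{P}$ is the corresponding probability. Distance. For $\alpha\in(0,1)$, $d_{\alpha,\sigma}(M,N)=D_\alpha(P_M,P_N)=\frac{1}{\alpha-1} \log \left[ \frac{1}{mp}\sum_{i=1}^m\sum_{j=1}^p \exp\left(\frac{\alpha(\alpha-1)(M_{i,j}-N_{i,j})^2}{2\sigma^2}\right) \right]$ (the $\alpha$-Rényi divergence). Prior. Parameters are $(U,V,\gamma)$ with $U\in\mathbb{R}^{m\times K}$, $V\in\mathbb{R}^{p\times K}$, $\gamma\in(0,\infty)^K$, and $M=UV^t$. Under the prior $\pi$: $\gamma_1,\dots,\gamma_K$ are independent with $1/\gamma_k\sim\Gamma(a,b)$ (i.e. $\gamma_k$ has density $\frac{b^a}{\Gamma(a)}x^{-a-1}e^{-b/x}$ on $(0,\infty)$), and given $\gamma$ the entries $U_{i,k}$ and $V_{j,k}$ are independent $\mathcal{N}(0,\gamma_k)$. Variational approximation. The tempered posterior is $\pi_{n,\alpha}(\mathrm{d}(U,V,\gamma)|X_1^n)\propto L_n(UV^t)^\alpha\,\pi(\mathrm{d}(U,V,\gamma))$,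 where $L_n(M)$ is the likelihood of $X_1^n$ under $P_M$. $\mathcal{F}$ is the set of product probability measures $\rho(\mathrm{d}U,\mathrm{d}V,\mathrm{d}\gamma)=\bigotimes_{i=1}^m\rho_{U_i}(\mathrm{d}U_{i,\cdot})\bigotimes_{j=1}^p\rho_{V_j}(\mathrm{d}V_{j,\cdot})\bigotimes_{k=1}^K\rho_{\gamma_k}(\mathrm{d}\gamma_k)$ (arbitrary marginals). $\tilde\pi_{n,\alpha}(\cdot|X_1^n)=\arg\min_{\rho\in\mathcal{F}}\mathcal{K}(\rho,\pi_{n,\alpha}(\cdot|X_1^n))$ (any minimizer), with $\mathcal{K}$ the Kullback–Leibler divergence; $\tilde\pi_{n,\alpha}(\mathrm{d}M|X_1^n)$ denotes the induced law of $M=UV^t$. Class $\mathcal{M}(r,B)$. For $r\ge1$, $B>0$: the set of pairs $(\bar U,\bar V)$ of matrices of dimensions $m\times K$ and $p\times K$ with $\bar U_{i,\ell}=0$ for $\ell>r$, $\max_{i,\ell}|\bar U_{i,\ell}|\le B$, and similarly $\bar V_{j,\ell}=0$ for $\ell>r$ and $\max_{j,\ell}|\bar V_{j,\ell}|\le B$. When $\varepsilon_n=0$ (i.e. $nmp=1$) the right-hand side $1-2/(n\varepsilon_n)$ is read as $-\infty$. *)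

theory Defs
  imports "HOL-Probability.Probability"
begin

text \<open>
  All dimensions are natural numbers and all indices start at 0: a real \<open>m \<times> p\<close> matrix is a
  point of \<open>matrix_space m p\<close>, i.e. a function on \<open>{..<m}\<close> with values in the functions on
  \<open>{..<p}\<close>, extended by \<open>undefined\<close> outside of these index sets.
\<close>

type_synonym mat = "nat \<Rightarrow> nat \<Rightarrow> real"
type_synonym observation = "(nat \<times> nat) \<times> real"
type_synonym parameter = "mat \<times> mat \<times> (nat \<Rightarrow> real)"

definition matrix_space :: "nat \<Rightarrow> nat \<Rightarrow> mat measure" where
  "matrix_space m p = (\<Pi>\<^sub>M i\<in>{..<m}. \<Pi>\<^sub>M j\<in>{..<p}. borel)"

definition mult_transpose :: "nat \<Rightarrow> nat \<Rightarrow> nat \<Rightarrow> mat \<Rightarrow> mat \<Rightarrow> mat" where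
  "mult_transpose m p K U V = (\<lambda>i\<in>{..<m}. \<lambda>j\<in>{..<p}. \<Sum>k<K. U i k * V j k)"

definition matrix_class :: "nat \<Rightarrow> nat \<Rightarrow> nat \<Rightarrow> nat \<Rightarrow> real \<Rightarrow> (mat \<times> mat) set" where
  "matrix_class m p K r B =
     {(U, V). U \<in> space (matrix_space m K) \<and> V \<in> space (matrix_space p K) \<and>
        (\<forall>i<m. \<forall>l<K. (r \<le> l \<longrightarrow> U i l = 0) \<and> \<bar>U i l\<bar> \<le> B) \<and>
        (\<forall>j<p. \<forall>l<K. (r \<le> l \<longrightarrow> V j l = 0) \<and> \<bar>V j l\<bar> \<le> B)}"

definition obs_space :: "nat \<Rightarrow> nat \<Rightarrow> observation measure" where
  "obs_space m p = count_space ({..<m} \<times> {..<p}) \<Otimes>\<^sub>M borel"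

definition obs_law :: "nat \<Rightarrow> nat \<Rightarrow> real \<Rightarrow> mat \<Rightarrow> observation measure" where
  "obs_law m p \<sigma> M =
     distr (uniform_count_measure ({..<m} \<times> {..<p}) \<Otimes>\<^sub>M density lborel (normal_density 0 \<sigma>))
       (obs_space m p) (\<lambda>((i, j), \<xi>). ((i, j), M i j + \<xi>))"

definition sample_law :: "nat \<Rightarrow> nat \<Rightarrow> nat \<Rightarrow> real \<Rightarrow> mat \<Rightarrow> (nat \<Rightarrow> observation) measure" where
  "sample_law m p n \<sigma> M = (\<Pi>\<^sub>M k\<in>{..<n}. obs_law m p \<sigma> M)"

text \<open>
  The likelihood is taken with respect to the product of counting measure (on the positions)
  and Lebesgue measure (on the noisy entries).
\<close>

definition likelihood ::
    "nat \<Rightarrow> nat \<Rightarrow> nat \<Rightarrow> real \<Rightarrow> (nat \<Rightarrow> observation) \<Rightarrow> mat \<Rightarrow> real" where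
  "likelihood m p n \<sigma> X M =
     (\<Prod>k<n. case X k of ((i, j), y) \<Rightarrow> 1 / (real m * real p) * normal_density (M i j) \<sigma> y)"

definition renyi_dist :: "nat \<Rightarrow> nat \<Rightarrow> real \<Rightarrow> real \<Rightarrow> mat \<Rightarrow> mat \<Rightarrow> real" where
  "renyi_dist m p \<alpha> \<sigma> M N =
     1 / (\<alpha> - 1) * ln (1 / (real m * real p) *
       (\<Sum>i<m. \<Sum>j<p. exp (\<alpha> * (\<alpha> - 1) * (M i j - N i j)\<^sup>2 / (2 * \<sigma>\<^sup>2))))"

definition inv_gamma_density :: "real \<Rightarrow> real \<Rightarrow> real \<Rightarrow> real" where
  "inv_gamma_density a b x = b powr a / Gamma a * x powr (- a - 1) * exp (- b / x)"

text \<open>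
  The prior is given by its joint density, (density of \<open>\<gamma>\<close>) times (conditional density of
  \<open>(U, V)\<close> given \<open>\<gamma>\<close>), with respect to Lebesgue measure; \<open>\<gamma>\<close> ranges over \<open>(0, \<infinity>)\<^sup>K\<close>.
  The second argument of \<open>normal_density\<close> is the standard deviation, hence the square roots.
\<close>

definition prior_density :: "nat \<Rightarrow> nat \<Rightarrow> nat \<Rightarrow> real \<Rightarrow> real \<Rightarrow> parameter \<Rightarrow> real" where
  "prior_density m p K a b = (\<lambda>(U, V, \<gamma>).
     (\<Prod>k<K. inv_gamma_density a b (\<gamma> k)) *
     (\<Prod>i<m. \<Prod>k<K. normal_density 0 (sqrt (\<gamma> k)) (U i k)) *
     (\<Prod>j<p. \<Prod>k<K. normal_density 0 (sqrt (\<gamma> k)) (V j k)))"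

definition prior :: "nat \<Rightarrow> nat \<Rightarrow> nat \<Rightarrow> real \<Rightarrow> real \<Rightarrow> parameter measure" where
  "prior m p K a b =
     density
       ((\<Pi>\<^sub>M i\<in>{..<m}. \<Pi>\<^sub>M k\<in>{..<K}. lborel) \<Otimes>\<^sub>M
        (\<Pi>\<^sub>M j\<in>{..<p}. \<Pi>\<^sub>M k\<in>{..<K}. lborel) \<Otimes>\<^sub>M
        (\<Pi>\<^sub>M k\<in>{..<K}. restrict_space lborel {0<..}))
       (prior_density m p K a b)"

definition tempered_posterior ::
    "nat \<Rightarrow> nat \<Rightarrow> nat \<Rightarrow> nat \<Rightarrow> real \<Rightarrow> real \<Rightarrow> real \<Rightarrow> real \<Rightarrow> (nat \<Rightarrow> observation) \<Rightarrow> parameter measure"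
  where
  "tempered_posterior m p n K a b \<sigma> \<alpha> X =
     (let \<pi> = prior m p K a b;
          L = (\<lambda>(U, V, \<gamma>). likelihood m p n \<sigma> X (mult_transpose m p K U V) powr \<alpha>)
      in density \<pi> (\<lambda>\<theta>. ennreal (L \<theta>) / (\<integral>\<^sup>+ \<theta>'. ennreal (L \<theta>') \<partial>\<pi>)))"

definition mean_field :: "nat \<Rightarrow> nat \<Rightarrow> nat \<Rightarrow> parameter measure set" where
  "mean_field m p K =
     {(\<Pi>\<^sub>M i\<in>{..<m}. \<rho>U i) \<Otimes>\<^sub>M (\<Pi>\<^sub>M j\<in>{..<p}. \<rho>V j) \<Otimes>\<^sub>M (\<Pi>\<^sub>M k\<in>{..<K}. \<rho>\<gamma> k) | \<rho>U \<rho>V \<rho>\<gamma>.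
        (\<forall>i<m. \<rho>U i \<in> space (prob_algebra (\<Pi>\<^sub>M k\<in>{..<K}. borel))) \<and>
        (\<forall>j<p. \<rho>V j \<in> space (prob_algebra (\<Pi>\<^sub>M k\<in>{..<K}. borel))) \<and>
        (\<forall>k<K. \<rho>\<gamma> k \<in> space (prob_algebra (restrict_space borel {0<..})))}"

text \<open>
  The library's \<open>KL_divergence b \<mu> \<rho>\<close> is the integral of \<open>log b (d\<rho>/d\<mu>)\<close> under \<open>\<rho>\<close> and is
  only meaningful if \<open>\<rho> \<lless> \<mu>\<close> and the integral exists. As the negative part of the integrand is
  always integrable for probability measures, the divergence is \<open>\<infinity>\<close> in all other cases.
\<close>

definition KL :: "'a measure \<Rightarrow> 'a measure \<Rightarrow> ereal" where
  "KL \<rho> \<mu> =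
     (if absolutely_continuous \<mu> \<rho> \<and> integrable \<rho> (entropy_density (exp 1) \<mu> \<rho>)
      then ereal (KL_divergence (exp 1) \<mu> \<rho>) else \<infinity>)"

definition is_variational_approx ::
    "nat \<Rightarrow> nat \<Rightarrow> nat \<Rightarrow> nat \<Rightarrow> real \<Rightarrow> real \<Rightarrow> real \<Rightarrow> real \<Rightarrow> (nat \<Rightarrow> observation) \<Rightarrow>
     parameter measure \<Rightarrow> bool" where
  "is_variational_approx m p n K a b \<sigma> \<alpha> X \<rho> \<longleftrightarrow>
     is_arg_min (\<lambda>\<rho>'. KL \<rho>' (tempered_posterior m p n K a b \<sigma> \<alpha> X))
       (\<lambda>\<rho>'. \<rho>' \<in> mean_field m p K) \<rho>"

definition induced_law :: "nat \<Rightarrow> nat \<Rightarrow> nat \<Rightarrow> parameter measure \<Rightarrow> mat measure" where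
  "induced_law m p K \<rho> =
     distr \<rho> (matrix_space m p) (\<lambda>(U, V, \<gamma>). mult_transpose m p K U V)"

definition eps_rate :: "real \<Rightarrow> nat \<Rightarrow> nat \<Rightarrow> nat \<Rightarrow> nat \<Rightarrow> real" where
  "eps_rate D r m p n = D * real r * (real m + real p) * ln (real (n * m * p)) / real n"

end

theory Submission
  imports Defs
begin

text \<open>
  Let \<open>\<mu>\<close> be the tempered posterior, \<open>\<rho>\<close> its variational approximation and \<open>d\<close> the Renyi
  divergence to the truth. The Donsker--Varadhan inequality bounds \<open>n(1 - \<alpha>) \<integral> d d\<rho>\<close> by
  \<open>KL(\<rho>, \<mu>) + ln \<integral> exp(n(1 - \<alpha>) d) d\<mu>\<close>, and \<open>KL(\<rho>, \<mu>) \<le> KL(\<rho>', \<mu>)\<close> for every mean-field \<open>\<rho>'\<close>.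
  The normalising constant of \<open>\<mu>\<close> cancels in the sum of the two terms. What remains of the second
  one is the logarithm of a variable whose expectation is the total mass of the prior, so Markov's
  inequality controls it. For the first one, \<open>\<rho>'\<close> is chosen so that its density with respect to the
  prior is at most \<open>exp(n \<epsilon>)\<close> everywhere and so that \<open>M\<close> stays within \<open>\<sigma>/n\<close> of the truth entrywise on
  its support; the log-likelihood ratio there is bounded by the total absolute noise, which Markov's
  inequality controls as well.
\<close>

text \<open>They hold \<open>(K - r) * (m + p)\<close> entries, while the rate pays for
  \<open>r * (m + p)\<close> only, so a logarithmic price for confining each of these entries is too
  much. Instead the scale \<open>\<gamma> k\<close> of such a column is made tiny. That is paid for
  once per column, at a logarithmic price, and given this scale the entries are almost
  prior-distributed, at a price of order \<open>1/(m + p)\<close> each. As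
  \<open>K \<le> m + p\<close>, one logarithm per column fits into the rate. The value of
  \<open>b\<close> is what keeps the price of a scale logarithmic: for both scales \<open>w\<close>
  in use, \<open>b / w\<close> is bounded and \<open>w / b\<close> is polynomial in
  \<open>nmp\<close>. A pointwise bound on densities, rather than a computed divergence, splits into
  independent one-dimensional comparisons. The very small radius \<sigma>/n enters the cost only
  through logarithms and in return makes a first absolute moment of the noise sufficient. The
  minimiser need not depend measurably on the sample; the event is therefore defined without
  it.\<close>

section \<open>Product measures with densities and the inverse gamma law\<close>

lemma nn_integral_normal_density:
  assumes "0 < s"
  shows "(\<integral>\<^sup>+ x. ennreal (normal_density c s x) \<partial>lborel) = 1"
  using assms by (subst nn_integral_eq_integral) auto

lemma PiM_density:
  fixes f :: "'i \<Rightarrow> 'a \<Rightarrow> ennreal"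
  assumes I: "finite I"
    and M: "\<And>i. i \<in> I \<Longrightarrow> sigma_finite_measure (M i)"
    and f [measurable]: "\<And>i. i \<in> I \<Longrightarrow> f i \<in> borel_measurable (M i)"
    and P: "\<And>i. i \<in> I \<Longrightarrow> sigma_finite_measure (density (M i) (f i))"
  shows "PiM I (\<lambda>i. density (M i) (f i)) = density (PiM I M) (\<lambda>x. \<Prod>i\<in>I. f i (x i))"
proof -
  \<comment> \<open>The product locales ask for sigma-finiteness at every index, while the
    hypotheses give it on \<open>I\<close> only. Outside \<open>I\<close> a one-point counting
    measure is put in, which \<open>PiM I\<close> does not see.\<close>
  define M' where "M' i = (if i \<in> I then M i else count_space {undefined})" for i
  define N' where "N' i = (if i \<in> I then density (M i) (f i) else count_space {undefined})" for i
  have "sigma_finite_measure (M' i)" for i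
    using M by (auto simp: M'_def sigma_finite_measure_count_space_finite)
  then interpret M': product_sigma_finite M' by (rule product_sigma_finite.intro)
  have "sigma_finite_measure (N' i)" for i
    using P by (auto simp: N'_def sigma_finite_measure_count_space_finite)
  then interpret N': product_sigma_finite N' by (rule product_sigma_finite.intro)
  have eqM: "PiM I M = PiM I M'" by (rule PiM_cong) (auto simp: M'_def)
  have eqN: "PiM I (\<lambda>i. density (M i) (f i)) = PiM I N'" by (rule PiM_cong) (auto simp: N'_def)
  have [measurable]: "\<And>i. i \<in> I \<Longrightarrow> f i \<in> borel_measurable (M' i)" by (simp add: M'_def)
  have meas [measurable]: "(\<lambda>x. \<Prod>i\<in>I. f i (x i)) \<in> borel_measurable (PiM I M')"
    by measurable
  have "density (PiM I M') (\<lambda>x. \<Prod>i\<in>I. f i (x i)) = PiM I N'"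
  proof (rule N'.PiM_eqI[OF I])
    show "sets (density (PiM I M') (\<lambda>x. \<Prod>i\<in>I. f i (x i))) = sets (PiM I N')"
      by (auto simp: M'_def N'_def intro!: sets_PiM_cong)
    fix A assume A: "\<And>i. i \<in> I \<Longrightarrow> A i \<in> sets (N' i)"
    then have A' [measurable]: "\<And>i. i \<in> I \<Longrightarrow> A i \<in> sets (M' i)" by (simp add: M'_def N'_def)
    have "emeasure (density (PiM I M') (\<lambda>x. \<Prod>i\<in>I. f i (x i))) (Pi\<^sub>E I A)
        = (\<integral>\<^sup>+ x. (\<Prod>i\<in>I. f i (x i)) * indicator (Pi\<^sub>E I A) x \<partial>PiM I M')"
      by (rule emeasure_density[OF meas]) (use I A' in \<open>auto intro: sets_PiM_I_finite\<close>)
    also have "\<dots> = (\<integral>\<^sup>+ x. (\<Prod>i\<in>I. f i (x i) * indicator (A i) (x i)) \<partial>PiM I M')"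
    proof (rule nn_integral_cong)
      fix x assume x: "x \<in> space (PiM I M')"
      have "(\<Prod>i\<in>I. indicator (A i) (x i)) = (indicator (Pi\<^sub>E I A) x :: ennreal)"
      proof (cases "x \<in> Pi\<^sub>E I A")
        case True then show ?thesis by (auto simp: PiE_iff)
      next
        case False
        then obtain i where "i \<in> I" "x i \<notin> A i" using x by (auto simp: PiE_iff space_PiM)
        then have "(\<Prod>i\<in>I. indicator (A i) (x i)) = (0 :: ennreal)"
          using I by (intro prod_zero) (auto intro!: bexI[of _ i])
        then show ?thesis using False by simp
      qed
      then show "(\<Prod>i\<in>I. f i (x i)) * indicator (Pi\<^sub>E I A) x = (\<Prod>i\<in>I. f i (x i) * indicator (A i) (x i))"
        by (simp add: prod.distrib)
    qed
    also have "\<dots> = (\<Prod>i\<in>I. \<integral>\<^sup>+ x. f i x * indicator (A i) x \<partial>M' i)"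
      by (rule M'.product_nn_integral_prod[OF I]) measurable
    also have "\<dots> = (\<Prod>i\<in>I. emeasure (N' i) (A i))"
      by (rule prod.cong) (use A' in \<open>auto simp: N'_def M'_def emeasure_density\<close>)
    finally show "emeasure (density (PiM I M') (\<lambda>x. \<Prod>i\<in>I. f i (x i))) (Pi\<^sub>E I A) = \<dots>" .
  qed
  then show ?thesis using eqM eqN by simp
qed

lemma borel_measurable_inv_gamma_density [measurable]:
  "inv_gamma_density a b \<in> borel_measurable borel"
  unfolding inv_gamma_density_def by measurable

text \<open>The substitution \<open>t = b / x\<close> turns this into Euler's integral for
  \<open>Gamma a\<close>.\<close>

lemma nn_integral_inv_gamma_density:
  assumes a: "0 < a" and b: "0 < b"
  shows "(\<integral>\<^sup>+ x. ennreal (inv_gamma_density a b x) \<partial>restrict_space lborel {0<..}) = 1"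
proof -
  define f :: "real \<Rightarrow> real" where "f t = t powr (a - 1) / exp t" for t
  have g0: "(f has_integral Gamma a) {0..}"
    unfolding f_def using Gamma_integral_real[OF a] .
  \<comment> \<open>The point 0 is dropped before substituting, because \<open>b / x\<close> maps
    \<open>{0<..}\<close> onto itself but sends 0 to 0 by convention.\<close>
  then have g1: "(f has_integral Gamma a) {0<..}"
    by (rule has_integral_spike_set_eq[THEN iffD1, rotated 2]) (auto intro: negligible_subset[of "{0}"])
  have fabs: "f absolutely_integrable_on {0<..}"
    using g1 by (intro nonnegative_absolutely_integrable_1) (auto simp: f_def has_integral_iff)
  define g where "g x = b / x" for x :: real
  have im: "g ` {0<..} = {0<..}"
  proof (intro set_eqI iffI)
    fix y :: real assume y: "y \<in> {0<..}"
    then have "y = g (b / y)" "b / y \<in> {0<..}" using b by (auto simp: g_def)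
    then show "y \<in> g ` {0<..}" by blast
  qed (use b in \<open>auto simp: g_def\<close>)
  have "(\<lambda>x. \<bar>- b / x\<^sup>2\<bar> * f (g x)) absolutely_integrable_on {0<..} \<and>
        integral {0<..} (\<lambda>x. \<bar>- b / x\<^sup>2\<bar> * f (g x)) = Gamma a"
  proof (rule has_absolute_integral_change_of_variables_1'[where g = g and g' = "\<lambda>x. - b / x\<^sup>2" and f = f, THEN iffD2])
    show "inj_on g {0<..}" using b by (auto simp: inj_on_def g_def)
    show "(g has_field_derivative - b / x\<^sup>2) (at x within {0<..})" if "x \<in> {0<..}" for x
      using that unfolding g_def by (auto intro!: derivative_eq_intros simp: power2_eq_square)
    show "f absolutely_integrable_on g ` {0<..} \<and> integral (g ` {0<..}) f = Gamma a"
      using fabs g1 im by (simp add: integral_unique)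
  qed auto
  then have hi: "((\<lambda>x. \<bar>- b / x\<^sup>2\<bar> * f (g x)) has_integral Gamma a) {0<..}"
    by (auto simp: has_integral_iff dest: set_lebesgue_integral_eq_integral(1))
  have "((\<lambda>x. (1 / Gamma a) * (\<bar>- b / x\<^sup>2\<bar> * f (g x))) has_integral (1 / Gamma a) * Gamma a) {0<..}"
    by (rule has_integral_mult_right[OF hi])
  moreover have "(1 / Gamma a) * (\<bar>- b / x\<^sup>2\<bar> * f (g x)) = inv_gamma_density a b x" if "x \<in> {0<..}" for x
  proof -
    from that have x: "0 < x" by simp
    have "(b / x) powr (a - 1) = (b / x) powr a / (b / x)"
      using x b by (simp add: powr_diff)
    also have "(b / x) powr a = b powr a * x powr (- a)"
      using x b by (simp add: powr_divide powr_minus_divide)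
    finally have "b / x\<^sup>2 * (b / x) powr (a - 1) = b powr a * (x powr (- a) / x)"
      using x b by (simp add: power2_eq_square)
    also have "x powr (- a) / x = x powr (- a - 1)"
      using x by (simp add: powr_diff)
    finally have eq: "b / x\<^sup>2 * (b / x) powr (a - 1) = b powr a * x powr (- a - 1)" .
    have "\<bar>- b / x\<^sup>2\<bar> * f (g x) = (b / x\<^sup>2 * (b / x) powr (a - 1)) * exp (- b / x)"
      using x b by (simp add: f_def g_def exp_minus divide_inverse)
    then show ?thesis
      unfolding inv_gamma_density_def eq by simp
  qed
  ultimately have hi1: "((\<lambda>x. inv_gamma_density a b x) has_integral 1) {0<..}"
    using Gamma_real_pos[OF a] has_integral_cong[of "{0<..}" "\<lambda>x. 1 / Gamma a * (\<bar>- b / x\<^sup>2\<bar> * f (g x))" "inv_gamma_density a b"]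
    by simp
  have nonneg: "0 \<le> inv_gamma_density a b x" for x
    using Gamma_real_pos[OF a] by (simp add: inv_gamma_density_def)
  have "(\<integral>\<^sup>+ x. ennreal (inv_gamma_density a b x) * indicator {0<..} x \<partial>lborel) = ennreal 1"
    using nn_integral_has_integral_lebesgue'[OF nonneg hi1] .
  then show ?thesis
    by (subst nn_integral_restrict_space) simp_all
qed

section \<open>Variational bounds for the Kullback--Leibler divergence\<close>

text \<open>Where \<open>h > 0\<close>, the Radon--Nikodym derivative is \<open>h / k\<close>, whose
  logarithm is at most \<open>ln C\<close>. The remaining work is integrability of that logarithm,
  without which \<open>KL\<close> is infinite by definition.\<close>

lemma KL_le_of_density_le:
  fixes h k :: "'a \<Rightarrow> real" and C :: real
  assumes h [measurable]: "h \<in> borel_measurable M" and k [measurable]: "k \<in> borel_measurable M"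
    and h0: "\<And>x. x \<in> space M \<Longrightarrow> 0 \<le> h x" and k0: "\<And>x. x \<in> space M \<Longrightarrow> 0 < k x"
    and le: "\<And>x. x \<in> space M \<Longrightarrow> h x \<le> C * k x"
    and ph: "prob_space (density M h)" and pk: "finite_measure (density M k)"
  shows "KL (density M h) (density M k) \<le> ereal (ln C)"
proof -
  interpret H: prob_space "density M h" by fact
  interpret K: finite_measure "density M k" by fact
  define q where "q x = h x / k x" for x
  have [measurable]: "q \<in> borel_measurable M" unfolding q_def by measurable
  have eq: "density M h = density (density M k) q"
  proof -
    have "density (density M k) q = density M (\<lambda>x. ennreal (k x) * ennreal (q x))"
      by (rule density_density_eq) auto
    also have "\<dots> = density M h"
      using h0 k0 less_imp_neq[OF k0]
      by (intro density_cong) (auto simp: q_def ennreal_mult[symmetric] less_imp_le)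
    finally show ?thesis by simp
  qed
  have ac: "absolutely_continuous (density M k) (density M h)"
    unfolding eq by (rule absolutely_continuousI_density) simp
  have "AE x in density M k. ennreal (q x) = RN_deriv (density M k) (density M h) x"
    by (rule K.RN_deriv_unique) (auto simp: eq)
  then have "AE x in density M h. ennreal (q x) = RN_deriv (density M k) (density M h) x"
    by (rule absolutely_continuous_AE[OF _ ac, rotated]) simp
  moreover have "AE x in density M h. 0 < h x"
    by (subst AE_density) (auto intro!: AE_I2 simp: ennreal_neg not_less ennreal_eq_0_iff dest: h0)
  ultimately have ae: "AE x in density M h. entropy_density (exp 1) (density M k) (density M h) x = ln (q x) \<and> 0 < h x \<and> x \<in> space M"
    using AE_space[of "density M h"]
  proof eventually_elim
    case (elim x)
    then have "RN_deriv (density M k) (density M h) x = ennreal (q x)" "0 < h x" "0 < k x"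
      using k0 by auto
    then show ?case using elim by (simp add: entropy_density_def log_def q_def)
  qed
  \<comment> \<open>\<open>C\<close> is not assumed positive. A point with \<open>h > 0\<close>,
    which exists because \<open>density M h\<close> has mass one, forces it to be.\<close>
  obtain x0 where x0: "x0 \<in> space M" "0 < h x0"
  proof (rule ccontr)
    assume "\<not> thesis"
    then have no: "x \<notin> space M \<or> \<not> 0 < h x" for x using that by blast
    have "AE x in density M h. False" using ae by eventually_elim (use no in blast)
    then show False by simp
  qed
  have C: "0 < C"
    using le[OF x0(1)] x0(2) k0[OF x0(1)] by (metis less_le_trans zero_less_mult_pos2)
  \<comment> \<open>The lower bound is \<open>ln q \<ge> 1 - 1 / q\<close>. It is integrable because
    the integral of \<open>k / h\<close> under \<open>density M h\<close> is at most the mass of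
    \<open>density M k\<close>.\<close>
  have up: "ln (q x) \<le> ln C" and dn: "1 - k x / h x \<le> ln (q x)" if "0 < h x" "x \<in> space M" for x
  proof -
    have q: "0 < q x" "q x \<le> C" using that k0[OF that(2)] le[OF that(2)] by (auto simp: q_def field_simps)
    then show "ln (q x) \<le> ln C" using C by simp
    have "- ln (q x) \<le> inverse (q x) - 1"
      using q ln_le_minus_one[of "inverse (q x)"] by (simp add: ln_inverse)
    then show "1 - k x / h x \<le> ln (q x)" by (simp add: q_def)
  qed
  have intq: "integrable (density M h) (\<lambda>x. k x / h x)"
  proof (rule integrableI_bounded)
    have "(\<integral>\<^sup>+ x. ennreal (norm (k x / h x)) \<partial>density M h) = (\<integral>\<^sup>+ x. ennreal (h x) * ennreal (norm (k x / h x)) \<partial>M)"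
      by (rule nn_integral_density) auto
    also have "\<dots> \<le> (\<integral>\<^sup>+ x. ennreal (k x) \<partial>M)"
      using h0 k0 by (intro nn_integral_mono) (auto simp: ennreal_mult[symmetric] less_imp_le intro!: ennreal_leI)
    also have "\<dots> = emeasure (density M k) (space M)"
      by (subst emeasure_density) (auto intro!: nn_integral_cong)
    also have "\<dots> < \<infinity>"
      using K.emeasure_finite[of "space M"] unfolding infinity_ennreal_def top.not_eq_extremum .
    finally show "(\<integral>\<^sup>+ x. ennreal (norm (k x / h x)) \<partial>density M h) < \<infinity>" .
  qed simp
  have int: "integrable (density M h) (entropy_density (exp 1) (density M k) (density M h))"
  proof (rule Bochner_Integration.integrable_bound[where f = "\<lambda>x. \<bar>ln C\<bar> + 1 + k x / h x"])
    show "integrable (density M h) (\<lambda>x. \<bar>ln C\<bar> + 1 + k x / h x)"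
      using intq by auto
    show "entropy_density (exp 1) (density M k) (density M h) \<in> borel_measurable (density M h)"
      using measurable_entropy_density[of "exp 1" "density M k" "density M h"]
      by (simp add: measurable_def)
    show "AE x in density M h. norm (entropy_density (exp 1) (density M k) (density M h) x) \<le> norm (\<bar>ln C\<bar> + 1 + k x / h x)"
      using ae
    proof eventually_elim
      case (elim x)
      then have "0 < k x / h x" "1 - k x / h x \<le> ln (q x)" "ln (q x) \<le> ln C" using k0 up dn by auto
      then show ?case using elim by auto
    qed
  qed
  have "KL_divergence (exp 1) (density M k) (density M h) \<le> (\<integral> x. ln C \<partial>density M h)"
    unfolding KL_divergence_def
  proof (rule integral_mono_AE[OF int])
    show "AE x in density M h. entropy_density (exp 1) (density M k) (density M h) x \<le> ln C"
      using ae by eventually_elim (use up in auto)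
  qed simp
  then show ?thesis
    using ac int H.prob_space by (simp add: KL_def)
qed

text \<open>The easy half of the Donsker--Varadhan variational formula; the elementary inequality
  behind it is \<open>x \<le> e\<^sup>x - 1\<close> for \<open>x = g - ln W - ln (d\<rho>/d\<mu>)\<close>.\<close>

lemma donsker_varadhan:
  fixes g :: "'a \<Rightarrow> real" and W R :: real
  assumes "sigma_finite_measure \<mu>" and p: "prob_space \<rho>" and sets: "sets \<rho> = sets \<mu>"
    and KL: "KL \<rho> \<mu> \<le> ereal R"
    and g [measurable]: "g \<in> borel_measurable \<mu>" and g0: "\<And>x. 0 \<le> g x"
    and W: "(\<integral>\<^sup>+ x. ennreal (exp (g x)) \<partial>\<mu>) \<le> ennreal W" "0 < W"
  shows "(\<integral>\<^sup>+ x. ennreal (g x) \<partial>\<rho>) \<le> ennreal (R + ln W)"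
proof -
  interpret M: sigma_finite_measure \<mu> by fact
  interpret P: prob_space \<rho> by fact
  note sets [measurable_cong]
  have ac: "absolutely_continuous \<mu> \<rho>" and int: "integrable \<rho> (entropy_density (exp 1) \<mu> \<rho>)"
    and KLR: "KL_divergence (exp 1) \<mu> \<rho> \<le> R"
    using KL by (auto simp: KL_def split: if_splits)
  obtain D where D [measurable]: "D \<in> borel_measurable \<mu>"
      and D2: "AE x in \<mu>. RN_deriv \<mu> \<rho> x = ennreal (D x)"
      and D3: "AE x in \<rho>. 0 < D x" and D0: "\<And>x. 0 \<le> D x"
    using M.real_RN_deriv[OF P.finite_measure_axioms ac sets] by blast
  define L where "L = entropy_density (exp 1) \<mu> \<rho>"
  have D': "AE x in \<rho>. RN_deriv \<mu> \<rho> x = ennreal (D x)"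
    by (rule absolutely_continuous_AE[OF _ ac D2]) (simp add: sets)
  have L: "AE x in \<rho>. L x = ln (D x) \<and> 0 < D x"
    using D' D3 by eventually_elim (use D0 in \<open>auto simp: L_def entropy_density_def log_def\<close>)
  have dens: "\<rho> = density \<mu> D"
    using M.density_RN_deriv[OF ac sets] density_cong[OF _ _ D2] by simp
  \<comment> \<open>This is the exponential of \<open>g - ln W - ln D\<close>. Written with a
    division by \<open>D\<close>, its \<rho>-integral becomes a \<mu>-integral of
    \<open>exp g / W\<close>.\<close>
  define e where "e x = exp (g x - ln W) / D x" for x
  have [measurable]: "e \<in> borel_measurable \<mu>" unfolding e_def by measurable
  have e1: "(\<integral>\<^sup>+ x. ennreal (e x) \<partial>\<rho>) \<le> 1"
  proof -
    have "(\<integral>\<^sup>+ x. ennreal (e x) \<partial>\<rho>) = (\<integral>\<^sup>+ x. ennreal (D x) * ennreal (e x) \<partial>\<mu>)"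
      by (subst dens, rule nn_integral_density) auto
    \<comment> \<open>Only an inequality: where \<open>D x = 0\<close>, division by zero makes
      \<open>e x = 0\<close>.\<close>
    also have "\<dots> \<le> (\<integral>\<^sup>+ x. ennreal (1 / W) * ennreal (exp (g x)) \<partial>\<mu>)"
      using D0 W(2) by (intro nn_integral_mono)
        (auto simp: ennreal_mult[symmetric] e_def exp_diff intro!: ennreal_leI)
    also have "\<dots> = ennreal (1 / W) * (\<integral>\<^sup>+ x. ennreal (exp (g x)) \<partial>\<mu>)"
      by (rule nn_integral_cmult) simp
    also have "\<dots> \<le> ennreal (1 / W) * ennreal W"
      by (rule mult_left_mono[OF W(1)]) simp
    also have "\<dots> = 1" using W(2) by (simp add: ennreal_mult[symmetric])
    finally show ?thesis .
  qed
  have inte: "integrable \<rho> e"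
  proof (rule integrableI_nonneg)
    show "AE x in \<rho>. 0 \<le> e x" using D0 by (simp add: e_def)
    show "(\<integral>\<^sup>+ x. ennreal (e x) \<partial>\<rho>) < \<infinity>" using e1 by (rule order.strict_trans1) simp
  qed simp
  have le1: "(\<integral> x. e x \<partial>\<rho>) \<le> 1"
  proof -
    have "AE x in \<rho>. 0 \<le> e x" using D0 by (simp add: e_def)
    from nn_integral_eq_integral[OF inte this] e1 show ?thesis by simp
  qed
  have le: "AE x in \<rho>. g x \<le> L x + ln W + e x - 1"
    using L
  proof eventually_elim
    case (elim x)
    have "1 + (g x - ln W - ln (D x)) \<le> exp (g x - ln W - ln (D x))" by (rule exp_ge_add_one_self)
    also have "\<dots> = e x" using elim by (simp add: exp_diff e_def)
    finally show ?case using elim by auto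
  qed
  have intL: "integrable \<rho> (\<lambda>x. L x + ln W + e x - 1)"
    using int inte by (auto simp: L_def)
  \<comment> \<open>\<open>g\<close> is not assumed integrable under \<rho>. Its nonnegative
    integral is compared with that of the integrable majorant, so finiteness is part of the
    result.\<close>
  have "(\<integral>\<^sup>+ x. ennreal (g x) \<partial>\<rho>) \<le> (\<integral>\<^sup>+ x. ennreal (L x + ln W + e x - 1) \<partial>\<rho>)"
    by (rule nn_integral_mono_AE) (use le in \<open>auto elim!: eventually_mono intro!: ennreal_leI\<close>)
  also have "\<dots> = ennreal (\<integral> x. L x + ln W + e x - 1 \<partial>\<rho>)"
  proof (rule nn_integral_eq_integral[OF intL])
    show "AE x in \<rho>. 0 \<le> L x + ln W + e x - 1"
      using le by eventually_elim (rule order_trans[OF g0])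
  qed
  also have "(\<integral> x. L x + ln W + e x - 1 \<partial>\<rho>) = KL_divergence (exp 1) \<mu> \<rho> + ln W + (\<integral> x. e x \<partial>\<rho>) - 1"
    using int inte by (simp add: L_def KL_divergence_def P.prob_space)
  also have "ennreal \<dots> \<le> ennreal (R + ln W)"
    using KLR le1 by (intro ennreal_leI) simp
  finally show ?thesis .
qed

section \<open>The prior\<close>

lemma sigma_finite_PiM:
  assumes "finite I" "\<And>i. sigma_finite_measure (M i)"
  shows "sigma_finite_measure (PiM I M)"
  by (rule product_sigma_finite.sigma_finite[OF product_sigma_finite.intro]) (use assms in auto)

text \<open>A common dominating measure: prior, tempered posterior and comparison measure all have
  densities with respect to it, so comparing them means comparing real functions.\<close>

definition param_lebesgue :: "nat \<Rightarrow> nat \<Rightarrow> nat \<Rightarrow> parameter measure" where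
  "param_lebesgue m p K =
     (\<Pi>\<^sub>M i\<in>{..<m}. \<Pi>\<^sub>M k\<in>{..<K}. lborel) \<Otimes>\<^sub>M
     (\<Pi>\<^sub>M j\<in>{..<p}. \<Pi>\<^sub>M k\<in>{..<K}. lborel) \<Otimes>\<^sub>M
     (\<Pi>\<^sub>M k\<in>{..<K}. restrict_space lborel {0<..})"

lemma prior_eq: "prior m p K a b = density (param_lebesgue m p K) (prior_density m p K a b)"
  by (simp add: prior_def param_lebesgue_def)

lemma sigma_finite_pos_lborel: "sigma_finite_measure (restrict_space lborel {0::real<..})"
  by (rule sigma_finite_measure_restrict_space[OF sigma_finite_lborel]) simp

lemma borel_measurable_pos_lborel:
  "(\<lambda>x. x) \<in> borel_measurable (restrict_space lborel {0::real<..})"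
  by (rule measurable_restrict_space1) simp

lemma borel_measurable_inv_gamma_density_pos:
  "inv_gamma_density a b \<in> borel_measurable (restrict_space lborel {0<..})"
  by (rule measurable_restrict_space1) (simp add: borel_measurable_inv_gamma_density)

lemma borel_measurable_normal_density_compose [measurable (raw)]:
  assumes [measurable]: "f \<in> borel_measurable M" "s \<in> borel_measurable M" "g \<in> borel_measurable M"
  shows "(\<lambda>x. normal_density (f x) (s x) (g x)) \<in> borel_measurable M"
  unfolding normal_density_def by measurable

lemma measurable_PiM_const_component:
  assumes "f \<in> M \<rightarrow>\<^sub>M (\<Pi>\<^sub>M i\<in>I. N)" "i \<in> I"
  shows "(\<lambda>x. f x i) \<in> M \<rightarrow>\<^sub>M N"
  using measurable_compose[OF assms(1) measurable_component_singleton[OF assms(2)]] .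

lemma borel_measurable_matrix_entry:
  assumes "f \<in> M \<rightarrow>\<^sub>M (\<Pi>\<^sub>M i\<in>{..<m}. \<Pi>\<^sub>M k\<in>{..<K}. lborel)" "i < m" "k < K"
  shows "(\<lambda>x. f x i k) \<in> borel_measurable M"
  using measurable_PiM_const_component[OF measurable_PiM_const_component, OF assms(1)] assms(2,3)
  by fastforce

lemma measurable_param_components [measurable]:
  "i < m \<Longrightarrow> k < K \<Longrightarrow> (\<lambda>\<theta>. fst \<theta> i k) \<in> borel_measurable (param_lebesgue m p K)"
  "j < p \<Longrightarrow> k < K \<Longrightarrow> (\<lambda>\<theta>. fst (snd \<theta>) j k) \<in> borel_measurable (param_lebesgue m p K)"
  "k < K \<Longrightarrow> (\<lambda>\<theta>. snd (snd \<theta>) k) \<in> borel_measurable (param_lebesgue m p K)"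
proof -
  have "fst \<in> param_lebesgue m p K \<rightarrow>\<^sub>M (\<Pi>\<^sub>M i\<in>{..<m}. \<Pi>\<^sub>M k\<in>{..<K}. lborel)"
    unfolding param_lebesgue_def by measurable
  then show "(\<lambda>\<theta>. fst \<theta> i k) \<in> borel_measurable (param_lebesgue m p K)" if "i < m" "k < K"
    using borel_measurable_matrix_entry[of fst] that by blast
  have "(\<lambda>\<theta>. fst (snd \<theta>)) \<in> param_lebesgue m p K \<rightarrow>\<^sub>M (\<Pi>\<^sub>M i\<in>{..<p}. \<Pi>\<^sub>M k\<in>{..<K}. lborel)"
    unfolding param_lebesgue_def by measurable
  then show "(\<lambda>\<theta>. fst (snd \<theta>) j k) \<in> borel_measurable (param_lebesgue m p K)" if "j < p" "k < K"
    using borel_measurable_matrix_entry[of "\<lambda>\<theta>. fst (snd \<theta>)"] that by blast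
  have "(\<lambda>\<theta>. snd (snd \<theta>)) \<in> param_lebesgue m p K \<rightarrow>\<^sub>M (\<Pi>\<^sub>M k\<in>{..<K}. restrict_space lborel {0<..})"
    unfolding param_lebesgue_def by measurable
  from measurable_PiM_const_component[OF this]
  show "(\<lambda>\<theta>. snd (snd \<theta>) k) \<in> borel_measurable (param_lebesgue m p K)" if "k < K"
    using that by (intro measurable_compose[OF _ borel_measurable_pos_lborel]) auto
qed

lemma space_param_lebesgue_pos:
  assumes "\<theta> \<in> space (param_lebesgue m p K)" "k < K"
  shows "0 < snd (snd \<theta>) k"
  using assms by (auto simp: param_lebesgue_def space_pair_measure space_PiM space_restrict_space PiE_iff)

lemma borel_measurable_prior_density [measurable]:
  "prior_density m p K a b \<in> borel_measurable (param_lebesgue m p K)"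
  unfolding prior_density_def inv_gamma_density_def normal_density_def case_prod_beta
  by measurable

lemma prior_density_pos:
  assumes "0 < a" "0 < b" "\<theta> \<in> space (param_lebesgue m p K)"
  shows "0 < prior_density m p K a b \<theta>"
proof -
  have g: "0 < snd (snd \<theta>) k" if "k < K" for k using space_param_lebesgue_pos[OF assms(3) that] .
  have "0 < inv_gamma_density a b (snd (snd \<theta>) k)" if "k < K" for k
    using g[OF that] assms(1,2) Gamma_real_pos[OF assms(1)]
    by (simp add: inv_gamma_density_def)
  moreover have "0 < normal_density 0 (sqrt (snd (snd \<theta>) k)) x" if "k < K" for k x
    using g[OF that] by (simp add: normal_density_pos)
  ultimately show ?thesis
    by (auto simp: prior_density_def case_prod_beta intro!: mult_pos_pos prod_pos)
qed

lemma nn_integral_PiM_matrix_prod: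
  fixes f :: "nat \<Rightarrow> nat \<Rightarrow> real \<Rightarrow> real"
  assumes f [measurable]: "\<And>i k. f i k \<in> borel_measurable borel" and f0: "\<And>i k x. 0 \<le> f i k x"
  shows "(\<integral>\<^sup>+ U. ennreal (\<Prod>i<m. \<Prod>k<K. f i k (U i k)) \<partial>(\<Pi>\<^sub>M i\<in>{..<m}. \<Pi>\<^sub>M k\<in>{..<K}. lborel))
    = (\<Prod>i<m. \<Prod>k<K. \<integral>\<^sup>+ x. ennreal (f i k x) \<partial>lborel)"
proof -
  interpret inner: product_sigma_finite "\<lambda>k::nat. lborel :: real measure"
    by (rule product_sigma_finite.intro) (rule sigma_finite_lborel)
  interpret outer: product_sigma_finite "\<lambda>i::nat. \<Pi>\<^sub>M k\<in>{..<K}. (lborel :: real measure)"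
    by (rule product_sigma_finite.intro) (intro sigma_finite_PiM sigma_finite_lborel finite_lessThan)
  have "(\<integral>\<^sup>+ U. ennreal (\<Prod>i<m. \<Prod>k<K. f i k (U i k)) \<partial>(\<Pi>\<^sub>M i\<in>{..<m}. \<Pi>\<^sub>M k\<in>{..<K}. lborel))
     = (\<integral>\<^sup>+ U. (\<Prod>i<m. (\<lambda>u. \<Prod>k<K. ennreal (f i k (u k))) (U i)) \<partial>(\<Pi>\<^sub>M i\<in>{..<m}. \<Pi>\<^sub>M k\<in>{..<K}. lborel))"
    using f0 by (simp add: prod_ennreal prod_nonneg)
  also have "\<dots> = (\<Prod>i<m. \<integral>\<^sup>+ u. (\<Prod>k<K. ennreal (f i k (u k))) \<partial>(\<Pi>\<^sub>M k\<in>{..<K}. lborel))"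
    by (rule outer.product_nn_integral_prod) measurable
  also have "\<dots> = (\<Prod>i<m. \<Prod>k<K. \<integral>\<^sup>+ x. ennreal (f i k x) \<partial>lborel)"
    by (intro prod.cong refl inner.product_nn_integral_prod) auto
  finally show ?thesis .
qed

text \<open>Tonelli with the entries inside and the scales outside: given \<gamma>, each Gaussian
  factor integrates to one, for which \<open>\<gamma> k > 0\<close> is needed and supplied by the
  restricted base space. The inverse gamma factors are left.\<close>

lemma prob_space_prior:
  assumes a: "0 < a" and b: "0 < b"
  shows "prob_space (prior m p K a b)"
proof
  define G where "G = (\<Pi>\<^sub>M k\<in>{..<K}. restrict_space lborel {0::real<..})"
  define MU where "MU m = (\<Pi>\<^sub>M i\<in>{..<m}. \<Pi>\<^sub>M k\<in>{..<K}. (lborel :: real measure))" for m :: nat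
  interpret g: product_sigma_finite "\<lambda>k::nat. restrict_space lborel {0::real<..}"
    by (rule product_sigma_finite.intro) (rule sigma_finite_pos_lborel)
  interpret G: sigma_finite_measure G
    unfolding G_def by (rule g.sigma_finite) simp
  have sf: "sigma_finite_measure (MU m)" for m
    unfolding MU_def by (intro sigma_finite_PiM sigma_finite_lborel) auto
  interpret VG: pair_sigma_finite "MU p" G
    by (intro pair_sigma_finite.intro sf G.sigma_finite_measure_axioms)
  interpret UVG: pair_sigma_finite "MU m" "MU p \<Otimes>\<^sub>M G"
    by (intro pair_sigma_finite.intro sf sigma_finite_pair_measure G.sigma_finite_measure_axioms)
  define N where "N m \<gamma> U = (\<Prod>i<m. \<Prod>k<K. normal_density 0 (sqrt (\<gamma> k)) (U i k))"
    for m :: nat and \<gamma> :: "nat \<Rightarrow> real" and U :: mat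
  define I where "I \<gamma> = (\<Prod>k<K. inv_gamma_density a b (\<gamma> k))" for \<gamma>
  have I0: "0 \<le> I \<gamma>" for \<gamma>
    using Gamma_real_pos[OF a] by (auto simp: I_def inv_gamma_density_def intro!: prod_nonneg)
  have N0: "0 \<le> N m \<gamma> U" for m \<gamma> U
    by (auto simp: N_def intro!: prod_nonneg)
  have pd: "prior_density m p K a b = (\<lambda>(U, V, \<gamma>). I \<gamma> * N m \<gamma> U * N p \<gamma> V)"
    by (auto simp: prior_density_def I_def N_def)
  have meas: "prior_density m p K a b \<in> borel_measurable (MU m \<Otimes>\<^sub>M MU p \<Otimes>\<^sub>M G)"
    using borel_measurable_prior_density by (simp add: param_lebesgue_def MU_def G_def)
  have comp: "(\<lambda>\<gamma>. \<gamma> k) \<in> borel_measurable G" if "k < K" for k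
  proof -
    have "(\<lambda>\<gamma>. \<gamma>) \<in> G \<rightarrow>\<^sub>M (\<Pi>\<^sub>M k\<in>{..<K}. restrict_space lborel {0<..})" unfolding G_def by simp
    from measurable_PiM_const_component[OF this] show ?thesis
      using that by (intro measurable_compose[OF _ borel_measurable_pos_lborel]) auto
  qed
  have Nm [measurable]: "(\<lambda>U. N m \<gamma> U) \<in> borel_measurable (MU m)" for m \<gamma>
    unfolding N_def
    by (intro borel_measurable_prod measurable_compose[OF _ borel_measurable_normal_density]
        borel_measurable_matrix_entry[where m = m and K = K]) (auto simp: MU_def)
  have sd: "(\<lambda>z. sqrt (snd z k)) \<in> borel_measurable (MU p \<Otimes>\<^sub>M G)" if "k < K" for k
  proof -
    have [measurable]: "(\<lambda>z. snd z k) \<in> borel_measurable (MU p \<Otimes>\<^sub>M G)"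
      by (rule measurable_compose[OF measurable_snd comp[OF that]])
    show ?thesis by measurable
  qed
  have entry: "(\<lambda>z. fst z j k) \<in> borel_measurable (MU p \<Otimes>\<^sub>M G)" if "j < p" "k < K" for j k
    by (rule borel_measurable_matrix_entry[OF _ that]) (simp add: MU_def)
  have Nm' [measurable]: "(\<lambda>(V, \<gamma>). N p \<gamma> V) \<in> borel_measurable (MU p \<Otimes>\<^sub>M G)"
    unfolding N_def case_prod_beta
    by (intro borel_measurable_prod borel_measurable_normal_density_compose borel_measurable_const
        sd entry) auto
  have Im [measurable]: "I \<in> borel_measurable G"
    unfolding I_def inv_gamma_density_def using comp by measurable
  have N1: "(\<integral>\<^sup>+ U. ennreal (N m \<gamma> U) \<partial>MU m) = 1" if "\<gamma> \<in> space G" for m \<gamma>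
  proof -
    have "0 < \<gamma> k" if "k < K" for k
      using \<open>\<gamma> \<in> space G\<close> that by (auto simp: G_def space_PiM space_restrict_space PiE_iff)
    then have "(\<Prod>k<K. \<integral>\<^sup>+ x. ennreal (normal_density 0 (sqrt (\<gamma> k)) x) \<partial>lborel) = 1"
      by (intro prod.neutral) (auto intro: nn_integral_normal_density)
    then show ?thesis
      unfolding N_def MU_def by (subst nn_integral_PiM_matrix_prod) auto
  qed
  have "emeasure (prior m p K a b) (space (prior m p K a b))
      = (\<integral>\<^sup>+ \<theta>. ennreal (prior_density m p K a b \<theta>) \<partial>param_lebesgue m p K)"
    by (simp add: prior_eq emeasure_density cong: nn_integral_cong)
  also have "param_lebesgue m p K = MU m \<Otimes>\<^sub>M MU p \<Otimes>\<^sub>M G"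
    by (simp add: param_lebesgue_def MU_def G_def)
  also have "(\<integral>\<^sup>+ \<theta>. ennreal (prior_density m p K a b \<theta>) \<partial>(MU m \<Otimes>\<^sub>M MU p \<Otimes>\<^sub>M G)) = (\<integral>\<^sup>+ z. (\<integral>\<^sup>+ U. ennreal (prior_density m p K a b (U, z)) \<partial>MU m) \<partial>(MU p \<Otimes>\<^sub>M G))"
    by (rule UVG.nn_integral_snd[symmetric, OF measurable_compose[OF meas measurable_ennreal]])
  also have "\<dots> = (\<integral>\<^sup>+ z. ennreal (I (snd z) * N p (snd z) (fst z)) \<partial>(MU p \<Otimes>\<^sub>M G))"
  proof (rule nn_integral_cong)
    fix z assume z: "z \<in> space (MU p \<Otimes>\<^sub>M G)"
    have "(\<integral>\<^sup>+ U. ennreal (prior_density m p K a b (U, z)) \<partial>MU m)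
       = (\<integral>\<^sup>+ U. ennreal (I (snd z) * N p (snd z) (fst z)) * ennreal (N m (snd z) U) \<partial>MU m)"
      using I0 N0 by (simp add: pd case_prod_beta ennreal_mult[symmetric] mult_ac)
    also have "\<dots> = ennreal (I (snd z) * N p (snd z) (fst z)) * 1"
      using z by (subst nn_integral_cmult) (auto simp: N1 space_pair_measure)
    finally show "(\<integral>\<^sup>+ U. ennreal (prior_density m p K a b (U, z)) \<partial>MU m) = ennreal (I (snd z) * N p (snd z) (fst z))"
      by simp
  qed
  also have "\<dots> = (\<integral>\<^sup>+ \<gamma>. (\<integral>\<^sup>+ V. ennreal (I \<gamma> * N p \<gamma> V) \<partial>MU p) \<partial>G)"
    using Nm' by (subst VG.nn_integral_snd[symmetric]) (auto simp: case_prod_beta)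
  also have "\<dots> = (\<integral>\<^sup>+ \<gamma>. ennreal (I \<gamma>) \<partial>G)"
  proof (rule nn_integral_cong)
    fix \<gamma> assume \<gamma>: "\<gamma> \<in> space G"
    have "(\<integral>\<^sup>+ V. ennreal (I \<gamma> * N p \<gamma> V) \<partial>MU p) = (\<integral>\<^sup>+ V. ennreal (I \<gamma>) * ennreal (N p \<gamma> V) \<partial>MU p)"
      using I0 N0 by (simp add: ennreal_mult)
    also have "\<dots> = ennreal (I \<gamma>) * 1"
      using \<gamma> by (subst nn_integral_cmult) (auto simp: N1)
    finally show "(\<integral>\<^sup>+ V. ennreal (I \<gamma> * N p \<gamma> V) \<partial>MU p) = ennreal (I \<gamma>)" by simp
  qed
  also have "\<dots> = (\<integral>\<^sup>+ \<gamma>. (\<Prod>k<K. ennreal (inv_gamma_density a b (\<gamma> k))) \<partial>G)"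
    using Gamma_real_pos[OF a] by (simp add: I_def prod_ennreal inv_gamma_density_def)
  also have "\<dots> = (\<Prod>k<K. \<integral>\<^sup>+ x. ennreal (inv_gamma_density a b x) \<partial>restrict_space lborel {0<..})"
    unfolding G_def
    by (intro g.product_nn_integral_prod measurable_compose[OF borel_measurable_inv_gamma_density_pos measurable_ennreal]) simp
  also have "\<dots> = 1"
    using nn_integral_inv_gamma_density[OF a b] by simp
  finally show "emeasure (prior m p K a b) (space (prior m p K a b)) = 1" .
qed

section \<open>The law of the observations\<close>

text \<open>The power \<alpha> of the ratio of the two densities of one observation; the normalising
  constants cancel, so this form is positive everywhere.\<close>

definition likelihood_ratio :: "real \<Rightarrow> real \<Rightarrow> mat \<Rightarrow> mat \<Rightarrow> observation \<Rightarrow> real" where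
  "likelihood_ratio \<alpha> \<sigma> M N x =
     exp (\<alpha> * ((snd x - N (fst (fst x)) (snd (fst x)))\<^sup>2 - (snd x - M (fst (fst x)) (snd (fst x)))\<^sup>2) / (2 * \<sigma>\<^sup>2))"

text \<open>There are finitely many positions, so measurability may be checked on each set where the
  position is fixed. The matrix is allowed to vary with \<open>x\<close> too, which is what joint
  measurability in sample and parameter requires.\<close>

lemma borel_measurable_random_entry:
  fixes F :: "'a \<Rightarrow> mat"
  assumes "g \<in> S \<rightarrow>\<^sub>M count_space ({..<m} \<times> {..<p})"
    and "\<And>i j. i < m \<Longrightarrow> j < p \<Longrightarrow> (\<lambda>x. F x i j) \<in> borel_measurable S"
  shows "(\<lambda>x. F x (fst (g x)) (snd (g x))) \<in> borel_measurable S"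
  by (rule measurable_compose_countable'[where f = "\<lambda>z x. F x (fst z) (snd z)", OF _ assms(1)])
    (use assms(2) in \<open>auto intro: countable_finite\<close>)

lemma borel_measurable_likelihood_ratio:
  assumes g: "g \<in> S \<rightarrow>\<^sub>M obs_space m p"
    and F: "\<And>i j. i < m \<Longrightarrow> j < p \<Longrightarrow> (\<lambda>x. F x i j) \<in> borel_measurable S"
  shows "(\<lambda>x. likelihood_ratio \<alpha> \<sigma> (F x) N (g x)) \<in> borel_measurable S"
proof -
  have [measurable]: "(\<lambda>x. fst (g x)) \<in> S \<rightarrow>\<^sub>M count_space ({..<m} \<times> {..<p})" "(\<lambda>x. snd (g x)) \<in> borel_measurable S"
    using measurable_compose[OF g[unfolded obs_space_def] measurable_fst]
      measurable_compose[OF g[unfolded obs_space_def] measurable_snd] .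
  have [measurable]: "(\<lambda>x. F x (fst (fst (g x))) (snd (fst (g x)))) \<in> borel_measurable S"
    by (rule borel_measurable_random_entry[where m = m and p = p and g = "\<lambda>x. fst (g x)"]) (use F in auto)
  have [measurable]: "(\<lambda>x. N (fst (fst (g x))) (snd (fst (g x)))) \<in> borel_measurable S"
    by (rule borel_measurable_random_entry[where m = m and p = p and g = "\<lambda>x. fst (g x)"]) auto
  show ?thesis unfolding likelihood_ratio_def by measurable
qed

lemma measurable_obs_shift:
  "(\<lambda>((i, j), \<xi>). ((i, j), M i j + \<xi>))
    \<in> uniform_count_measure ({..<m} \<times> {..<p}) \<Otimes>\<^sub>M density lborel (normal_density 0 \<sigma>) \<rightarrow>\<^sub>M obs_space m p"
proof -
  have [measurable]: "(\<lambda>x. M (fst (fst x)) (snd (fst x)))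
      \<in> borel_measurable (count_space ({..<m} \<times> {..<p}) \<Otimes>\<^sub>M borel)"
    by (rule borel_measurable_random_entry[where m = m and p = p and g = fst]) auto
  have "(\<lambda>x. (fst x, M (fst (fst x)) (snd (fst x)) + snd x))
      \<in> count_space ({..<m} \<times> {..<p}) \<Otimes>\<^sub>M borel \<rightarrow>\<^sub>M count_space ({..<m} \<times> {..<p}) \<Otimes>\<^sub>M borel"
    by measurable
  then show ?thesis
    unfolding obs_space_def case_prod_beta by (simp cong: measurable_cong_sets)
qed

lemma sets_obs_law [simp, measurable_cong]: "sets (obs_law m p \<sigma> M) = sets (obs_space m p)"
  by (simp add: obs_law_def)

lemma prob_space_obs_law:
  assumes "1 \<le> m" "1 \<le> p" "0 < \<sigma>"
  shows "prob_space (obs_law m p \<sigma> M)"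
proof -
  interpret E: prob_space "uniform_count_measure ({..<m} \<times> {..<p})"
    by (rule prob_space_uniform_count_measure) (use assms in \<open>auto simp: lessThan_empty_iff\<close>)
  interpret N: prob_space "density lborel (normal_density 0 \<sigma>)"
    by (rule prob_space_normal_density) fact
  interpret P: pair_prob_space "uniform_count_measure ({..<m} \<times> {..<p})" "density lborel (normal_density 0 \<sigma>)" ..
  show ?thesis
    unfolding obs_law_def by (rule P.prob_space_distr[OF measurable_obs_shift])
qed

lemma nn_integral_obs_law:
  assumes "0 < \<sigma>" and f: "f \<in> borel_measurable (obs_space m p)"
  shows "(\<integral>\<^sup>+ x. f x \<partial>obs_law m p \<sigma> M) =
    (\<Sum>i<m. \<Sum>j<p. ennreal (1 / (real m * real p)) *
      (\<integral>\<^sup>+ \<xi>. ennreal (normal_density 0 \<sigma> \<xi>) * f ((i, j), M i j + \<xi>) \<partial>lborel))"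
proof -
  interpret N: prob_space "density lborel (normal_density 0 \<sigma>)"
    by (rule prob_space_normal_density) fact
  let ?E = "{..<m} \<times> {..<p}"
  define T where "T = (\<lambda>((i, j), \<xi>). ((i, j), M i j + \<xi>))"
  have fm: "(\<lambda>x. f (T x))
     \<in> borel_measurable (uniform_count_measure ?E \<Otimes>\<^sub>M density lborel (normal_density 0 \<sigma>))"
    unfolding T_def by (rule measurable_compose[OF measurable_obs_shift f])
  have fz: "(\<lambda>\<xi>. f (z, M (fst z) (snd z) + \<xi>)) \<in> borel_measurable borel" if "z \<in> ?E" for z
  proof (rule measurable_compose[OF _ f])
    show "(\<lambda>\<xi>. (z, M (fst z) (snd z) + \<xi>)) \<in> borel \<rightarrow>\<^sub>M obs_space m p"
      unfolding obs_space_def using that by (intro measurable_Pair) auto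
  qed
  have "(\<integral>\<^sup>+ x. f x \<partial>obs_law m p \<sigma> M) = (\<integral>\<^sup>+ x. f (T x) \<partial>(uniform_count_measure ?E \<Otimes>\<^sub>M density lborel (normal_density 0 \<sigma>)))"
    unfolding obs_law_def T_def by (rule nn_integral_distr[OF measurable_obs_shift]) (use f in simp)
  also have "\<dots> = (\<integral>\<^sup>+ z. \<integral>\<^sup>+ \<xi>. f (z, M (fst z) (snd z) + \<xi>) \<partial>density lborel (normal_density 0 \<sigma>) \<partial>uniform_count_measure ?E)"
    by (subst N.nn_integral_fst[OF fm, symmetric]) (simp add: T_def case_prod_beta)
  also have "\<dots> = (\<Sum>z\<in>?E. ennreal (1 / real (card ?E)) * (\<integral>\<^sup>+ \<xi>. f (z, M (fst z) (snd z) + \<xi>) \<partial>density lborel (normal_density 0 \<sigma>)))"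
    unfolding uniform_count_measure_def by (subst nn_integral_point_measure_finite) auto
  also have "\<dots> = (\<Sum>z\<in>?E. ennreal (1 / (real m * real p)) * (\<integral>\<^sup>+ \<xi>. ennreal (normal_density 0 \<sigma> \<xi>) * f (z, M (fst z) (snd z) + \<xi>) \<partial>lborel))"
    using fz by (intro sum.cong refl arg_cong2[of _ _ _ _ "(*)"] nn_integral_density) auto
  finally show ?thesis
    by (simp add: sum.cartesian_product case_prod_beta)
qed

text \<open>Completing the square: the tilt moves the mean of the noise to
  \<open>\<alpha> * d\<close> and leaves behind exactly the summand of
  \<open>renyi_dist\<close>.\<close>

lemma normal_density_exp_shift:
  assumes "0 < \<sigma>"
  shows "normal_density 0 \<sigma> \<xi> * exp (\<alpha> * (\<xi>\<^sup>2 - (\<xi> - d)\<^sup>2) / (2 * \<sigma>\<^sup>2))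
    = exp (\<alpha> * (\<alpha> - 1) * d\<^sup>2 / (2 * \<sigma>\<^sup>2)) * normal_density (\<alpha> * d) \<sigma> \<xi>"
proof -
  have "- \<xi>\<^sup>2 / (2 * \<sigma>\<^sup>2) + \<alpha> * (\<xi>\<^sup>2 - (\<xi> - d)\<^sup>2) / (2 * \<sigma>\<^sup>2)
     = \<alpha> * (\<alpha> - 1) * d\<^sup>2 / (2 * \<sigma>\<^sup>2) + - (\<xi> - \<alpha> * d)\<^sup>2 / (2 * \<sigma>\<^sup>2)"
    unfolding add_divide_distrib[symmetric] by (simp add: power2_eq_square algebra_simps)
  then have "exp (- \<xi>\<^sup>2 / (2 * \<sigma>\<^sup>2)) * exp (\<alpha> * (\<xi>\<^sup>2 - (\<xi> - d)\<^sup>2) / (2 * \<sigma>\<^sup>2))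
     = exp (\<alpha> * (\<alpha> - 1) * d\<^sup>2 / (2 * \<sigma>\<^sup>2)) * exp (- (\<xi> - \<alpha> * d)\<^sup>2 / (2 * \<sigma>\<^sup>2))"
    by (simp only: exp_add[symmetric])
  then show ?thesis
    unfolding normal_density_def by (simp add: mult_ac)
qed

lemma renyi_exp:
  assumes "1 \<le> m" "1 \<le> p" "\<alpha> < 1"
  shows "exp ((\<alpha> - 1) * renyi_dist m p \<alpha> \<sigma> M N) = 1 / (real m * real p) *
       (\<Sum>i<m. \<Sum>j<p. exp (\<alpha> * (\<alpha> - 1) * (M i j - N i j)\<^sup>2 / (2 * \<sigma>\<^sup>2)))"
proof -
  have "0 < (\<Sum>i<m. \<Sum>j<p. exp (\<alpha> * (\<alpha> - 1) * (M i j - N i j)\<^sup>2 / (2 * \<sigma>\<^sup>2)))"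
    using assms by (intro sum_pos) (auto simp: lessThan_empty_iff)
  then show ?thesis
    using assms unfolding renyi_dist_def by simp
qed

lemma renyi_nonneg:
  assumes "1 \<le> m" "1 \<le> p" "0 < \<alpha>" "\<alpha> < 1"
  shows "0 \<le> renyi_dist m p \<alpha> \<sigma> M N"
proof -
  have "(\<Sum>i<m. \<Sum>j<p. exp (\<alpha> * (\<alpha> - 1) * (M i j - N i j)\<^sup>2 / (2 * \<sigma>\<^sup>2))) \<le> (\<Sum>i<m. \<Sum>j<p. 1)"
  proof (intro sum_mono)
    fix i j
    have "\<alpha> * (\<alpha> - 1) * (M i j - N i j)\<^sup>2 \<le> 0"
      using assms by (intro mult_nonpos_nonneg mult_nonneg_nonpos) auto
    then show "exp (\<alpha> * (\<alpha> - 1) * (M i j - N i j)\<^sup>2 / (2 * \<sigma>\<^sup>2)) \<le> 1"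
      by (simp add: divide_nonpos_nonneg)
  qed
  then have "exp ((\<alpha> - 1) * renyi_dist m p \<alpha> \<sigma> M N) \<le> 1"
    unfolding renyi_exp[OF assms(1,2,4)] using assms by (simp add: divide_le_eq)
  then show ?thesis using assms by (simp add: mult_le_0_iff)
qed

text \<open>This is where the Renyi divergence enters: the tilted density integrates to one at each
  position, and averaging the leftover factors over the positions gives the argument of the
  logarithm in \<open>renyi_dist\<close>.\<close>

lemma nn_integral_likelihood_ratio:
  assumes "1 \<le> m" "1 \<le> p" "0 < \<sigma>" "0 < \<alpha>" "\<alpha> < 1"
  shows "(\<integral>\<^sup>+ x. ennreal (likelihood_ratio \<alpha> \<sigma> M N x) \<partial>obs_law m p \<sigma> N)
     = ennreal (exp ((\<alpha> - 1) * renyi_dist m p \<alpha> \<sigma> M N))"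
proof -
  have "(\<integral>\<^sup>+ \<xi>. ennreal (normal_density 0 \<sigma> \<xi>) * ennreal (likelihood_ratio \<alpha> \<sigma> M N ((i, j), N i j + \<xi>)) \<partial>lborel)
    = ennreal (exp (\<alpha> * (\<alpha> - 1) * (M i j - N i j)\<^sup>2 / (2 * \<sigma>\<^sup>2)))" for i j
  proof -
    define d where "d = M i j - N i j"
    have "(\<integral>\<^sup>+ \<xi>. ennreal (normal_density 0 \<sigma> \<xi>) * ennreal (likelihood_ratio \<alpha> \<sigma> M N ((i, j), N i j + \<xi>)) \<partial>lborel)
      = (\<integral>\<^sup>+ \<xi>. ennreal (normal_density 0 \<sigma> \<xi> * exp (\<alpha> * (\<xi>\<^sup>2 - (\<xi> - d)\<^sup>2) / (2 * \<sigma>\<^sup>2))) \<partial>lborel)"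
      by (simp add: likelihood_ratio_def d_def ennreal_mult algebra_simps)
    also have "\<dots> = (\<integral>\<^sup>+ \<xi>. ennreal (exp (\<alpha> * (\<alpha> - 1) * d\<^sup>2 / (2 * \<sigma>\<^sup>2))) * ennreal (normal_density (\<alpha> * d) \<sigma> \<xi>) \<partial>lborel)"
      using assms(3) by (simp only: normal_density_exp_shift ennreal_mult[OF exp_ge_zero normal_density_nonneg])
    also have "\<dots> = ennreal (exp (\<alpha> * (\<alpha> - 1) * d\<^sup>2 / (2 * \<sigma>\<^sup>2)))"
      using assms(3) by (subst nn_integral_cmult) (auto simp: nn_integral_normal_density)
    finally show ?thesis by (simp add: d_def)
  qed
  moreover have "(\<lambda>x. ennreal (likelihood_ratio \<alpha> \<sigma> M N x)) \<in> borel_measurable (obs_space m p)"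
    using borel_measurable_likelihood_ratio[of "\<lambda>x. x" "obs_space m p" m p "\<lambda>_. M"] by simp
  ultimately show ?thesis
    using assms(3) unfolding renyi_exp[OF assms(1,2,5)]
    by (simp add: nn_integral_obs_law ennreal_mult[symmetric] sum_ennreal sum_nonneg sum_distrib_left
       sum_divide_distrib)
qed

lemma nn_integral_abs_noise:
  assumes "1 \<le> m" "1 \<le> p" "0 < \<sigma>"
  shows "(\<integral>\<^sup>+ x. ennreal \<bar>snd x - N (fst (fst x)) (snd (fst x))\<bar> \<partial>obs_law m p \<sigma> N) \<le> ennreal \<sigma>"
proof -
  \<comment> \<open>The mean of the absolute noise is \<open>\<sigma> * sqrt (2 / pi)\<close>; the
    numerical factor is dropped.\<close>
  have s: "sqrt (2 / pi) \<le> 1"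
    using pi_gt3 by simp
  have "(\<integral>\<^sup>+ \<xi>. ennreal (normal_density 0 \<sigma> \<xi>) * ennreal \<bar>\<xi>\<bar> \<partial>lborel) = ennreal (\<sigma> * sqrt (2 / pi))"
  proof -
    have "has_bochner_integral lborel (\<lambda>x. normal_density 0 \<sigma> x * \<bar>x\<bar>) (\<sigma> * sqrt (2 / pi))"
      using normal_moment_abs_odd[OF assms(3), of 0 0] by simp
    then have "(\<integral>\<^sup>+ \<xi>. ennreal (normal_density 0 \<sigma> \<xi> * \<bar>\<xi>\<bar>) \<partial>lborel) = ennreal (\<sigma> * sqrt (2 / pi))"
      by (subst nn_integral_eq_integral) (auto simp: has_bochner_integral_iff)
    then show ?thesis by (simp add: ennreal_mult)
  qed
  moreover have "(\<lambda>x. ennreal \<bar>snd x - N (fst (fst x)) (snd (fst x))\<bar>) \<in> borel_measurable (obs_space m p)"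
  proof -
    have [measurable]: "(\<lambda>x. N (fst (fst x)) (snd (fst x))) \<in> borel_measurable (obs_space m p)"
      unfolding obs_space_def by (rule borel_measurable_random_entry[where m = m and p = p and g = fst]) auto
    have [measurable]: "snd \<in> borel_measurable (obs_space m p)"
      unfolding obs_space_def by measurable
    show ?thesis by measurable
  qed
  ultimately have "(\<integral>\<^sup>+ x. ennreal \<bar>snd x - N (fst (fst x)) (snd (fst x))\<bar> \<partial>obs_law m p \<sigma> N)
     = (\<Sum>i<m. \<Sum>j<p. ennreal (1 / (real m * real p)) * ennreal (\<sigma> * sqrt (2 / pi)))"
    using assms by (simp add: nn_integral_obs_law)
  also have "\<dots> = ennreal (\<Sum>i<m. \<Sum>j<p. 1 / (real m * real p) * (\<sigma> * sqrt (2 / pi)))"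
  proof -
    have "0 \<le> 1 / (real m * real p)" "0 \<le> \<sigma> * sqrt (2 / pi)" using assms by auto
    then have "0 \<le> 1 / (real m * real p) * (\<sigma> * sqrt (2 / pi))" by (rule mult_nonneg_nonneg)
    then show ?thesis
      by (simp only: ennreal_mult[OF \<open>0 \<le> 1 / (real m * real p)\<close> \<open>0 \<le> \<sigma> * sqrt (2 / pi)\<close>, symmetric]
        sum_ennreal sum_nonneg)
  qed
  also have "(\<Sum>i<m. \<Sum>j<p. 1 / (real m * real p) * (\<sigma> * sqrt (2 / pi))) = \<sigma> * sqrt (2 / pi)"
    using assms by simp
  also have "ennreal (\<sigma> * sqrt (2 / pi)) \<le> ennreal \<sigma>"
    using assms s by (intro ennreal_leI) (simp add: mult_left_le)
  finally show ?thesis .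
qed

text \<open>Markov's inequality gives failure probability \<open>1 / t\<close> for each variable,
  and the union bound adds the two; this is the 2 in \<open>2 / (n \<epsilon>)\<close>. The
  variables are extended because the exponential moment could be infinite for some samples.\<close>

lemma prob_two_markov:
  fixes u v :: "'a \<Rightarrow> ennreal"
  assumes "prob_space M" and [measurable]: "u \<in> borel_measurable M" "v \<in> borel_measurable M"
    and u: "(\<integral>\<^sup>+ x. u x \<partial>M) \<le> 1" and v: "(\<integral>\<^sup>+ x. v x \<partial>M) \<le> ennreal c" and c: "0 < c" and t: "0 < t"
  shows "1 - 2 / t \<le> measure M {x \<in> space M. u x \<le> ennreal t \<and> v x \<le> ennreal (c * t)}"
proof -
  interpret prob_space M by fact
  have markov: "prob {x \<in> space M. ennreal (d * t) < w x} \<le> 1 / t"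
    if [measurable]: "w \<in> borel_measurable M" and w: "(\<integral>\<^sup>+ x. w x \<partial>M) \<le> ennreal d" and d: "0 < d" for w d
  proof -
    have "emeasure M {x \<in> space M. ennreal (d * t) < w x} \<le> emeasure M ({x \<in> space M. 1 \<le> ennreal (1 / (d * t)) * w x})"
    proof (rule emeasure_mono)
      show "{x \<in> space M. ennreal (d * t) < w x} \<subseteq> {x \<in> space M. 1 \<le> ennreal (1 / (d * t)) * w x}"
      proof safe
        fix x assume "ennreal (d * t) < w x"
        then have "ennreal (1 / (d * t)) * ennreal (d * t) \<le> ennreal (1 / (d * t)) * w x"
          by (intro mult_left_mono) auto
        then show "1 \<le> ennreal (1 / (d * t)) * w x"
          using d t by (simp add: ennreal_mult[symmetric])
      qed
    qed measurable
    also have "\<dots> \<le> ennreal (1 / (d * t)) * (\<integral>\<^sup>+ x. w x * indicator (space M) x \<partial>M)"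
      using nn_integral_Markov_inequality[of w "space M" M "ennreal (1 / (d * t))"] by simp
    also have "\<dots> \<le> ennreal (1 / (d * t)) * ennreal d"
      using w by (intro mult_left_mono) (auto cong: nn_integral_cong)
    also have "\<dots> = ennreal (1 / t)"
      using d t by (simp add: ennreal_mult[symmetric])
    finally show ?thesis
      using t by (simp add: emeasure_eq_measure)
  qed
  let ?G = "{x \<in> space M. u x \<le> ennreal t \<and> v x \<le> ennreal (c * t)}"
  have "1 - prob ?G = prob (space M - ?G)" by (subst prob_compl) auto
  also have "space M - ?G = {x \<in> space M. ennreal (1 * t) < u x} \<union> {x \<in> space M. ennreal (c * t) < v x}"
    by (auto simp: not_le)
  also have "prob \<dots> \<le> 1 / t + 1 / t"
    using markov[of u 1] markov[of v c] u v c
    by (intro order_trans[OF measure_Un_le] add_mono) auto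
  finally show ?thesis by simp
qed

section \<open>Mean-field measures with densities\<close>

lemma mean_field_prob_space:
  assumes "\<rho> \<in> mean_field m p K"
  shows "prob_space \<rho>" and "sets \<rho> = sets (param_lebesgue m p K)"
proof -
  from assms obtain \<rho>U \<rho>V \<rho>\<gamma> where \<rho>: "\<rho> = (\<Pi>\<^sub>M i\<in>{..<m}. \<rho>U i) \<Otimes>\<^sub>M (\<Pi>\<^sub>M j\<in>{..<p}. \<rho>V j) \<Otimes>\<^sub>M (\<Pi>\<^sub>M k\<in>{..<K}. \<rho>\<gamma> k)"
    and U: "\<And>i. i < m \<Longrightarrow> \<rho>U i \<in> space (prob_algebra (\<Pi>\<^sub>M k\<in>{..<K}. borel))"
    and V: "\<And>j. j < p \<Longrightarrow> \<rho>V j \<in> space (prob_algebra (\<Pi>\<^sub>M k\<in>{..<K}. borel))"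
    and \<gamma>: "\<And>k. k < K \<Longrightarrow> \<rho>\<gamma> k \<in> space (prob_algebra (restrict_space borel {0<..}))"
    unfolding mean_field_def by blast
  show "prob_space \<rho>"
    unfolding \<rho> using U V \<gamma>
    by (intro prob_space_pair prob_space_PiM) (auto simp: space_prob_algebra)
  show "sets \<rho> = sets (param_lebesgue m p K)"
    unfolding \<rho> param_lebesgue_def
    by (intro sets_pair_measure_cong sets_PiM_cong refl)
      (use U V \<gamma> in \<open>auto simp: space_prob_algebra cong: sets_PiM_cong intro!: sets_restrict_space_cong\<close>)
qed

lemma prob_space_density_of_integral:
  fixes f :: "'a \<Rightarrow> ennreal"
  assumes [measurable]: "f \<in> borel_measurable M" and "(\<integral>\<^sup>+ x. f x \<partial>M) = 1"
  shows "prob_space (density M f)"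
  by (rule prob_spaceI) (simp add: emeasure_density assms(2) cong: nn_integral_cong)

text \<open>One factor per entry: independence of all entries, which is stronger than the
  independence of rows that \<open>mean_field\<close> asks for. The bracketing follows the nesting
  of the product measure.\<close>

definition mean_field_density ::
    "nat \<Rightarrow> nat \<Rightarrow> nat \<Rightarrow> (nat \<Rightarrow> nat \<Rightarrow> real \<Rightarrow> real) \<Rightarrow> (nat \<Rightarrow> nat \<Rightarrow> real \<Rightarrow> real) \<Rightarrow> (nat \<Rightarrow> real \<Rightarrow> real) \<Rightarrow>
     parameter \<Rightarrow> real" where
  "mean_field_density m p K u w g = (\<lambda>(U, V, \<gamma>).
     (\<Prod>i<m. \<Prod>k<K. u i k (U i k)) * ((\<Prod>j<p. \<Prod>k<K. w j k (V j k)) * (\<Prod>k<K. g k (\<gamma> k))))"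

lemma prob_space_PiM_density:
  fixes u :: "nat \<Rightarrow> real \<Rightarrow> real"
  assumes [measurable]: "\<And>k. u k \<in> borel_measurable borel" and u0: "\<And>k x. 0 \<le> u k x"
    and u1: "\<And>k. (\<integral>\<^sup>+ x. ennreal (u k x) \<partial>lborel) = 1"
  shows "prob_space (density lborel (u k))"
    and "(\<Pi>\<^sub>M k\<in>{..<K}. density lborel (u k)) = density (\<Pi>\<^sub>M k\<in>{..<K}. lborel) (\<lambda>x. ennreal (\<Prod>k<K. u k (x k)))"
    and "prob_space (\<Pi>\<^sub>M k\<in>{..<K}. density lborel (u k))"
proof -
  show p: "prob_space (density lborel (u k))" for k
    by (rule prob_space_density_of_integral) (use u1 in auto)
  have sf: "sigma_finite_measure (density lborel (u k))" for k
    using p[of k] by (rule prob_space_imp_sigma_finite)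
  show "(\<Pi>\<^sub>M k\<in>{..<K}. density lborel (u k)) = density (\<Pi>\<^sub>M k\<in>{..<K}. lborel) (\<lambda>x. ennreal (\<Prod>k<K. u k (x k)))"
    using sf u0 by (subst PiM_density) (auto simp: prod_ennreal sigma_finite_lborel)
  show "prob_space (\<Pi>\<^sub>M k\<in>{..<K}. density lborel (u k))"
    by (intro prob_space_PiM p)
qed

lemma PiM_matrix_density:
  fixes u :: "nat \<Rightarrow> nat \<Rightarrow> real \<Rightarrow> real"
  assumes [measurable]: "\<And>i k. u i k \<in> borel_measurable borel" and u0: "\<And>i k x. 0 \<le> u i k x"
    and u1: "\<And>i k. (\<integral>\<^sup>+ x. ennreal (u i k x) \<partial>lborel) = 1"
  shows "(\<Pi>\<^sub>M i\<in>{..<m}. \<Pi>\<^sub>M k\<in>{..<K}. density lborel (u i k))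
    = density (\<Pi>\<^sub>M i\<in>{..<m}. \<Pi>\<^sub>M k\<in>{..<K}. lborel) (\<lambda>U. ennreal (\<Prod>i<m. \<Prod>k<K. u i k (U i k)))"
proof -
  have eq: "(\<Pi>\<^sub>M k\<in>{..<K}. density lborel (u i k)) = density (\<Pi>\<^sub>M k\<in>{..<K}. lborel) (\<lambda>x. ennreal (\<Prod>k<K. u i k (x k)))" for i
    by (rule prob_space_PiM_density(2)) (use u0 u1 in auto)
  have sf: "sigma_finite_measure (\<Pi>\<^sub>M k\<in>{..<K}. density lborel (u i k))" for i
    by (rule prob_space_imp_sigma_finite, rule prob_space_PiM_density(3)) (use u0 u1 in auto)
  have meas: "(\<lambda>x. ennreal (\<Prod>k<K. u i k (x k))) \<in> borel_measurable (\<Pi>\<^sub>M k\<in>{..<K}. lborel)" for i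
    by measurable
  have "(\<Pi>\<^sub>M i\<in>{..<m}. \<Pi>\<^sub>M k\<in>{..<K}. density lborel (u i k))
     = (\<Pi>\<^sub>M i\<in>{..<m}. density (\<Pi>\<^sub>M k\<in>{..<K}. lborel) (\<lambda>x. ennreal (\<Prod>k<K. u i k (x k))))"
    by (simp add: eq)
  also have "\<dots> = density (\<Pi>\<^sub>M i\<in>{..<m}. \<Pi>\<^sub>M k\<in>{..<K}. lborel) (\<lambda>U. \<Prod>i<m. ennreal (\<Prod>k<K. u i k (U i k)))"
    using meas sf unfolding eq
    by (intro PiM_density sigma_finite_PiM sigma_finite_lborel) auto
  also have "(\<lambda>U. \<Prod>i<m. ennreal (\<Prod>k<K. u i k (U i k))) = (\<lambda>U::mat. ennreal (\<Prod>i<m. \<Prod>k<K. u i k (U i k)))"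
    using u0 by (simp add: prod_ennreal prod_nonneg)
  finally show ?thesis .
qed

text \<open>Densities multiply when measures do, applied from the inside out: entries to rows, rows
  to matrices, matrices and scales to the full parameter. This exhibits the marginals that
  membership in \<open>mean_field\<close> requires.\<close>

lemma density_mean_field:
  assumes u [measurable]: "\<And>i k. u i k \<in> borel_measurable borel" and u0: "\<And>i k x. 0 \<le> u i k x"
    and u1: "\<And>i k. (\<integral>\<^sup>+ x. ennreal (u i k x) \<partial>lborel) = 1"
    and w [measurable]: "\<And>j k. w j k \<in> borel_measurable borel" and w0: "\<And>j k x. 0 \<le> w j k x"
    and w1: "\<And>j k. (\<integral>\<^sup>+ x. ennreal (w j k x) \<partial>lborel) = 1"
    and g: "\<And>k. g k \<in> borel_measurable borel" and g0: "\<And>k x. 0 \<le> g k x"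
    and g1: "\<And>k. (\<integral>\<^sup>+ x. ennreal (g k x) \<partial>restrict_space lborel {0<..}) = 1"
  shows "density (param_lebesgue m p K) (mean_field_density m p K u w g) \<in> mean_field m p K"
    and "mean_field_density m p K u w g \<in> borel_measurable (param_lebesgue m p K)"
proof -
  let ?P = "restrict_space lborel {0::real<..}"
  let ?L = "\<lambda>m. \<Pi>\<^sub>M i\<in>{..<m::nat}. \<Pi>\<^sub>M k\<in>{..<K}. (lborel :: real measure)"
  have gm: "g k \<in> borel_measurable ?P" for k
    by (rule measurable_restrict_space1) (simp add: g)
  have gp: "prob_space (density ?P (g k))" for k
    by (rule prob_space_density_of_integral[OF measurable_compose[OF gm measurable_ennreal] g1])
  have geq: "(\<Pi>\<^sub>M k\<in>{..<K}. density ?P (g k)) = density (\<Pi>\<^sub>M k\<in>{..<K}. ?P) (\<lambda>x. ennreal (\<Prod>k<K. g k (x k)))"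
    using gm g0 gp
    by (subst PiM_density) (auto simp: prod_ennreal sigma_finite_pos_lborel intro: prob_space_imp_sigma_finite)
  note ueq = PiM_matrix_density[of u, OF u u0 u1, where m = m and K = K]
  note weq = PiM_matrix_density[of w, OF w w0 w1, where m = p and K = K]
  have comp: "(\<lambda>\<gamma>. \<gamma> k) \<in> (\<Pi>\<^sub>M k\<in>{..<K}. ?P) \<rightarrow>\<^sub>M ?P" if "k < K" for k
    using that by (intro measurable_component_singleton) auto
  have gpm: "(\<lambda>x. ennreal (\<Prod>k<K. g k (x k))) \<in> borel_measurable (\<Pi>\<^sub>M k\<in>{..<K}. ?P)"
    by (intro measurable_compose[OF _ measurable_ennreal] borel_measurable_prod measurable_compose[OF comp gm]) auto
  have upm: "(\<lambda>U. ennreal (\<Prod>i<m. \<Prod>k<K. u i k (U i k))) \<in> borel_measurable (?L m)"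
    if "\<And>i k. u i k \<in> borel_measurable borel" for u and m :: nat
    by (intro measurable_compose[OF _ measurable_ennreal] borel_measurable_prod
        measurable_compose[OF borel_measurable_matrix_entry that]) auto
  have pW: "prob_space (\<Pi>\<^sub>M j\<in>{..<p}. \<Pi>\<^sub>M k\<in>{..<K}. density lborel (w j k))"
    by (intro prob_space_PiM prob_space_PiM_density(1) w w0 w1)
  have pG: "prob_space (\<Pi>\<^sub>M k\<in>{..<K}. density ?P (g k))"
    by (intro prob_space_PiM gp)
  have "(\<Pi>\<^sub>M j\<in>{..<p}. \<Pi>\<^sub>M k\<in>{..<K}. density lborel (w j k)) \<Otimes>\<^sub>M (\<Pi>\<^sub>M k\<in>{..<K}. density ?P (g k))
    = density (?L p \<Otimes>\<^sub>M (\<Pi>\<^sub>M k\<in>{..<K}. ?P)) (\<lambda>(V, \<gamma>). ennreal (\<Prod>j<p. \<Prod>k<K. w j k (V j k)) * ennreal (\<Prod>k<K. g k (\<gamma> k)))"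
    unfolding weq geq
    by (rule pair_measure_density[OF upm[OF w] gpm])
      (use pG in \<open>auto simp: geq[symmetric] intro: prob_space_imp_sigma_finite sigma_finite_PiM sigma_finite_pos_lborel\<close>)
  also have "(\<lambda>(V::mat, \<gamma>). ennreal (\<Prod>j<p. \<Prod>k<K. w j k (V j k)) * ennreal (\<Prod>k<K. g k (\<gamma> k)))
     = (\<lambda>(V, \<gamma>). ennreal ((\<Prod>j<p. \<Prod>k<K. w j k (V j k)) * (\<Prod>k<K. g k (\<gamma> k))))"
    using w0 g0 by (simp add: ennreal_mult prod_nonneg fun_eq_iff)
  finally have wg: "(\<Pi>\<^sub>M j\<in>{..<p}. \<Pi>\<^sub>M k\<in>{..<K}. density lborel (w j k)) \<Otimes>\<^sub>M (\<Pi>\<^sub>M k\<in>{..<K}. density ?P (g k))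
    = density (?L p \<Otimes>\<^sub>M (\<Pi>\<^sub>M k\<in>{..<K}. ?P)) (\<lambda>(V, \<gamma>). ennreal ((\<Prod>j<p. \<Prod>k<K. w j k (V j k)) * (\<Prod>k<K. g k (\<gamma> k))))" .
  have wgm: "(\<lambda>(V, \<gamma>). ennreal ((\<Prod>j<p. \<Prod>k<K. w j k (V j k)) * (\<Prod>k<K. g k (\<gamma> k)))) \<in> borel_measurable (?L p \<Otimes>\<^sub>M (\<Pi>\<^sub>M k\<in>{..<K}. ?P))"
    unfolding case_prod_beta using w0 g0
    by (simp add: ennreal_mult prod_nonneg)
      (intro borel_measurable_times_ennreal measurable_compose[OF measurable_fst upm[OF w]] measurable_compose[OF measurable_snd gpm])
  have pWG: "prob_space ((\<Pi>\<^sub>M j\<in>{..<p}. \<Pi>\<^sub>M k\<in>{..<K}. density lborel (w j k)) \<Otimes>\<^sub>M (\<Pi>\<^sub>M k\<in>{..<K}. density ?P (g k)))"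
    by (intro prob_space_pair pW pG)
  have sfB: "sigma_finite_measure (?L p \<Otimes>\<^sub>M (\<Pi>\<^sub>M k\<in>{..<K}. ?P))"
    by (intro sigma_finite_pair_measure sigma_finite_PiM sigma_finite_lborel sigma_finite_pos_lborel finite_lessThan)
  have "(\<Pi>\<^sub>M i\<in>{..<m}. \<Pi>\<^sub>M k\<in>{..<K}. density lborel (u i k)) \<Otimes>\<^sub>M
      ((\<Pi>\<^sub>M j\<in>{..<p}. \<Pi>\<^sub>M k\<in>{..<K}. density lborel (w j k)) \<Otimes>\<^sub>M (\<Pi>\<^sub>M k\<in>{..<K}. density ?P (g k)))
    = density (?L m \<Otimes>\<^sub>M (?L p \<Otimes>\<^sub>M (\<Pi>\<^sub>M k\<in>{..<K}. ?P)))
       (\<lambda>(U, V\<gamma>). ennreal (\<Prod>i<m. \<Prod>k<K. u i k (U i k)) *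
         (case V\<gamma> of (V, \<gamma>) \<Rightarrow> ennreal ((\<Prod>j<p. \<Prod>k<K. w j k (V j k)) * (\<Prod>k<K. g k (\<gamma> k)))))"
    unfolding wg ueq
    by (rule pair_measure_density[OF upm[OF u] wgm sfB prob_space_imp_sigma_finite[OF pWG[unfolded wg]]])
  also have "(\<lambda>(U::mat, V\<gamma>::mat \<times> (nat \<Rightarrow> real)). ennreal (\<Prod>i<m. \<Prod>k<K. u i k (U i k)) *
         (case V\<gamma> of (V, \<gamma>) \<Rightarrow> ennreal ((\<Prod>j<p. \<Prod>k<K. w j k (V j k)) * (\<Prod>k<K. g k (\<gamma> k)))))
     = (\<lambda>\<theta>. ennreal (mean_field_density m p K u w g \<theta>))"
    using u0 w0 g0 by (auto simp: mean_field_density_def ennreal_mult prod_nonneg fun_eq_iff)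
  finally have eq: "density (param_lebesgue m p K) (mean_field_density m p K u w g) =
     (\<Pi>\<^sub>M i\<in>{..<m}. \<Pi>\<^sub>M k\<in>{..<K}. density lborel (u i k)) \<Otimes>\<^sub>M
      (\<Pi>\<^sub>M j\<in>{..<p}. \<Pi>\<^sub>M k\<in>{..<K}. density lborel (w j k)) \<Otimes>\<^sub>M (\<Pi>\<^sub>M k\<in>{..<K}. density ?P (g k))"
    unfolding param_lebesgue_def by simp
  have "(\<Pi>\<^sub>M k\<in>{..<K}. density lborel (u i k)) \<in> space (prob_algebra (\<Pi>\<^sub>M k\<in>{..<K}. borel))"
    if "\<And>i k. u i k \<in> borel_measurable borel" "\<And>i k x. 0 \<le> u i k x" "\<And>i k. (\<integral>\<^sup>+ x. ennreal (u i k x) \<partial>lborel) = 1"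
    for u :: "nat \<Rightarrow> nat \<Rightarrow> real \<Rightarrow> real" and i
    using prob_space_PiM_density(3)[of "u i", OF that]
    by (auto simp: space_prob_algebra intro!: sets_PiM_cong)
  moreover have "density ?P (g k) \<in> space (prob_algebra (restrict_space borel {0<..}))" for k
    using gp by (auto simp: space_prob_algebra intro!: sets_restrict_space_cong)
  ultimately show "density (param_lebesgue m p K) (mean_field_density m p K u w g) \<in> mean_field m p K"
    unfolding eq mean_field_def using u u0 u1 w w0 w1
    by (intro CollectI exI[of _ "\<lambda>i. \<Pi>\<^sub>M k\<in>{..<K}. density lborel (u i k)"]
      exI[of _ "\<lambda>j. \<Pi>\<^sub>M k\<in>{..<K}. density lborel (w j k)"] exI[of _ "\<lambda>k. density ?P (g k)"] conjI refl) auto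
  show "mean_field_density m p K u w g \<in> borel_measurable (param_lebesgue m p K)"
    unfolding mean_field_density_def case_prod_beta
    by (intro borel_measurable_times borel_measurable_prod measurable_compose[OF measurable_param_components(1) u]
       measurable_compose[OF measurable_param_components(2) w] measurable_compose[OF measurable_param_components(3) g]) auto
qed

section \<open>Comparing the factors of the densities\<close>

definition uniform_density :: "real \<Rightarrow> real \<Rightarrow> real \<Rightarrow> real" where
  "uniform_density c d x = indicator {c..d} x / (d - c)"

text \<open>\<open>v\<close> is a variance, whereas \<open>normal_density\<close> takes a standard
  deviation. The mass is never evaluated; a lower bound for it is enough.\<close>

definition truncation_mass :: "real \<Rightarrow> real \<Rightarrow> real" where
  "truncation_mass v t = (\<integral> x. normal_density 0 (sqrt v) x * indicator {- t..t} x \<partial>lborel)"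

definition truncated_normal_density :: "real \<Rightarrow> real \<Rightarrow> real \<Rightarrow> real" where
  "truncated_normal_density v t x = normal_density 0 (sqrt v) x * indicator {- t..t} x / truncation_mass v t"

lemma borel_measurable_uniform_density [measurable]: "uniform_density c d \<in> borel_measurable borel"
  unfolding uniform_density_def by measurable

lemma borel_measurable_truncated_normal_density [measurable]:
  "truncated_normal_density v t \<in> borel_measurable borel"
  unfolding truncated_normal_density_def by measurable

lemma uniform_density_nonneg: "c < d \<Longrightarrow> 0 \<le> uniform_density c d x"
  by (simp add: uniform_density_def)

lemma nn_integral_uniform_density:
  assumes "c < d"
  shows "(\<integral>\<^sup>+ x. ennreal (uniform_density c d x) \<partial>lborel) = 1"
proof -
  have "(\<integral>\<^sup>+ x. ennreal (uniform_density c d x) \<partial>lborel) = (\<integral>\<^sup>+ x. ennreal (1 / (d - c)) * indicator {c..d} x \<partial>lborel)"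
    by (intro nn_integral_cong) (auto simp: uniform_density_def indicator_def)
  also have "\<dots> = ennreal (1 / (d - c)) * ennreal (d - c)"
    using assms by (subst nn_integral_cmult_indicator) auto
  also have "\<dots> = 1"
    using assms by (simp add: ennreal_mult[symmetric])
  finally show ?thesis .
qed

lemma nn_integral_uniform_density_pos:
  assumes "0 < c" "c < d"
  shows "(\<integral>\<^sup>+ x. ennreal (uniform_density c d x) \<partial>restrict_space lborel {0<..}) = 1"
proof -
  have "(\<integral>\<^sup>+ x. ennreal (uniform_density c d x) \<partial>restrict_space lborel {0<..})
      = (\<integral>\<^sup>+ x. ennreal (uniform_density c d x) * indicator {0<..} x \<partial>lborel)"
    by (rule nn_integral_restrict_space) simp
  also have "\<dots> = (\<integral>\<^sup>+ x. ennreal (uniform_density c d x) \<partial>lborel)"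
    using assms by (intro nn_integral_cong) (auto simp: uniform_density_def indicator_def)
  finally show ?thesis using nn_integral_uniform_density[OF assms(2)] by simp
qed

text \<open>Chebyshev's inequality: \<open>1 \<le> x^2 / t^2\<close> outside
  \<open>{- t..t}\<close>, and the second moment is \<open>v\<close>.\<close>

lemma truncation_mass_ge:
  assumes "0 < v" "0 < t"
  shows "1 - v / t\<^sup>2 \<le> truncation_mass v t"
proof -
  let ?n = "normal_density 0 (sqrt v)"
  have sv: "0 < sqrt v" using assms by simp
  have mom: "has_bochner_integral lborel (\<lambda>x. ?n x * x\<^sup>2) v"
    using normal_moment_even[OF sv, of 0 1] assms by (simp add: fact_numeral)
  have int1: "integrable lborel (\<lambda>x. ?n x * indicator {- t..t} x)"
    using integrable_real_mult_indicator[OF _ integrable_normal_density[OF sv], of "{- t..t}" 0] by simp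
  have int2: "integrable lborel (\<lambda>x. ?n x * x\<^sup>2 / t\<^sup>2)"
    using mom by (auto simp: has_bochner_integral_iff)
  have "1 = (\<integral> x. ?n x \<partial>lborel)" using sv by simp
  also have "\<dots> \<le> (\<integral> x. ?n x * indicator {- t..t} x + ?n x * x\<^sup>2 / t\<^sup>2 \<partial>lborel)"
  proof (rule integral_mono)
    fix x
    show "?n x \<le> ?n x * indicator {- t..t} x + ?n x * x\<^sup>2 / t\<^sup>2"
    proof (cases "x \<in> {- t..t}")
      case False
      then have "t\<^sup>2 \<le> x\<^sup>2" using assms by (intro abs_le_square_iff[THEN iffD1]) auto
      then have "?n x * 1 \<le> ?n x * (x\<^sup>2 / t\<^sup>2)"
        using assms by (intro mult_left_mono) auto
      then show ?thesis using False by simp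
    qed auto
  qed (use int1 int2 sv in auto)
  also have "\<dots> = truncation_mass v t + v / t\<^sup>2"
    using mom int1 int2 by (simp add: truncation_mass_def has_bochner_integral_iff)
  finally show ?thesis by simp
qed

lemma nn_integral_truncated_normal_density:
  assumes "0 < v" "0 < truncation_mass v t"
  shows "(\<integral>\<^sup>+ x. ennreal (truncated_normal_density v t x) \<partial>lborel) = 1"
proof -
  have sv: "0 < sqrt v" using assms by simp
  have int1: "integrable lborel (\<lambda>x. normal_density 0 (sqrt v) x * indicator {- t..t} x)"
    using integrable_real_mult_indicator[OF _ integrable_normal_density[OF sv], of "{- t..t}" 0] by simp
  have eq: "truncated_normal_density v t = (\<lambda>x. normal_density 0 (sqrt v) x * indicator {- t..t} x / truncation_mass v t)"
    by (simp add: truncated_normal_density_def fun_eq_iff)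
  have "(\<integral> x. truncated_normal_density v t x \<partial>lborel)
      = (\<integral> x. normal_density 0 (sqrt v) x * indicator {- t..t} x \<partial>lborel) / truncation_mass v t"
    unfolding eq by (rule integral_divide_zero)
  also have "\<dots> = 1" using assms by (simp add: truncation_mass_def)
  finally show ?thesis
    using assms integrable_divide_zero[of "truncation_mass v t", OF int1]
    by (subst nn_integral_eq_integral) (auto simp: eq)
qed

lemma normal_density_sqrt: "0 \<le> v \<Longrightarrow> normal_density 0 (sqrt v) x = exp (- x\<^sup>2 / (2 * v)) / sqrt (2 * pi * v)"
  by (simp add: normal_density_def)

text \<open>The support lies in \<open>{- 2 * B..2 * B}\<close>. There
  \<open>x^2 \<le> 4 * \<gamma>\<close> keeps the Gaussian exponent above -2, and
  \<open>\<gamma> \<le> 2 * B^2\<close> keeps the normalisation below \<open>4 * B\<close>. The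
  uniform height \<open>1 / (2 * s)\<close> then needs one more factor
  \<open>exp 1 / 2 \<ge> 1\<close>, whence \<open>exp 3\<close>.\<close>

lemma uniform_density_le_normal_density:
  assumes c: "\<bar>c\<bar> \<le> B" and s: "0 < s" "s \<le> B" and \<gamma>: "B\<^sup>2 \<le> \<gamma>" "\<gamma> \<le> 2 * B\<^sup>2"
  shows "uniform_density (c - s) (c + s) x \<le> exp 3 * B / s * normal_density 0 (sqrt \<gamma>) x"
proof (cases "x \<in> {c - s..c + s}")
  case True
  have B: "0 < B" using s by simp
  then have \<gamma>0: "0 < \<gamma>" using \<gamma>(1) by (meson less_le_trans zero_less_power)
  have "\<bar>x\<bar> \<le> 2 * B" using True c s by auto
  then have "x\<^sup>2 \<le> (2 * B)\<^sup>2" by (rule abs_le_square_iff[THEN iffD1, OF order_trans]) (use B in simp)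
  then have "x\<^sup>2 \<le> 4 * \<gamma>" using \<gamma> by (simp add: power2_eq_square)
  then have e: "exp (- 2) \<le> exp (- x\<^sup>2 / (2 * \<gamma>))" using \<gamma>0 by (simp add: field_simps)
  have "2 * pi * \<gamma> \<le> 2 * 4 * (2 * B\<^sup>2)"
    using \<gamma> \<gamma>0 pi_less_4 by (intro mult_mono) auto
  also have "\<dots> = (4 * B)\<^sup>2" by (simp add: power2_eq_square)
  finally have q: "sqrt (2 * pi * \<gamma>) \<le> 4 * B" using B by (intro real_le_lsqrt) auto
  have "exp (- 2) / (4 * B) \<le> normal_density 0 (sqrt \<gamma>) x"
    unfolding normal_density_sqrt[OF less_imp_le[OF \<gamma>0]] using e q B \<gamma>0 by (intro frac_le) auto
  then have "exp 3 * B / s * (exp (- 2) / (4 * B)) \<le> exp 3 * B / s * normal_density 0 (sqrt \<gamma>) x"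
    using B s by (intro mult_left_mono) auto
  moreover have "exp 3 * B / s * (exp (- 2) / (4 * B)) = exp 1 / (4 * s)"
    using B s by (simp add: exp_minus field_simps exp_add[symmetric])
  moreover have "1 / (2 * s) \<le> exp 1 / (4 * s)"
    using exp_ge_add_one_self[of 1] s by (simp add: field_simps)
  moreover have "uniform_density (c - s) (c + s) x = 1 / (2 * s)"
    using True by (simp add: uniform_density_def)
  ultimately show ?thesis by linarith
next
  case False
  then show ?thesis using s by (simp add: uniform_density_def)
qed

text \<open>Two losses occur. Renormalising costs
  \<open>1 / (1 - \<eta>) \<le> 1 + 2 * \<eta>\<close>, valid for \<open>\<eta> \<le> 1 / 2\<close>.
  Changing the variance from \<open>v\<close> to \<gamma> costs only
  \<open>sqrt (\<gamma> / v)\<close>, because \<open>v \<le> \<gamma>\<close> makes the exponential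
  factor larger; hence a range of scales that starts at \<open>v\<close> instead of being centred
  there.\<close>

lemma truncated_normal_density_le_normal_density:
  assumes v: "0 < v" and t: "0 < t" and \<eta>: "v / t\<^sup>2 \<le> \<eta>" "\<eta> \<le> 1 / 2" and \<gamma>: "v \<le> \<gamma>" "\<gamma> \<le> v + v * \<delta>"
  shows "truncated_normal_density v t x \<le> exp (2 * \<eta> + \<delta> / 2) * normal_density 0 (sqrt \<gamma>) x"
proof -
  have \<gamma>0: "0 < \<gamma>" using v \<gamma> by simp
  have "0 < v / t\<^sup>2" using v t by simp
  then have \<eta>0: "0 < \<eta>" using \<eta> by simp
  have q: "1 - \<eta> \<le> truncation_mass v t" using truncation_mass_ge[OF v t] \<eta> by simp
  then have q0: "0 < truncation_mass v t" using \<eta> by simp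
  have "1 \<le> (1 + 2 * \<eta>) * (1 - \<eta>)"
  proof -
    have "0 \<le> \<eta> * (1 - 2 * \<eta>)" using \<eta>0 \<eta> by (intro mult_nonneg_nonneg) auto
    then show ?thesis by (simp add: algebra_simps)
  qed
  also have "\<dots> \<le> exp (2 * \<eta>) * truncation_mass v t"
    using q \<eta> by (intro mult_mono exp_ge_add_one_self) auto
  finally have q': "1 / truncation_mass v t \<le> exp (2 * \<eta>)"
    using q0 by (simp add: divide_le_eq)
  have "\<gamma> \<le> v * exp \<delta>"
    using \<gamma> exp_ge_add_one_self[of \<delta>] v mult_left_mono[of "1 + \<delta>" "exp \<delta>" v] by (simp add: algebra_simps)
  then have "sqrt (2 * pi * \<gamma>) \<le> sqrt ((exp (\<delta> / 2))\<^sup>2 * (2 * pi * v))"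
    by (intro real_sqrt_le_mono) (simp add: exp_double[symmetric] mult_ac)
  also have "\<dots> = exp (\<delta> / 2) * sqrt (2 * pi * v)"
    by (simp add: real_sqrt_mult)
  finally have r: "1 / sqrt (2 * pi * v) \<le> exp (\<delta> / 2) / sqrt (2 * pi * \<gamma>)"
    using v \<gamma>0 by (simp add: divide_le_eq le_divide_eq mult_ac)
  have e: "exp (- x\<^sup>2 / (2 * v)) \<le> exp (- x\<^sup>2 / (2 * \<gamma>))"
    using v \<gamma> by (simp add: divide_left_mono)
  have "normal_density 0 (sqrt v) x = exp (- x\<^sup>2 / (2 * v)) * (1 / sqrt (2 * pi * v))"
    using v by (simp add: normal_density_sqrt)
  also have "\<dots> \<le> exp (- x\<^sup>2 / (2 * \<gamma>)) * (exp (\<delta> / 2) / sqrt (2 * pi * \<gamma>))"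
    using e r v by (intro mult_mono) auto
  also have "\<dots> = exp (\<delta> / 2) * normal_density 0 (sqrt \<gamma>) x"
    using \<gamma>0 by (simp add: normal_density_sqrt)
  finally have n: "normal_density 0 (sqrt v) x \<le> exp (\<delta> / 2) * normal_density 0 (sqrt \<gamma>) x" .
  have "truncated_normal_density v t x \<le> (1 / truncation_mass v t) * normal_density 0 (sqrt v) x"
    using q0 by (simp add: truncated_normal_density_def divide_right_mono mult_left_le indicator_def)
  also have "\<dots> \<le> exp (2 * \<eta>) * (exp (\<delta> / 2) * normal_density 0 (sqrt \<gamma>) x)"
    using q' n q0 by (intro mult_mono) auto
  finally show ?thesis by (simp add: exp_add mult_ac)
qed

text \<open>On the support \<open>v \<le> x \<le> 2 * v\<close>, so the power
  \<open>x powr (- a - 1)\<close> loses at most \<open>(a + 1) * ln 2\<close> in the exponent and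
  \<open>exp (- b / x)\<close> at most \<open>b / v\<close>. The height
  \<open>1 / (v * \<delta>)\<close> accounts for \<open>- ln \<delta>\<close> and lowers the
  coefficient of \<open>ln v\<close> from \<open>a + 1\<close> to \<open>a\<close>.\<close>

lemma uniform_density_le_inv_gamma_density:
  assumes a: "0 < a" and b: "0 < b" and v: "0 < v" and \<delta>: "0 < \<delta>" "\<delta> \<le> 1" and x: "0 < x"
  shows "uniform_density v (v + v * \<delta>) x
    \<le> exp (ln (Gamma a) + (a + 1) * ln 2 + a * ln (v / b) + b / v - ln \<delta>) * inv_gamma_density a b x"
proof (cases "x \<in> {v..v + v * \<delta>}")
  case True
  then have x2: "v \<le> x" "x \<le> 2 * v"
    using mult_left_mono[OF \<delta>(2) less_imp_le[OF v]] unfolding atLeastAtMost_iff by linarith+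
  have G: "0 < Gamma a" using Gamma_real_pos[OF a] .
  have lx: "ln x \<le> ln 2 + ln v"
    using x2 x v ln_mult[of 2 v] ln_le_cancel_iff[of x "2 * v"] by simp
  have bx: "b / x \<le> b / v" using x2 b v by (intro divide_left_mono) auto
  have ig: "inv_gamma_density a b x = exp (a * ln b - ln (Gamma a) + (- a - 1) * ln x - b / x)"
    using b x G by (simp add: inv_gamma_density_def powr_def exp_add exp_diff exp_minus divide_inverse mult_ac)
  have "uniform_density v (v + v * \<delta>) x = exp (- ln v - ln \<delta>)"
    using True v \<delta> by (simp add: uniform_density_def exp_diff exp_minus divide_simps)
  also have "\<dots> \<le> exp (ln (Gamma a) + (a + 1) * ln 2 + a * ln (v / b) + b / v - ln \<delta>
      + (a * ln b - ln (Gamma a) + (- a - 1) * ln x - b / x))"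
  proof -
    have "(a + 1) * ln x \<le> (a + 1) * (ln 2 + ln v)" using lx a by (intro mult_left_mono) auto
    then show ?thesis using bx v b by (simp add: ln_div algebra_simps)
  qed
  finally show ?thesis unfolding ig exp_add .
next
  case False
  then show ?thesis
    using Gamma_real_pos[OF a] by (simp add: uniform_density_def inv_gamma_density_def)
qed

section \<open>The bound for a fixed sample\<close>

definition param_matrix :: "nat \<Rightarrow> nat \<Rightarrow> nat \<Rightarrow> parameter \<Rightarrow> mat" where
  "param_matrix m p K \<theta> = mult_transpose m p K (fst \<theta>) (fst (snd \<theta>))"

text \<open>The exponential moment of the scaled divergence under the tempered posterior, freed of
  the normalising constant and of the likelihood of \<open>M0\<close>. What is left is an integral
  against the prior, which does not depend on the sample, so Tonelli applies.\<close>

definition tilted_integral ::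
    "nat \<Rightarrow> nat \<Rightarrow> nat \<Rightarrow> nat \<Rightarrow> real \<Rightarrow> real \<Rightarrow> real \<Rightarrow> real \<Rightarrow> mat \<Rightarrow> (nat \<Rightarrow> observation) \<Rightarrow> ennreal" where
  "tilted_integral m p n K a b \<sigma> \<alpha> M0 X =
     (\<integral>\<^sup>+ \<theta>. ennreal (exp (real n * (1 - \<alpha>) * renyi_dist m p \<alpha> \<sigma> (param_matrix m p K \<theta>) M0) *
        (\<Prod>k<n. likelihood_ratio \<alpha> \<sigma> (param_matrix m p K \<theta>) M0 (X k))) \<partial>prior m p K a b)"

definition absolute_noise :: "nat \<Rightarrow> mat \<Rightarrow> (nat \<Rightarrow> observation) \<Rightarrow> real" where
  "absolute_noise n M0 X = (\<Sum>k<n. \<bar>snd (X k) - M0 (fst (fst (X k))) (snd (fst (X k)))\<bar>)"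

lemma borel_measurable_param_matrix:
  assumes "i < m" "j < p"
  shows "(\<lambda>\<theta>. param_matrix m p K \<theta> i j) \<in> borel_measurable (param_lebesgue m p K)"
proof -
  have "(\<lambda>\<theta>. param_matrix m p K \<theta> i j) = (\<lambda>\<theta>. \<Sum>k<K. fst \<theta> i k * fst (snd \<theta>) j k)"
    using assms by (simp add: param_matrix_def mult_transpose_def fun_eq_iff)
  then show ?thesis
    using assms measurable_param_components(1,2)[of _ _ _ K] by auto
qed

lemma borel_measurable_renyi_dist:
  assumes "\<And>i j. i < m \<Longrightarrow> j < p \<Longrightarrow> (\<lambda>x. F x i j) \<in> borel_measurable S"
  shows "(\<lambda>x. renyi_dist m p \<alpha> \<sigma> (F x) N) \<in> borel_measurable S"
proof -
  have "(\<lambda>x. exp (\<alpha> * (\<alpha> - 1) * (F x i j - N i j)\<^sup>2 / (2 * \<sigma>\<^sup>2))) \<in> borel_measurable S" if "i < m" "j < p" for i j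
  proof -
    note assms[OF that, measurable]
    show ?thesis by measurable
  qed
  then have [measurable]: "(\<lambda>x. \<Sum>i<m. \<Sum>j<p. exp (\<alpha> * (\<alpha> - 1) * (F x i j - N i j)\<^sup>2 / (2 * \<sigma>\<^sup>2))) \<in> borel_measurable S"
    by (intro borel_measurable_sum) auto
  show ?thesis unfolding renyi_dist_def by measurable
qed

lemma likelihood_ratio_pos [simp]: "0 < likelihood_ratio \<alpha> \<sigma> M N x"
  by (simp add: likelihood_ratio_def)

lemma likelihood_pos:
  assumes "1 \<le> m" "1 \<le> p" "0 < \<sigma>"
  shows "0 < likelihood m p n \<sigma> X M"
  using assms unfolding likelihood_def case_prod_beta
  by (intro prod_pos mult_pos_pos normal_density_pos) auto

text \<open>Separates from the posterior weight the factor that is constant in the parameter, so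
  that only ratios to the truth have to be estimated.\<close>

lemma likelihood_powr:
  assumes "1 \<le> m" "1 \<le> p" "0 < \<sigma>"
  shows "likelihood m p n \<sigma> X M powr \<alpha>
    = likelihood m p n \<sigma> X N powr \<alpha> * (\<Prod>k<n. likelihood_ratio \<alpha> \<sigma> M N (X k))"
proof -
  define c where "c = 1 / (real m * real p)"
  have c: "0 < c" using assms by (simp add: c_def)
  have eq: "(c * normal_density (M i j) \<sigma> y) powr \<alpha>
     = (c * normal_density (N i j) \<sigma> y) powr \<alpha> * likelihood_ratio \<alpha> \<sigma> M N ((i, j), y)" for i j y
  proof -
    have "c * normal_density (M i j) \<sigma> y
       = c * normal_density (N i j) \<sigma> y * exp (((y - N i j)\<^sup>2 - (y - M i j)\<^sup>2) / (2 * \<sigma>\<^sup>2))"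
      unfolding normal_density_def by (simp add: exp_add[symmetric] diff_divide_distrib)
    then show ?thesis
      using c assms normal_density_nonneg[of "N i j" \<sigma> y]
      by (simp add: powr_mult exp_powr_real likelihood_ratio_def mult_ac)
  qed
  have "likelihood m p n \<sigma> X M powr \<alpha>
     = (\<Prod>k<n. (c * normal_density (M (fst (fst (X k))) (snd (fst (X k)))) \<sigma> (snd (X k))) powr \<alpha>)" for M
    unfolding likelihood_def case_prod_beta c_def[symmetric]
    by (rule prod_powr_distrib)
  then show ?thesis
    by (simp add: eq prod.distrib)
qed

text \<open>With noise \<open>e\<close> and entrywise error \<open>d\<close>, the exponent is
  governed by \<open>e^2 - (e - d)^2 = 2 * e * d - d^2\<close>. It is linear in the noise, so its
  absolute values suffice.\<close>

lemma prod_likelihood_ratio_ge: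
  assumes \<sigma>: "0 < \<sigma>" and \<alpha>: "0 < \<alpha>"
    and X: "\<And>k. k < n \<Longrightarrow> fst (X k) \<in> {..<m} \<times> {..<p}"
    and d: "\<And>i j. i < m \<Longrightarrow> j < p \<Longrightarrow> \<bar>M i j - N i j\<bar> \<le> \<delta>"
  shows "exp (- \<alpha> * ((real n * \<delta>\<^sup>2 + 2 * \<delta> * absolute_noise n N X) / (2 * \<sigma>\<^sup>2)))
    \<le> (\<Prod>k<n. likelihood_ratio \<alpha> \<sigma> M N (X k))"
proof -
  define e where "e k = snd (X k) - N (fst (fst (X k))) (snd (fst (X k)))" for k
  define d' where "d' k = M (fst (fst (X k))) (snd (fst (X k))) - N (fst (fst (X k))) (snd (fst (X k)))" for k
  have sq: "- (\<delta>\<^sup>2 + 2 * \<delta> * \<bar>e k\<bar>) \<le> (e k)\<^sup>2 - (e k - d' k)\<^sup>2" if "k < n" for k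
  proof -
    have d1: "\<bar>d' k\<bar> \<le> \<delta>" using X[OF that] unfolding d'_def by (intro d) auto
    then have "(d' k)\<^sup>2 \<le> \<delta>\<^sup>2" by (intro abs_le_square_iff[THEN iffD1]) auto
    moreover have "\<bar>e k * d' k\<bar> \<le> \<bar>e k\<bar> * \<delta>"
      using d1 by (simp add: abs_mult mult_left_mono)
    ultimately show ?thesis by (simp add: power2_eq_square algebra_simps)
  qed
  have "- \<alpha> * ((real n * \<delta>\<^sup>2 + 2 * \<delta> * absolute_noise n N X) / (2 * \<sigma>\<^sup>2))
    = \<alpha> / (2 * \<sigma>\<^sup>2) * (\<Sum>k<n. - (\<delta>\<^sup>2 + 2 * \<delta> * \<bar>e k\<bar>))"
  proof -
    have "(\<Sum>k<n. - (\<delta>\<^sup>2 + 2 * \<delta> * \<bar>e k\<bar>)) = - (real n * \<delta>\<^sup>2 + 2 * \<delta> * absolute_noise n N X)"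
      by (simp only: absolute_noise_def e_def sum_negf sum.distrib sum_distrib_left sum_constant card_lessThan)
    moreover have "- \<alpha> * (A / c) = \<alpha> / c * - A" for A c by simp
    ultimately show ?thesis by (simp only:)
  qed
  also have "\<dots> \<le> \<alpha> / (2 * \<sigma>\<^sup>2) * (\<Sum>k<n. (e k)\<^sup>2 - (e k - d' k)\<^sup>2)"
    using sq \<alpha> \<sigma> by (intro mult_left_mono sum_mono) auto
  also have "\<dots> = (\<Sum>k<n. \<alpha> * ((e k)\<^sup>2 - (e k - d' k)\<^sup>2) / (2 * \<sigma>\<^sup>2))"
    by (simp add: sum_distrib_left)
  finally have "exp (- \<alpha> * ((real n * \<delta>\<^sup>2 + 2 * \<delta> * absolute_noise n N X) / (2 * \<sigma>\<^sup>2)))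
     \<le> exp (\<Sum>k<n. \<alpha> * ((e k)\<^sup>2 - (e k - d' k)\<^sup>2) / (2 * \<sigma>\<^sup>2))"
    by simp
  also have "\<dots> = (\<Prod>k<n. likelihood_ratio \<alpha> \<sigma> M N (X k))"
    by (simp add: exp_sum likelihood_ratio_def e_def d'_def)
  finally show ?thesis .
qed

lemma space_sample_law:
  assumes "X \<in> space (sample_law m p n \<sigma> M0)" "k < n"
  shows "X k \<in> space (obs_space m p)"
  using assms by (auto simp: sample_law_def space_PiM PiE_iff obs_law_def)

lemma fst_sample:
  assumes "X \<in> space (sample_law m p n \<sigma> M0)" "k < n"
  shows "fst (X k) \<in> {..<m} \<times> {..<p}"
  using space_sample_law[OF assms] by (auto simp: obs_space_def space_pair_measure)

lemma borel_measurable_prod_likelihood_ratio: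
  assumes "\<And>k. k < n \<Longrightarrow> X k \<in> space (obs_space m p)"
  shows "(\<lambda>\<theta>. \<Prod>k<n. likelihood_ratio \<alpha> \<sigma> (param_matrix m p K \<theta>) M0 (X k)) \<in> borel_measurable (param_lebesgue m p K)"
  by (intro borel_measurable_prod borel_measurable_likelihood_ratio[where g = "\<lambda>_. X _"] borel_measurable_param_matrix)
    (use assms in auto)

text \<open>The deterministic core. The divergence of the comparison measure contributes
  \<open>ln Zr - ln L0\<close> and the exponential moment \<open>ln L0 - ln Zr\<close>; the sum is
  free of both.\<close>

lemma variational_approx_bound:
  fixes h :: "parameter \<Rightarrow> real"
  assumes mp: "1 \<le> m" "1 \<le> p" and a: "0 < a" and b: "0 < b" and \<sigma>: "0 < \<sigma>" and \<alpha>: "0 < \<alpha>" "\<alpha> < 1"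
    and X: "X \<in> space (sample_law m p n \<sigma> M0)"
    and post: "is_variational_approx m p n K a b \<sigma> \<alpha> X \<rho>"
    and hm: "h \<in> borel_measurable (param_lebesgue m p K)" and h0: "\<And>\<theta>. 0 \<le> h \<theta>"
    and hF: "density (param_lebesgue m p K) h \<in> mean_field m p K"
    and hR: "\<And>\<theta>. \<theta> \<in> space (param_lebesgue m p K) \<Longrightarrow> h \<theta> \<le> exp R * prior_density m p K a b \<theta>"
    and hd: "\<And>\<theta> i j. \<theta> \<in> space (param_lebesgue m p K) \<Longrightarrow> h \<theta> \<noteq> 0 \<Longrightarrow> i < m \<Longrightarrow> j < p \<Longrightarrow>
      \<bar>param_matrix m p K \<theta> i j - M0 i j\<bar> \<le> \<delta>"
    and T: "(real n * \<delta>\<^sup>2 + 2 * \<delta> * absolute_noise n M0 X) / (2 * \<sigma>\<^sup>2) \<le> T"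
    and z: "tilted_integral m p n K a b \<sigma> \<alpha> M0 X \<le> ennreal z" "0 < z"
  shows "(\<integral>\<^sup>+ \<theta>. ennreal (real n * (1 - \<alpha>) * renyi_dist m p \<alpha> \<sigma> (param_matrix m p K \<theta>) M0) \<partial>\<rho>)
    \<le> ennreal (R + \<alpha> * T + ln z)"
proof -
  let ?\<Lambda> = "param_lebesgue m p K"
  let ?\<pi> = "prior m p K a b"
  let ?\<mu> = "tempered_posterior m p n K a b \<sigma> \<alpha> X"
  define q where "q \<theta> = (\<Prod>k<n. likelihood_ratio \<alpha> \<sigma> (param_matrix m p K \<theta>) M0 (X k))" for \<theta>
  define g where "g \<theta> = real n * (1 - \<alpha>) * renyi_dist m p \<alpha> \<sigma> (param_matrix m p K \<theta>) M0" for \<theta>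
  define L0 where "L0 = likelihood m p n \<sigma> X M0 powr \<alpha>"
  define pd where "pd = prior_density m p K a b"
  interpret P: prob_space ?\<pi> by (rule prob_space_prior[OF a b])
  have L0: "0 < L0" using likelihood_pos[OF mp \<sigma>, of n X M0] by (simp add: L0_def)
  have q0: "0 < q \<theta>" for \<theta> by (simp add: q_def prod_pos)
  have g0: "0 \<le> g \<theta>" for \<theta> using renyi_nonneg[OF mp \<alpha>] \<alpha> by (simp add: g_def)
  have qm [measurable]: "q \<in> borel_measurable ?\<Lambda>"
    unfolding q_def by (intro borel_measurable_prod_likelihood_ratio space_sample_law[OF X])
  have gm [measurable]: "g \<in> borel_measurable ?\<Lambda>"
    unfolding g_def by (intro borel_measurable_times borel_measurable_const borel_measurable_renyi_dist borel_measurable_param_matrix)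
  have pm [measurable]: "pd \<in> borel_measurable ?\<Lambda>" unfolding pd_def by measurable
  have pd0: "0 < pd \<theta>" if "\<theta> \<in> space ?\<Lambda>" for \<theta> unfolding pd_def by (rule prior_density_pos[OF a b that])
  have \<pi>: "?\<pi> = density ?\<Lambda> pd" by (simp add: prior_eq pd_def)
  have sets\<pi> [measurable_cong]: "sets ?\<pi> = sets ?\<Lambda>" by (simp add: \<pi>)
  have lik: "likelihood m p n \<sigma> X (param_matrix m p K \<theta>) powr \<alpha> = L0 * q \<theta>" for \<theta>
    unfolding L0_def q_def by (rule likelihood_powr[OF mp \<sigma>])
  define Z where "Z = (\<integral>\<^sup>+ \<theta>. ennreal (L0 * q \<theta>) \<partial>?\<pi>)"
  \<comment> \<open>The exponential factor is at least one because the divergence is nonnegative, so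
    the bound on the tilted integral also shows that the normalising constant is finite.\<close>
  have Zle: "Z \<le> ennreal (L0 * z)"
  proof -
    have "Z \<le> (\<integral>\<^sup>+ \<theta>. ennreal L0 * ennreal (exp (g \<theta>) * q \<theta>) \<partial>?\<pi>)"
      unfolding Z_def using L0 q0 g0
      by (intro nn_integral_mono) (auto simp: ennreal_mult[symmetric] less_imp_le intro!: ennreal_leI)
    also have "\<dots> = ennreal L0 * (\<integral>\<^sup>+ \<theta>. ennreal (exp (g \<theta>) * q \<theta>) \<partial>?\<pi>)"
      by (rule nn_integral_cmult) measurable
    also have "\<dots> \<le> ennreal L0 * ennreal z"
      using z(1) unfolding tilted_integral_def g_def q_def by (rule mult_left_mono) simp
    also have "\<dots> = ennreal (L0 * z)" using L0 z(2) by (simp add: ennreal_mult)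
    finally show ?thesis .
  qed
  have "Z \<noteq> 0"
  proof
    assume "Z = 0"
    then have "AE \<theta> in ?\<pi>. ennreal (L0 * q \<theta>) = 0"
      unfolding Z_def by (subst (asm) nn_integral_0_iff_AE) auto
    then have "AE \<theta> in ?\<pi>. False"
    proof eventually_elim
      case (elim \<theta>)
      then show False using mult_pos_pos[OF L0 q0[of \<theta>]] by (simp add: ennreal_eq_0_iff)
    qed
    then show False by simp
  qed
  define Zr where "Zr = enn2real Z"
  have Zfin: "Z < \<top>" using Zle by (rule order.strict_trans1) simp
  have Zr: "0 < Zr" and Z: "Z = ennreal Zr"
    using \<open>Z \<noteq> 0\<close> Zfin by (auto simp: Zr_def enn2real_positive_iff zero_less_iff_neq_zero)
  define k where "k \<theta> = pd \<theta> * (L0 * q \<theta> / Zr)" for \<theta>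
  have km [measurable]: "k \<in> borel_measurable ?\<Lambda>" unfolding k_def by measurable
  have k0: "0 < k \<theta>" if "\<theta> \<in> space ?\<Lambda>" for \<theta>
    using pd0[OF that] L0 q0 Zr by (simp add: k_def)
  have \<mu>1: "?\<mu> = density ?\<pi> (\<lambda>\<theta>. ennreal (L0 * q \<theta> / Zr))"
  proof -
    have "?\<mu> = density ?\<pi> (\<lambda>\<theta>. ennreal (L0 * q \<theta>) / Z)"
      by (simp add: tempered_posterior_def Let_def case_prod_beta param_matrix_def[symmetric] lik Z_def)
    also have "(\<lambda>\<theta>. ennreal (L0 * q \<theta>) / Z) = (\<lambda>\<theta>. ennreal (L0 * q \<theta> / Zr))"
      using Zr L0 q0 unfolding Z by (intro ext divide_ennreal) (auto intro: less_imp_le)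
    finally show ?thesis .
  qed
  have \<mu>: "?\<mu> = density ?\<Lambda> k"
  proof -
    have "?\<mu> = density ?\<Lambda> (\<lambda>\<theta>. ennreal (pd \<theta>) * ennreal (L0 * q \<theta> / Zr))"
      unfolding \<mu>1 \<pi> by (rule density_density_eq) auto
    also have "\<dots> = density ?\<Lambda> k"
    proof (intro density_cong AE_I2)
      fix \<theta> assume "\<theta> \<in> space ?\<Lambda>"
      then show "ennreal (pd \<theta>) * ennreal (L0 * q \<theta> / Zr) = ennreal (k \<theta>)"
        using pd0[of \<theta>] mult_pos_pos[OF L0 q0[of \<theta>]] Zr unfolding k_def
        by (intro ennreal_mult[symmetric]) auto
    qed auto
    finally show ?thesis .
  qed
  have \<mu>_int: "(\<integral>\<^sup>+ \<theta>. f \<theta> \<partial>?\<mu>) = (\<integral>\<^sup>+ \<theta>. ennreal (L0 * q \<theta> / Zr) * f \<theta> \<partial>?\<pi>)"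
    if "f \<in> borel_measurable ?\<Lambda>" for f
    unfolding \<mu>1 using that by (intro nn_integral_density) auto
  have "prob_space ?\<mu>"
    unfolding \<mu>1
  proof (rule prob_space_density_of_integral)
    have "(\<integral>\<^sup>+ \<theta>. ennreal (L0 * q \<theta> / Zr) \<partial>?\<pi>) = (\<integral>\<^sup>+ \<theta>. ennreal (1 / Zr) * ennreal (L0 * q \<theta>) \<partial>?\<pi>)"
      using Zr L0 q0 by (intro nn_integral_cong) (simp add: ennreal_mult[symmetric] less_imp_le)
    also have "\<dots> = ennreal (1 / Zr) * Z"
      unfolding Z_def by (rule nn_integral_cmult) measurable
    also have "\<dots> = 1" using Zr by (simp add: Z ennreal_mult[symmetric])
    finally show "(\<integral>\<^sup>+ \<theta>. ennreal (L0 * q \<theta> / Zr) \<partial>?\<pi>) = 1" .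
  qed measurable
  then interpret MU: prob_space ?\<mu> .
  \<comment> \<open>\<open>exp (- \<alpha> * T)\<close> is the lower bound for \<open>q\<close> on
    the support of \<open>h\<close>; off the support the inequality \<open>hC\<close> holds
    trivially.\<close>
  define C where "C = exp R * (Zr / (L0 * exp (- \<alpha> * T)))"
  have hC: "h \<theta> \<le> C * k \<theta>" if \<theta>: "\<theta> \<in> space ?\<Lambda>" for \<theta>
  proof (cases "h \<theta> = 0")
    case True
    then show ?thesis using k0[OF \<theta>] Zr L0 by (simp add: C_def)
  next
    case False
    have "exp (- \<alpha> * T) \<le> exp (- \<alpha> * ((real n * \<delta>\<^sup>2 + 2 * \<delta> * absolute_noise n M0 X) / (2 * \<sigma>\<^sup>2)))"
      using mult_left_mono[OF T, of \<alpha>] \<alpha> by simp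
    also have "\<dots> \<le> q \<theta>"
      unfolding q_def by (rule prod_likelihood_ratio_ge[OF \<sigma> \<alpha>(1) fst_sample[OF X] hd[OF \<theta> False]])
    finally have "1 \<le> q \<theta> / exp (- \<alpha> * T)" by (simp add: le_divide_eq)
    then have "exp R * pd \<theta> * 1 \<le> exp R * pd \<theta> * (q \<theta> / exp (- \<alpha> * T))"
      using pd0[OF \<theta>] by (intro mult_left_mono) auto
    also have "\<dots> = C * k \<theta>"
      using Zr L0 by (simp add: C_def k_def)
    finally show ?thesis using hR[OF \<theta>] unfolding pd_def by simp
  qed
  have "KL (density ?\<Lambda> h) ?\<mu> \<le> ereal (ln C)"
    unfolding \<mu>
    by (rule KL_le_of_density_le)
      (use hm h0 k0 hC mean_field_prob_space(1)[OF hF] MU.finite_measure_axioms in \<open>auto simp: \<mu>\<close>)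
  moreover have "KL \<rho> ?\<mu> \<le> KL (density ?\<Lambda> h) ?\<mu>"
    using post hF unfolding is_variational_approx_def is_arg_min_def by (auto simp: not_less)
  \<comment> \<open>Finiteness is passed on by minimality. Absolute continuity of the unknown \<rho>
    with respect to the posterior is obtained only in this way.\<close>
  ultimately have KL: "KL \<rho> ?\<mu> \<le> ereal (ln C)" by (rule order_trans[rotated])
  have \<rho>: "\<rho> \<in> mean_field m p K"
    using post unfolding is_variational_approx_def is_arg_min_def by simp
  have W: "(\<integral>\<^sup>+ \<theta>. ennreal (exp (g \<theta>)) \<partial>?\<mu>) \<le> ennreal (L0 / Zr * z)"
  proof -
    have "(\<integral>\<^sup>+ \<theta>. ennreal (exp (g \<theta>)) \<partial>?\<mu>) = (\<integral>\<^sup>+ \<theta>. ennreal (L0 / Zr) * ennreal (exp (g \<theta>) * q \<theta>) \<partial>?\<pi>)"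
      using L0 Zr q0 by (subst \<mu>_int) (auto simp: ennreal_mult[symmetric] less_imp_le mult_ac intro!: nn_integral_cong)
    also have "\<dots> = ennreal (L0 / Zr) * (\<integral>\<^sup>+ \<theta>. ennreal (exp (g \<theta>) * q \<theta>) \<partial>?\<pi>)"
      by (rule nn_integral_cmult) measurable
    also have "\<dots> \<le> ennreal (L0 / Zr) * ennreal z"
      using z(1) unfolding tilted_integral_def g_def q_def by (rule mult_left_mono) simp
    also have "\<dots> = ennreal (L0 / Zr * z)" using L0 Zr z(2) by (simp add: ennreal_mult[symmetric])
    finally show ?thesis .
  qed
  have "(\<integral>\<^sup>+ \<theta>. ennreal (g \<theta>) \<partial>\<rho>) \<le> ennreal (ln C + ln (L0 / Zr * z))"
  proof (rule donsker_varadhan[OF MU.sigma_finite_measure_axioms mean_field_prob_space(1)[OF \<rho>] _ KL _ g0 W])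
    show "sets \<rho> = sets ?\<mu>" using mean_field_prob_space(2)[OF \<rho>] by (simp add: \<mu>)
    show "g \<in> borel_measurable ?\<mu>" using gm by (simp add: \<mu>)
    show "0 < L0 / Zr * z" using L0 Zr z(2) by simp
  qed
  also have "ln C + ln (L0 / Zr * z) = R + \<alpha> * T + ln z"
    using L0 Zr z(2) by (simp add: C_def ln_mult ln_div)
  finally show ?thesis unfolding g_def .
qed

section \<open>The good event\<close>

lemma prob_space_sample_law:
  assumes "1 \<le> m" "1 \<le> p" "0 < \<sigma>"
  shows "prob_space (sample_law m p n \<sigma> M0)"
  unfolding sample_law_def by (intro prob_space_PiM prob_space_obs_law assms)

lemma measurable_sample_component:
  assumes "k < n"
  shows "(\<lambda>X. X k) \<in> sample_law m p n \<sigma> M0 \<rightarrow>\<^sub>M obs_space m p"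
proof -
  have "(\<lambda>X. X k) \<in> sample_law m p n \<sigma> M0 \<rightarrow>\<^sub>M obs_law m p \<sigma> M0"
    unfolding sample_law_def using assms by (intro measurable_component_singleton) auto
  then show ?thesis by (simp cong: measurable_cong_sets)
qed

text \<open>Joint measurability in the sample and the parameter, as exchanging the two integrals
  requires.\<close>

lemma borel_measurable_tilted_integrand:
  "(\<lambda>z. ennreal (exp (c * renyi_dist m p \<alpha> \<sigma> (param_matrix m p K (snd z)) M0) *
      (\<Prod>k<n. likelihood_ratio \<alpha> \<sigma> (param_matrix m p K (snd z)) M0 (fst z k))))
    \<in> borel_measurable (sample_law m p n \<sigma> M0 \<Otimes>\<^sub>M prior m p K a b)"
proof -
  let ?S = "sample_law m p n \<sigma> M0 \<Otimes>\<^sub>M prior m p K a b"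
  have entry: "(\<lambda>z. param_matrix m p K (snd z) i j) \<in> borel_measurable ?S" if "i < m" "j < p" for i j
    by (rule measurable_compose[OF measurable_snd])
      (use borel_measurable_param_matrix[OF that] in \<open>simp add: prior_eq\<close>)
  have [measurable]: "(\<lambda>z. renyi_dist m p \<alpha> \<sigma> (param_matrix m p K (snd z)) M0) \<in> borel_measurable ?S"
    by (rule borel_measurable_renyi_dist) (rule entry)
  have [measurable]: "(\<lambda>z. \<Prod>k<n. likelihood_ratio \<alpha> \<sigma> (param_matrix m p K (snd z)) M0 (fst z k)) \<in> borel_measurable ?S"
    by (intro borel_measurable_prod borel_measurable_likelihood_ratio[where m = m and p = p] entry
       measurable_compose[OF measurable_fst measurable_sample_component]) auto
  show ?thesis by measurable
qed

text \<open>For a fixed parameter, independence gives the expected product of ratios as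
  \<open>exp ((\<alpha> - 1) * d)\<close> to the power \<open>n\<close>, which the factor
  \<open>exp (n * (1 - \<alpha>) * d)\<close> cancels exactly. After exchanging the integrals only
  the mass of the prior remains.\<close>

lemma nn_integral_tilted_integral:
  assumes mp: "1 \<le> m" "1 \<le> p" and a: "0 < a" and b: "0 < b" and \<sigma>: "0 < \<sigma>" and \<alpha>: "0 < \<alpha>" "\<alpha> < 1"
  shows "(\<integral>\<^sup>+ X. tilted_integral m p n K a b \<sigma> \<alpha> M0 X \<partial>sample_law m p n \<sigma> M0) = 1"
    and "tilted_integral m p n K a b \<sigma> \<alpha> M0 \<in> borel_measurable (sample_law m p n \<sigma> M0)"
proof -
  let ?S = "sample_law m p n \<sigma> M0"
  let ?\<pi> = "prior m p K a b"
  define c where "c = real n * (1 - \<alpha>)"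
  define d where "d \<theta> = renyi_dist m p \<alpha> \<sigma> (param_matrix m p K \<theta>) M0" for \<theta>
  define f where "f X \<theta> = ennreal (exp (c * d \<theta>) *
      (\<Prod>k<n. likelihood_ratio \<alpha> \<sigma> (param_matrix m p K \<theta>) M0 (X k)))" for X :: "nat \<Rightarrow> observation" and \<theta>
  interpret P: prob_space ?\<pi> by (rule prob_space_prior[OF a b])
  interpret S: prob_space ?S by (rule prob_space_sample_law[OF mp \<sigma>])
  interpret O: prob_space "obs_law m p \<sigma> M0" by (rule prob_space_obs_law[OF mp \<sigma>])
  interpret OO: product_sigma_finite "\<lambda>k::nat. obs_law m p \<sigma> M0"
    by (rule product_sigma_finite.intro) (rule O.sigma_finite_measure_axioms)
  interpret SP: pair_sigma_finite ?S ?\<pi> ..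
  have fm: "(\<lambda>z. f (fst z) (snd z)) \<in> borel_measurable (?S \<Otimes>\<^sub>M ?\<pi>)"
    unfolding f_def d_def by (rule borel_measurable_tilted_integrand)
  have tilted: "tilted_integral m p n K a b \<sigma> \<alpha> M0 = (\<lambda>X. \<integral>\<^sup>+ \<theta>. f X \<theta> \<partial>?\<pi>)"
    by (simp add: tilted_integral_def f_def c_def d_def fun_eq_iff)
  show "tilted_integral m p n K a b \<sigma> \<alpha> M0 \<in> borel_measurable ?S"
    unfolding tilted using fm by (intro P.borel_measurable_nn_integral) (simp add: case_prod_beta')
  have inner: "(\<integral>\<^sup>+ X. f X \<theta> \<partial>?S) = 1" for \<theta>
  proof -
    let ?l = "likelihood_ratio \<alpha> \<sigma> (param_matrix m p K \<theta>) M0"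
    have lm: "(\<lambda>x. ennreal (?l x)) \<in> borel_measurable (obs_law m p \<sigma> M0)"
      using borel_measurable_likelihood_ratio[of "\<lambda>x. x" "obs_space m p" m p "\<lambda>_. param_matrix m p K \<theta>"]
      by simp
    have pm: "(\<lambda>X. \<Prod>k<n. ennreal (?l (X k))) \<in> borel_measurable ?S"
      by (intro borel_measurable_prod_ennreal measurable_compose[OF measurable_sample_component]) (use lm in simp_all)
    have "(\<integral>\<^sup>+ X. f X \<theta> \<partial>?S) = (\<integral>\<^sup>+ X. ennreal (exp (c * d \<theta>)) * (\<Prod>k<n. ennreal (?l (X k))) \<partial>?S)"
      by (simp add: f_def ennreal_mult prod_ennreal less_imp_le prod_nonneg)
    also have "\<dots> = ennreal (exp (c * d \<theta>)) * (\<integral>\<^sup>+ X. (\<Prod>k<n. ennreal (?l (X k))) \<partial>?S)"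
      by (rule nn_integral_cmult[OF pm])
    also have "(\<integral>\<^sup>+ X. (\<Prod>k<n. ennreal (?l (X k))) \<partial>?S) = (\<Prod>k<n. \<integral>\<^sup>+ x. ennreal (?l x) \<partial>obs_law m p \<sigma> M0)"
      unfolding sample_law_def by (rule OO.product_nn_integral_prod) (use lm in auto)
    also have "\<dots> = ennreal (exp ((\<alpha> - 1) * d \<theta>) ^ n)"
      by (simp add: nn_integral_likelihood_ratio[OF mp \<sigma> \<alpha>] d_def ennreal_power)
    also have "exp ((\<alpha> - 1) * d \<theta>) ^ n = exp (- (c * d \<theta>))"
      by (simp add: exp_of_nat_mult[symmetric] c_def algebra_simps)
    also have "ennreal (exp (c * d \<theta>)) * ennreal (exp (- (c * d \<theta>))) = 1"
      by (simp add: ennreal_mult[symmetric] exp_add[symmetric])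
    finally show ?thesis .
  qed
  have "(\<integral>\<^sup>+ X. tilted_integral m p n K a b \<sigma> \<alpha> M0 X \<partial>?S) = (\<integral>\<^sup>+ X. \<integral>\<^sup>+ \<theta>. f X \<theta> \<partial>?\<pi> \<partial>?S)"
    by (simp add: tilted)
  also have "\<dots> = (\<integral>\<^sup>+ \<theta>. \<integral>\<^sup>+ X. f X \<theta> \<partial>?S \<partial>?\<pi>)"
    using SP.Fubini[OF fm] by simp
  also have "\<dots> = 1" by (simp add: inner P.emeasure_space_1)
  finally show "(\<integral>\<^sup>+ X. tilted_integral m p n K a b \<sigma> \<alpha> M0 X \<partial>?S) = 1" .
qed

lemma nn_integral_absolute_noise:
  assumes mp: "1 \<le> m" "1 \<le> p" and \<sigma>: "0 < \<sigma>"
  shows "(\<integral>\<^sup>+ X. ennreal (absolute_noise n M0 X) \<partial>sample_law m p n \<sigma> M0) \<le> ennreal (real n * \<sigma>)"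
    and "absolute_noise n M0 \<in> borel_measurable (sample_law m p n \<sigma> M0)"
proof -
  let ?S = "sample_law m p n \<sigma> M0"
  define e where "e x = \<bar>snd x - M0 (fst (fst x)) (snd (fst x))\<bar>" for x :: observation
  have em: "e \<in> borel_measurable (obs_space m p)"
  proof -
    have [measurable]: "(\<lambda>x. M0 (fst (fst x)) (snd (fst x))) \<in> borel_measurable (obs_space m p)"
      unfolding obs_space_def by (rule borel_measurable_random_entry[where m = m and p = p and g = fst]) auto
    have [measurable]: "snd \<in> borel_measurable (obs_space m p)"
      unfolding obs_space_def by measurable
    show ?thesis unfolding e_def by measurable
  qed
  have noise: "absolute_noise n M0 = (\<lambda>X. \<Sum>k<n. e (X k))"
    by (simp add: absolute_noise_def e_def fun_eq_iff)
  have km: "(\<lambda>X. e (X k)) \<in> borel_measurable ?S" if "k < n" for k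
    by (rule measurable_compose[OF measurable_sample_component[OF that] em])
  show "absolute_noise n M0 \<in> borel_measurable ?S"
    unfolding noise by (intro borel_measurable_sum km) simp
  have "(\<integral>\<^sup>+ X. ennreal (absolute_noise n M0 X) \<partial>?S) = (\<integral>\<^sup>+ X. (\<Sum>k<n. ennreal (e (X k))) \<partial>?S)"
    by (simp add: noise sum_ennreal e_def)
  also have "\<dots> = (\<Sum>k<n. \<integral>\<^sup>+ X. ennreal (e (X k)) \<partial>?S)"
    by (rule nn_integral_sum) (use km in auto)
  also have "\<dots> \<le> (\<Sum>k<n. ennreal \<sigma>)"
  proof (rule sum_mono)
    fix k assume "k \<in> {..<n}"
    then have k: "k < n" by simp
    have "(\<integral>\<^sup>+ x. ennreal (e x) \<partial>obs_law m p \<sigma> M0)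
       = (\<integral>\<^sup>+ x. ennreal (e x) \<partial>distr ?S (obs_law m p \<sigma> M0) (\<lambda>X. X k))"
      unfolding sample_law_def using k
      by (subst distr_PiM_component[of "{..<n}" "\<lambda>_. obs_law m p \<sigma> M0" k]) (auto intro: prob_space_obs_law[OF mp \<sigma>])
    also have "\<dots> = (\<integral>\<^sup>+ X. ennreal (e (X k)) \<partial>?S)"
      by (rule nn_integral_distr) (use measurable_sample_component[OF k] em in \<open>auto cong: measurable_cong_sets\<close>)
    finally show "(\<integral>\<^sup>+ X. ennreal (e (X k)) \<partial>?S) \<le> ennreal \<sigma>"
      using nn_integral_abs_noise[OF mp \<sigma>, of M0] by (simp add: e_def)
  qed
  also have "\<dots> = ennreal (real n * \<sigma>)"
    using \<sigma> by (simp add: ennreal_mult ennreal_of_nat_eq_real_of_nat)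
  finally show "(\<integral>\<^sup>+ X. ennreal (absolute_noise n M0 X) \<partial>?S) \<le> ennreal (real n * \<sigma>)" .
qed

text \<open>The variational approximation does not occur here, so the event is measurable whatever
  choice of minimiser is made for each sample.\<close>

definition good_event ::
    "nat \<Rightarrow> nat \<Rightarrow> nat \<Rightarrow> nat \<Rightarrow> real \<Rightarrow> real \<Rightarrow> real \<Rightarrow> real \<Rightarrow> mat \<Rightarrow> real \<Rightarrow> (nat \<Rightarrow> observation) set" where
  "good_event m p n K a b \<sigma> \<alpha> M0 t =
     {X \<in> space (sample_law m p n \<sigma> M0). tilted_integral m p n K a b \<sigma> \<alpha> M0 X \<le> ennreal t \<and>
        absolute_noise n M0 X \<le> real n * \<sigma> * t}"

lemma good_event_prob:
  assumes mp: "1 \<le> m" "1 \<le> p" and n: "1 \<le> n" and a: "0 < a" and b: "0 < b" and \<sigma>: "0 < \<sigma>" and \<alpha>: "0 < \<alpha>" "\<alpha> < 1"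
    and t: "0 < t"
  shows "good_event m p n K a b \<sigma> \<alpha> M0 t \<in> sets (sample_law m p n \<sigma> M0)"
    and "1 - 2 / t \<le> measure (sample_law m p n \<sigma> M0) (good_event m p n K a b \<sigma> \<alpha> M0 t)"
proof -
  note [measurable] = nn_integral_tilted_integral(2)[OF mp a b \<sigma> \<alpha>] nn_integral_absolute_noise(2)[OF mp \<sigma>]
  show "good_event m p n K a b \<sigma> \<alpha> M0 t \<in> sets (sample_law m p n \<sigma> M0)"
    unfolding good_event_def by measurable
  have G: "good_event m p n K a b \<sigma> \<alpha> M0 t =
     {X \<in> space (sample_law m p n \<sigma> M0). tilted_integral m p n K a b \<sigma> \<alpha> M0 X \<le> ennreal t \<and>
      ennreal (absolute_noise n M0 X) \<le> ennreal (real n * \<sigma> * t)}"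
    using \<sigma> t by (auto simp: good_event_def ennreal_le_iff)
  show "1 - 2 / t \<le> measure (sample_law m p n \<sigma> M0) (good_event m p n K a b \<sigma> \<alpha> M0 t)"
    unfolding G
    by (rule prob_two_markov[OF prob_space_sample_law[OF mp \<sigma>]])
      (use nn_integral_tilted_integral[OF mp a b \<sigma> \<alpha>, where n = n and K = K and ?M0.0 = M0] nn_integral_absolute_noise[OF mp \<sigma>, of n M0] n \<sigma> t in auto)
qed

lemma nn_integral_induced_law:
  assumes "\<rho> \<in> mean_field m p K"
  shows "(\<integral>\<^sup>+ M. ennreal (renyi_dist m p \<alpha> \<sigma> M M0) \<partial>induced_law m p K \<rho>)
    = (\<integral>\<^sup>+ \<theta>. ennreal (renyi_dist m p \<alpha> \<sigma> (param_matrix m p K \<theta>) M0) \<partial>\<rho>)"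
proof -
  have "param_matrix m p K \<in> param_lebesgue m p K \<rightarrow>\<^sub>M matrix_space m p"
  proof -
    have "(\<lambda>\<theta>. \<lambda>i\<in>{..<m}. \<lambda>j\<in>{..<p}. param_matrix m p K \<theta> i j) \<in> param_lebesgue m p K \<rightarrow>\<^sub>M matrix_space m p"
      unfolding matrix_space_def by (intro measurable_restrict borel_measurable_param_matrix) auto
    also have "(\<lambda>\<theta>. \<lambda>i\<in>{..<m}. \<lambda>j\<in>{..<p}. param_matrix m p K \<theta> i j) = param_matrix m p K"
      by (auto simp: param_matrix_def mult_transpose_def restrict_def fun_eq_iff)
    finally show ?thesis .
  qed
  then have T: "(\<lambda>(U, V, \<gamma>). mult_transpose m p K U V) \<in> \<rho> \<rightarrow>\<^sub>M matrix_space m p"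
    using mean_field_prob_space(2)[OF assms]
    by (simp add: param_matrix_def[abs_def] case_prod_beta' cong: measurable_cong_sets)
  have "(\<lambda>M. renyi_dist m p \<alpha> \<sigma> M M0) \<in> borel_measurable (matrix_space m p)"
  proof (rule borel_measurable_renyi_dist)
    fix i j assume "i < m" "j < p"
    then show "(\<lambda>M. M i j) \<in> borel_measurable (matrix_space m p)"
      using borel_measurable_matrix_entry[of "\<lambda>M. M" "matrix_space m p" m p i j]
      by (simp add: matrix_space_def cong: measurable_cong_sets sets_PiM_cong)
  qed
  then show ?thesis
    unfolding induced_law_def by (subst nn_integral_distr[OF T]) (auto simp: param_matrix_def case_prod_beta)
qed

section \<open>The comparison measure\<close>

lemma matrix_product_close:
  fixes U V U0 V0 :: mat
  assumes s: "0 < s" "s \<le> B" and ij: "i < m" "j < p" and UV: "(U0, V0) \<in> matrix_class m p K r B"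
    and U: "\<And>k. k < K \<Longrightarrow> k < r \<Longrightarrow> \<bar>U i k - U0 i k\<bar> \<le> s" "\<And>k. k < K \<Longrightarrow> \<not> k < r \<Longrightarrow> \<bar>U i k\<bar> \<le> t"
    and V: "\<And>k. k < K \<Longrightarrow> k < r \<Longrightarrow> \<bar>V j k - V0 j k\<bar> \<le> s" "\<And>k. k < K \<Longrightarrow> \<not> k < r \<Longrightarrow> \<bar>V j k\<bar> \<le> t"
  shows "\<bar>mult_transpose m p K U V i j - mult_transpose m p K U0 V0 i j\<bar> \<le> real K * (3 * B * s + t\<^sup>2)"
proof -
  have "mult_transpose m p K U V i j - mult_transpose m p K U0 V0 i j = (\<Sum>k<K. U i k * V j k - U0 i k * V0 j k)"
    using ij by (simp add: mult_transpose_def sum_subtractf)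
  also have "\<bar>\<dots>\<bar> \<le> (\<Sum>k<K. 3 * B * s + t\<^sup>2)"
  proof (rule order_trans[OF sum_abs sum_mono])
    fix k assume "k \<in> {..<K}"
    then have k: "k < K" by simp
    have U0: "r \<le> k \<Longrightarrow> U0 i k = 0" "\<bar>U0 i k\<bar> \<le> B" and V0: "\<bar>V0 j k\<bar> \<le> B"
      using UV ij k by (auto simp: matrix_class_def)
    show "\<bar>U i k * V j k - U0 i k * V0 j k\<bar> \<le> 3 * B * s + t\<^sup>2"
    proof (cases "k < r")
      case True
      have "\<bar>V j k\<bar> \<le> 2 * B" using V(1)[OF k True] V0 s by linarith
      then have "\<bar>(U i k - U0 i k) * V j k\<bar> \<le> s * (2 * B)"
        unfolding abs_mult using U(1)[OF k True] s by (intro mult_mono) auto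
      moreover have "\<bar>U0 i k * (V j k - V0 j k)\<bar> \<le> B * s"
        unfolding abs_mult using U0(2) V(1)[OF k True] s by (intro mult_mono) auto
      moreover have "U i k * V j k - U0 i k * V0 j k = (U i k - U0 i k) * V j k + U0 i k * (V j k - V0 j k)"
        by (simp add: algebra_simps)
      moreover have "s * (2 * B) + B * s = 3 * B * s" "0 \<le> t\<^sup>2" by auto
      ultimately show ?thesis by linarith
    next
      case False
      have "\<bar>U i k * V j k\<bar> \<le> t * t"
        unfolding abs_mult using U(2)[OF k False] V(2)[OF k False] by (intro mult_mono) auto
      moreover have "U0 i k = 0" using U0(1) False by simp
      moreover have "0 \<le> 3 * B * s" using s by simp
      ultimately show ?thesis by (simp add: power2_eq_square)
    qed
  qed
  also have "\<dots> = real K * (3 * B * s + t\<^sup>2)" by simp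
  finally show ?thesis .
qed

text \<open>The comparison measure: the first \<open>r\<close> columns are uniform around the true factors, the
  remaining ones are truncated centred Gaussians whose variance almost equals the corresponding
  \<open>\<gamma>\<^sub>k\<close>, so that each of these columns costs \<open>O(1)\<close> instead of \<open>O(m + p)\<close>.\<close>

lemma reference_density:
  fixes U0 V0 :: mat and a b B s v t \<eta> \<delta> :: real
  assumes UV: "(U0, V0) \<in> matrix_class m p K r B" and a: "0 < a" and b: "0 < b" and s: "0 < s" "s \<le> B"
    and v: "0 < v" and t: "0 < t" and \<eta>: "v / t\<^sup>2 \<le> \<eta>" "\<eta> \<le> 1 / 2" and \<delta>: "0 < \<delta>" "\<delta> \<le> 1"
  defines "E \<equiv> \<lambda>k. if k < r then 3 + ln (B / s) else 2 * \<eta> + \<delta> / 2"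
    and "w \<equiv> \<lambda>k. if k < r then B\<^sup>2 else v"
  defines "G \<equiv> \<lambda>k. ln (Gamma a) + (a + 1) * ln 2 + a * ln (w k / b) + b / w k - ln \<delta>"
  obtains h :: "parameter \<Rightarrow> real" where
    "h \<in> borel_measurable (param_lebesgue m p K)" "\<And>\<theta>. 0 \<le> h \<theta>"
    "density (param_lebesgue m p K) h \<in> mean_field m p K"
    "\<And>\<theta>. \<theta> \<in> space (param_lebesgue m p K) \<Longrightarrow>
       h \<theta> \<le> exp ((real m + real p) * (\<Sum>k<K. E k) + (\<Sum>k<K. G k)) * prior_density m p K a b \<theta>"
    "\<And>\<theta> i j. \<theta> \<in> space (param_lebesgue m p K) \<Longrightarrow> h \<theta> \<noteq> 0 \<Longrightarrow> i < m \<Longrightarrow> j < p \<Longrightarrow>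
      \<bar>param_matrix m p K \<theta> i j - mult_transpose m p K U0 V0 i j\<bar> \<le> real K * (3 * B * s + t\<^sup>2)"
proof -
  have B: "0 < B" using s by simp
  have q: "1 - \<eta> \<le> truncation_mass v t" using truncation_mass_ge[OF v t] \<eta> by simp
  then have q0: "0 < truncation_mass v t" using \<eta> by simp
  have w0: "0 < w k" for k using v B by (simp add: w_def)
  have wd: "w k < w k + w k * \<delta>" for k using w0[of k] \<delta> by simp
  define f where "f c k = (if k < r then uniform_density (c - s) (c + s) else truncated_normal_density v t)" for c :: real and k
  define g where "g k = uniform_density (w k) (w k + w k * \<delta>)" for k
  have fm: "f c k \<in> borel_measurable borel" for c k by (simp add: f_def)
  have f0: "0 \<le> f c k x" for c k x
    using s q0 by (simp add: f_def uniform_density_nonneg truncated_normal_density_def)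
  have f1: "(\<integral>\<^sup>+ x. ennreal (f c k x) \<partial>lborel) = 1" for c k
    using s nn_integral_uniform_density[of "c - s" "c + s"] nn_integral_truncated_normal_density[OF v q0]
    by (simp add: f_def)
  have gm: "g k \<in> borel_measurable borel" for k by (simp add: g_def)
  have g0: "0 \<le> g k x" for k x by (simp add: g_def uniform_density_nonneg[OF wd])
  have g1: "(\<integral>\<^sup>+ x. ennreal (g k x) \<partial>restrict_space lborel {0<..}) = 1" for k
    unfolding g_def by (rule nn_integral_uniform_density_pos[OF w0 wd])
  define h where "h = mean_field_density m p K (\<lambda>i k. f (U0 i k) k) (\<lambda>j k. f (V0 j k) k) g"
  show ?thesis
  proof
    show "h \<in> borel_measurable (param_lebesgue m p K)"
      unfolding h_def by (intro density_mean_field(2) fm f0 f1 gm g0 g1)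
    show "density (param_lebesgue m p K) h \<in> mean_field m p K"
      unfolding h_def by (intro density_mean_field(1) fm f0 f1 gm g0 g1)
    show "0 \<le> h \<theta>" for \<theta>
      using f0 g0 by (auto simp: h_def mean_field_density_def case_prod_beta intro!: mult_nonneg_nonneg prod_nonneg)
  next
    fix \<theta> :: parameter
    assume \<theta>: "\<theta> \<in> space (param_lebesgue m p K)"
    obtain U V \<gamma> where \<theta>_eq: "\<theta> = (U, V, \<gamma>)" by (metis prod_cases3)
    have \<gamma>0: "0 < \<gamma> k" if "k < K" for k
      using space_param_lebesgue_pos[OF \<theta> that] by (simp add: \<theta>_eq)
    have prior_nonneg: "0 \<le> prior_density m p K a b \<theta>"
      using prior_density_pos[OF a b \<theta>] by simp
    show "h \<theta> \<le> exp ((real m + real p) * (\<Sum>k<K. E k) + (\<Sum>k<K. G k)) * prior_density m p K a b \<theta>"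
    proof (cases "h \<theta> = 0")
      case True
      then show ?thesis using prior_nonneg by simp
    next
      case False
      \<comment> \<open>The Gaussian comparisons hold only for scales near \<open>w k\<close>. A
        nonzero value of \<open>h\<close> confines \<gamma> to that range.\<close>
      have gn: "g k (\<gamma> k) \<noteq> 0" if "k < K" for k
        using False that by (auto simp: h_def mean_field_density_def \<theta>_eq)
      have \<gamma>w: "w k \<le> \<gamma> k" "\<gamma> k \<le> w k + w k * \<delta>" if "k < K" for k
        using gn[OF that] by (auto simp: g_def uniform_density_def indicator_def split: if_splits)
      have fle: "f c k x \<le> exp (E k) * normal_density 0 (sqrt (\<gamma> k)) x" if k: "k < K" and c: "k < r \<longrightarrow> \<bar>c\<bar> \<le> B" for c k x
      proof (cases "k < r")
        case True
        have "B\<^sup>2 + B\<^sup>2 * \<delta> \<le> 2 * B\<^sup>2" using mult_left_mono[OF \<delta>(2), of "B\<^sup>2"] by simp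
        then have "uniform_density (c - s) (c + s) x \<le> exp 3 * B / s * normal_density 0 (sqrt (\<gamma> k)) x"
          using \<gamma>w[OF k] True c by (intro uniform_density_le_normal_density s) (auto simp: w_def)
        moreover have "exp (E k) = exp 3 * B / s" using True B s by (simp add: E_def exp_add)
        ultimately show ?thesis using True by (simp add: f_def)
      next
        case False
        then show ?thesis
          using truncated_normal_density_le_normal_density[OF v t \<eta>, of "\<gamma> k" \<delta> x] \<gamma>w[OF k]
          by (simp add: f_def E_def w_def)
      qed
      have gle: "g k (\<gamma> k) \<le> exp (G k) * inv_gamma_density a b (\<gamma> k)" if "k < K" for k
        unfolding g_def G_def by (rule uniform_density_le_inv_gamma_density[OF a b w0 \<delta> \<gamma>0[OF that]])
      have entries: "(\<Prod>i<m. \<Prod>k<K. f (U0 i k) k (U i k))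
         \<le> exp (real m * (\<Sum>k<K. E k)) * (\<Prod>i<m. \<Prod>k<K. normal_density 0 (sqrt (\<gamma> k)) (U i k))"
        if U0: "\<And>i k. i < m \<Longrightarrow> k < K \<Longrightarrow> \<bar>U0 i k\<bar> \<le> B" for m and U0 U :: mat
      proof -
        have "(\<Prod>i<m. \<Prod>k<K. f (U0 i k) k (U i k)) \<le> (\<Prod>i<m. \<Prod>k<K. exp (E k) * normal_density 0 (sqrt (\<gamma> k)) (U i k))"
          using f0 fle U0 by (intro prod_mono conjI prod_nonneg) auto
        also have "\<dots> = exp (real m * (\<Sum>k<K. E k)) * (\<Prod>i<m. \<Prod>k<K. normal_density 0 (sqrt (\<gamma> k)) (U i k))"
          by (simp add: prod.distrib exp_sum exp_of_nat_mult)
        finally show ?thesis .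
      qed
      have "(\<Prod>k<K. g k (\<gamma> k)) \<le> (\<Prod>k<K. exp (G k) * inv_gamma_density a b (\<gamma> k))"
        using g0 gle by (intro prod_mono) auto
      also have "\<dots> = exp (\<Sum>k<K. G k) * (\<Prod>k<K. inv_gamma_density a b (\<gamma> k))"
        by (simp add: prod.distrib exp_sum)
      finally have gammas: "(\<Prod>k<K. g k (\<gamma> k)) \<le> \<dots>" .
      have "h \<theta> \<le> (exp (real m * (\<Sum>k<K. E k)) * (\<Prod>i<m. \<Prod>k<K. normal_density 0 (sqrt (\<gamma> k)) (U i k))) *
         ((exp (real p * (\<Sum>k<K. E k)) * (\<Prod>j<p. \<Prod>k<K. normal_density 0 (sqrt (\<gamma> k)) (V j k))) *
          (exp (\<Sum>k<K. G k) * (\<Prod>k<K. inv_gamma_density a b (\<gamma> k))))"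
        unfolding h_def mean_field_density_def \<theta>_eq case_prod_conv
        using UV f0 g0
        by (intro mult_mono entries gammas mult_nonneg_nonneg prod_nonneg) (auto simp: matrix_class_def)
      also have "\<dots> = exp ((real m + real p) * (\<Sum>k<K. E k) + (\<Sum>k<K. G k)) * prior_density m p K a b \<theta>"
        by (simp add: prior_density_def \<theta>_eq exp_add algebra_simps)
      finally show ?thesis .
    qed
    fix i j assume hn: "h \<theta> \<noteq> 0" and i: "i < m" and j: "j < p"
    have Un: "f (U0 i k) k (U i k) \<noteq> 0" and Vn: "f (V0 j k) k (V j k) \<noteq> 0" if "k < K" for k
      using hn i j that by (auto simp: h_def mean_field_density_def \<theta>_eq)
    have close: "k < r \<Longrightarrow> \<bar>x - c\<bar> \<le> s" "\<not> k < r \<Longrightarrow> \<bar>x\<bar> \<le> t" if "f c k x \<noteq> 0" for c k x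
      using that by (auto simp: f_def uniform_density_def truncated_normal_density_def indicator_def split: if_splits)
    show "\<bar>param_matrix m p K \<theta> i j - mult_transpose m p K U0 V0 i j\<bar> \<le> real K * (3 * B * s + t\<^sup>2)"
      unfolding param_matrix_def \<theta>_eq fst_conv snd_conv
      by (rule matrix_product_close[OF s i j UV]) (use close Un Vn in blast)+
  qed
qed

section \<open>The rate constant and the cost of the comparison measure\<close>

text \<open>The cost turns out to be at most \<open>c + (3 + 8 * a) * ln (nmp)\<close> per unit of
  \<open>r * (m + p)\<close>. For \<open>nmp \<ge> 2\<close> one has
  \<open>1 \<le> 2 * ln (nmp)\<close>, so the constant part \<open>c\<close> is absorbed after
  doubling. The argument \<open>s\<close> is the noise variance.\<close>

definition rate_constant :: "real \<Rightarrow> real \<Rightarrow> real \<Rightarrow> real" where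
  "rate_constant a s B =
     (let \<sigma> = sqrt s;
          c = 6 + ln (1 + 6 * B\<^sup>2 / \<sigma>) + \<bar>ln (Gamma a)\<bar> + (a + 1)
            + a * (ln 512 + \<bar>ln (128 * \<sigma> / B\<^sup>2)\<bar>) + B\<^sup>2 / (64 * \<sigma>)
      in 2 * c + 3 + 8 * a)"

text \<open>Only the summand 6 is counted. The value 12 is large enough to give
  \<open>n * \<epsilon> \<ge> 1\<close> as soon as \<open>nmp \<ge> 2\<close>.\<close>

lemma rate_constant_ge:
  assumes "0 < a" "0 < s" "0 < B"
  shows "12 \<le> rate_constant a s B"
proof -
  define c where "c = 6 + ln (1 + 6 * B\<^sup>2 / sqrt s) + \<bar>ln (Gamma a)\<bar> + (a + 1)
      + a * (ln 512 + \<bar>ln (128 * sqrt s / B\<^sup>2)\<bar>) + B\<^sup>2 / (64 * sqrt s)"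
  have "6 + 0 + 0 + 0 + 0 + 0 \<le> c"
    unfolding c_def using assms by (intro add_mono mult_nonneg_nonneg ln_ge_zero) auto
  moreover have "rate_constant a s B = 2 * c + 3 + 8 * a"
    by (simp add: rate_constant_def Let_def c_def)
  ultimately show ?thesis using assms(1) by linarith
qed

text \<open>Every dimension is at most \<open>N = nmp\<close>, so each logarithm is a constant plus
  a multiple of \<open>ln N\<close>. The active columns cost \<open>r * (m + p)\<close> such terms;
  everything charged per column is absorbed through \<open>K \<le> r * (m + p)\<close>.\<close>

lemma reference_cost_le:
  fixes m p n K r :: nat and a b B \<sigma> :: real
  assumes m: "1 \<le> m" and p: "1 \<le> p" and n: "1 \<le> n" and K: "1 \<le> K" "K \<le> min m p" and r: "1 \<le> r" "r \<le> K"
    and a: "0 < a" and \<sigma>: "0 < \<sigma>" and B: "0 < B" and N2: "2 \<le> n * m * p"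
    and b: "b = B\<^sup>2 / (512 * real (n * m * p) ^ 4 * (real (max m p) * real K)\<^sup>2)"
  defines "\<delta> \<equiv> 1 / (real m + real p)" and "s \<equiv> B / (1 + 6 * B\<^sup>2 / \<sigma> * real (n * m * p))"
    and "v \<equiv> \<sigma> / (4 * real K * real n * (real m + real p))" and "\<eta> \<equiv> 1 / (2 * (real m + real p))"
  defines "E \<equiv> \<lambda>k. if k < r then 3 + ln (B / s) else 2 * \<eta> + \<delta> / 2"
    and "w \<equiv> \<lambda>k. if k < r then B\<^sup>2 else v"
  defines "G \<equiv> \<lambda>k. ln (Gamma a) + (a + 1) * ln 2 + a * ln (w k / b) + b / w k - ln \<delta>"
  shows "(real m + real p) * (\<Sum>k<K. E k) + (\<Sum>k<K. G k)
    \<le> rate_constant a (\<sigma>\<^sup>2) B * real r * (real m + real p) * ln (real (n * m * p))"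
proof -
  define N where "N = real (n * m * p)"
  define l where "l = ln N"
  define q where "q = real (max m p)"
  have N: "2 \<le> N" using N2 unfolding N_def by (metis of_nat_le_iff of_nat_numeral)
  have l: "1 \<le> 2 * l"
  proof -
    have "ln 2 \<le> l" using N by (simp add: l_def)
    then show ?thesis using ln2_ge_two_thirds by linarith
  qed
  have le_N: "real m \<le> N" "real p \<le> N" "real n \<le> N" "real m * real p \<le> N"
  proof -
    have "m * 1 * 1 \<le> m * n * p" "p * 1 * 1 \<le> p * n * m" "n * 1 * 1 \<le> n * m * p" "m * p * 1 \<le> m * p * n"
      using m n p by (intro mult_le_mono; simp)+
    then have "m \<le> n * m * p" "p \<le> n * m * p" "n \<le> n * m * p" "m * p \<le> n * m * p"
      by (simp_all add: mult_ac)
    then show "real m \<le> N" "real p \<le> N" "real n \<le> N" "real m * real p \<le> N"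
      unfolding N_def of_nat_mult[symmetric] of_nat_le_iff by blast+
  qed
  have q: "1 \<le> q" "q \<le> N" "real m + real p \<le> 2 * q" "q \<le> real m + real p" "real K \<le> q"
    using m p K le_N by (auto simp: q_def max_def)
  have KN: "1 \<le> real K" "real K \<le> N" using K q le_N by auto
  have mp: "2 \<le> real m + real p" "real m + real p \<le> N\<^sup>2"
  proof -
    show "2 \<le> real m + real p" using m p by simp
    have "real m + real p \<le> 2 * N" using le_N by simp
    also have "\<dots> \<le> N * N" using N by (intro mult_right_mono) auto
    finally show "real m + real p \<le> N\<^sup>2" by (simp add: power2_eq_square)
  qed
  have n1: "1 \<le> real n" using n by simp
  have b0: "0 < b" unfolding b using B q KN N N_def[symmetric] q_def[symmetric] by auto
  have bi: "1 / b = 512 * N ^ 4 * (q * real K)\<^sup>2 / B\<^sup>2"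
    unfolding b N_def[symmetric] q_def[symmetric] by simp
  have v0: "0 < v" unfolding v_def using \<sigma> KN n1 mp by auto
  have N1: "1 \<le> N ^ 4" using N by (intro one_le_power) auto
  define c1 where "c1 = \<bar>ln (128 * \<sigma> / B\<^sup>2)\<bar>"
  have E1: "3 + ln (B / s) \<le> 3 + ln (1 + 6 * B\<^sup>2 / \<sigma>) + l"
  proof -
    have pos: "0 < 6 * B\<^sup>2 / \<sigma>" using B \<sigma> by simp
    have "B / s = 1 + 6 * B\<^sup>2 / \<sigma> * N" using B by (simp add: s_def N_def)
    also have "\<dots> \<le> (1 + 6 * B\<^sup>2 / \<sigma>) * N" using N by (simp add: algebra_simps)
    finally have "B / s \<le> (1 + 6 * B\<^sup>2 / \<sigma>) * N" .
    moreover have "0 < B / s"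
      using \<open>B / s = 1 + 6 * B\<^sup>2 / \<sigma> * N\<close> mult_pos_pos[OF pos, of N] N by linarith
    ultimately have "ln (B / s) \<le> ln ((1 + 6 * B\<^sup>2 / \<sigma>) * N)" by simp
    also have "\<dots> = ln (1 + 6 * B\<^sup>2 / \<sigma>) + l" using pos N by (simp add: l_def ln_mult)
    finally show ?thesis by simp
  qed
  have ln_w: "ln (w k / b) \<le> ln 512 + c1 + 8 * l" for k
  proof (cases "k < r")
    case True
    have "B\<^sup>2 / b = B\<^sup>2 * (1 / b)" by simp
    also have "\<dots> = 512 * (N ^ 4 * (q * real K)\<^sup>2)"
      unfolding bi using B by simp
    \<comment> \<open>Both \<open>q\<close> and \<open>K\<close> are at most \<open>N\<close>, which
      produces the coefficient 8 of \<open>l\<close>.\<close>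
    also have "\<dots> \<le> 512 * (N ^ 4 * (N * N)\<^sup>2)"
      using q KN N by (intro mult_left_mono power_mono mult_mono) auto
    also have "\<dots> = 512 * N ^ 8" by (simp add: power_mult_distrib power_add[symmetric] power2_eq_square[symmetric])
    finally have "ln (B\<^sup>2 / b) \<le> ln (512 * N ^ 8)" using B b0 N by simp
    also have "\<dots> = ln 512 + 8 * l" using N by (simp add: ln_mult ln_realpow l_def)
    finally show ?thesis using True by (simp add: w_def c1_def)
  next
    case False
    have "v / b = v * (1 / b)" by simp
    \<comment> \<open>Here \<open>128 = 512 / 4\<close>, the 4 coming from \<open>v\<close>. The
      last factor is split off because \<open>q \<le> m + p\<close> makes it at most one.\<close>
    also have "\<dots> = 128 * \<sigma> / B\<^sup>2 * (N ^ 4 * q * real K) * (q / (real n * (real m + real p)))"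
      unfolding bi v_def using KN n1 mp B by (simp add: divide_simps power2_eq_square)
    also have "\<dots> \<le> 128 * \<sigma> / B\<^sup>2 * (N ^ 4 * N * N) * 1"
    proof (intro mult_mono)
      have "1 * q \<le> real n * (real m + real p)" using q n1 by (intro mult_mono) auto
      then show "q / (real n * (real m + real p)) \<le> 1" using n1 mp by simp
    qed (use q KN N B \<sigma> n1 mp in auto)
    also have "\<dots> = 128 * \<sigma> / B\<^sup>2 * N ^ 6" by (simp add: numeral_eq_Suc)
    finally have "ln (v / b) \<le> ln (128 * \<sigma> / B\<^sup>2 * N ^ 6)" using v0 b0 B \<sigma> N by simp
    also have "\<dots> = ln (128 * \<sigma> / B\<^sup>2) + 6 * l"
      using N B \<sigma> ln_mult[of "128 * \<sigma> / B\<^sup>2" "N ^ 6"] ln_realpow[of N 6] by (simp add: l_def)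
    also have "\<dots> \<le> ln 512 + c1 + 8 * l"
    proof -
      have "0 \<le> ln (512 :: real)" by simp
      then show ?thesis using l abs_ge_self[of "ln (128 * \<sigma> / B\<^sup>2)"] unfolding c1_def by linarith
    qed
    finally show ?thesis using False by (simp add: w_def)
  qed
  have b_w: "b / w k \<le> 1 + B\<^sup>2 / (64 * \<sigma>)" for k
  proof (cases "k < r")
    case True
    have "1 * 1 * 1 \<le> 512 * N ^ 4 * (q * real K)\<^sup>2"
      using N1 q KN by (intro mult_mono one_le_power) (auto intro: mult_ge1_I)
    then have "1 / (512 * N ^ 4 * (q * real K)\<^sup>2) \<le> 1" by (simp only: divide_le_eq_1) linarith
    moreover have "b / B\<^sup>2 = 1 / (512 * N ^ 4 * (q * real K)\<^sup>2)"
      unfolding b N_def[symmetric] q_def[symmetric] using B by simp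
    ultimately have "b / B\<^sup>2 \<le> 1" by simp
    moreover have "0 \<le> B\<^sup>2 / (64 * \<sigma>)" using \<sigma> by simp
    ultimately show ?thesis using True by (simp add: w_def)
  next
    case False
    have "b / v = B\<^sup>2 / (128 * \<sigma>) * ((real n * (real m + real p)) / (N ^ 4 * q\<^sup>2 * real K))"
      unfolding b N_def[symmetric] q_def[symmetric] v_def using \<sigma> KN n1 mp
      by (simp add: divide_simps power2_eq_square)
    \<comment> \<open>The power \<open>N ^ 4\<close> in \<open>b\<close> absorbs \<open>n\<close>,
      and \<open>q^2\<close> absorbs \<open>m + p\<close> up to the factor 2; hence the 64 in the
      rate constant.\<close>
    also have "\<dots> \<le> B\<^sup>2 / (128 * \<sigma>) * 2"
    proof (intro mult_left_mono)
      have "real n * (real m + real p) \<le> N ^ 4 * (2 * q)"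
      proof (intro mult_mono)
        have "real n \<le> N ^ 1" using le_N by simp
        also have "\<dots> \<le> N ^ 4" using N by (intro power_increasing) auto
        finally show "real n \<le> N ^ 4" .
      qed (use q N1 mp in auto)
      also have "\<dots> \<le> N ^ 4 * (2 * q\<^sup>2 * real K)"
      proof (intro mult_left_mono)
        have "2 * q * 1 \<le> 2 * q * (q * real K)" using q KN by (intro mult_left_mono) (auto intro: mult_ge1_I)
        then show "2 * q \<le> 2 * q\<^sup>2 * real K" by (simp add: power2_eq_square mult_ac)
      qed (use N1 in auto)
      finally show "(real n * (real m + real p)) / (N ^ 4 * q\<^sup>2 * real K) \<le> 2"
        using N q KN by (simp add: divide_le_eq mult_ac)
    qed (use \<sigma> in auto)
    finally show ?thesis using False by (simp add: w_def)
  qed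
  have ln_\<delta>: "- ln \<delta> \<le> 2 * l"
  proof -
    have "- ln \<delta> = ln (real m + real p)" using mp by (simp add: \<delta>_def ln_div)
    also have "\<dots> \<le> ln (N\<^sup>2)" using mp N by (subst ln_le_cancel_iff) auto
    also have "\<dots> = 2 * l" using N by (simp add: ln_realpow l_def)
    finally show ?thesis .
  qed
  define g where "g = \<bar>ln (Gamma a)\<bar> + (a + 1) + a * (ln 512 + c1 + 8 * l) + 1 + B\<^sup>2 / (64 * \<sigma>) + 2 * l"
  have Gle: "G k \<le> g" for k
  proof -
    have "a * ln (w k / b) \<le> a * (ln 512 + c1 + 8 * l)" using ln_w[of k] a by (intro mult_left_mono) auto
    moreover have "(a + 1) * ln 2 \<le> (a + 1) * 1" using a ln2_le_25_over_36 by (intro mult_left_mono) auto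
    moreover have "c + x + y + u - d \<le> \<bar>c\<bar> + x' + y' + 1 + u' + d'"
      if "y \<le> y'" "x \<le> x' * 1" "u \<le> 1 + u'" "- d \<le> d'" for c x y u d x' y' u' d' :: real
      using that by linarith
    ultimately show ?thesis using b_w[of k] ln_\<delta> unfolding G_def g_def by blast
  qed
  have c1_0: "0 \<le> c1" by (simp add: c1_def)
  have g0: "0 \<le> g"
    unfolding g_def using a l c1_0 \<sigma> by (intro add_nonneg_nonneg mult_nonneg_nonneg) auto
  have Kr: "real K \<le> real r * (real m + real p)"
  proof -
    have "1 * real K \<le> real r * (real m + real p)" using r q by (intro mult_mono) auto
    then show ?thesis by simp
  qed
  define L where "L = ln (1 + 6 * B\<^sup>2 / \<sigma>)"
  have L0: "0 \<le> L" unfolding L_def using B \<sigma> by (intro ln_ge_zero) auto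
  have "(real m + real p) * (\<Sum>k<K. E k) \<le> (real m + real p) * (real r * (3 + L + l) + real K * (2 * \<eta> + \<delta> / 2))"
  proof (intro mult_left_mono)
    have "(\<Sum>k<K. E k) \<le> (\<Sum>k<K. (if k < r then 3 + L + l else 0) + (2 * \<eta> + \<delta> / 2))"
    proof (rule sum_mono)
      fix k
      have "0 \<le> 2 * \<eta> + \<delta> / 2" using mp by (simp add: \<eta>_def \<delta>_def)
      then show "E k \<le> (if k < r then 3 + L + l else 0) + (2 * \<eta> + \<delta> / 2)"
        using E1 unfolding E_def L_def by auto
    qed
    also have "\<dots> = (\<Sum>k<K. if k < r then 3 + L + l else 0) + real K * (2 * \<eta> + \<delta> / 2)"
      by (simp add: sum.distrib)
    also have "(\<Sum>k<K. if k < r then 3 + L + l else 0) = (\<Sum>k\<in>{..<r}. 3 + L + l)"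
      using r by (intro sum.mono_neutral_cong_right) auto
    finally show "(\<Sum>k<K. E k) \<le> real r * (3 + L + l) + real K * (2 * \<eta> + \<delta> / 2)" by simp
  qed (use mp in auto)
  also have "\<dots> = real r * (real m + real p) * (3 + L + l) + real K * ((real m + real p) * (2 * \<eta> + \<delta> / 2))"
    by (simp add: algebra_simps)
  also have "(real m + real p) * (2 * \<eta> + \<delta> / 2) = 3 / 2"
    using mp by (simp add: \<eta>_def \<delta>_def field_simps)
  also have "real K * (3 / 2) \<le> real r * (real m + real p) * (3 / 2)"
    using Kr by (intro mult_right_mono) auto
  finally have S1: "(real m + real p) * (\<Sum>k<K. E k) \<le> real r * (real m + real p) * (3 + L + l + 3 / 2)"
    by (simp add: algebra_simps)
  have "(\<Sum>k<K. G k) \<le> real K * g" using sum_mono[of "{..<K}" G "\<lambda>_. g"] Gle by simp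
  also have "\<dots> \<le> real r * (real m + real p) * g" using Kr g0 by (rule mult_right_mono)
  finally have "(real m + real p) * (\<Sum>k<K. E k) + (\<Sum>k<K. G k) \<le> real r * (real m + real p) * (3 + L + l + 3 / 2 + g)"
    using S1 by (simp add: algebra_simps)
  also have "\<dots> \<le> real r * (real m + real p) * (rate_constant a (\<sigma>\<^sup>2) B * l)"
  proof (intro mult_left_mono)
    define c where "c = 6 + L + \<bar>ln (Gamma a)\<bar> + (a + 1) + a * (ln 512 + c1) + B\<^sup>2 / (64 * \<sigma>)"
    have c0: "0 \<le> c"
      unfolding c_def using a L0 c1_0 \<sigma> by (intro add_nonneg_nonneg mult_nonneg_nonneg) auto
    \<comment> \<open>The constants add up to \<open>3 + 3 / 2 + 1\<close>, rounded up to the 6 in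
      \<open>c\<close>; the multiples of \<open>l\<close> are \<open>l + 2 * l\<close> and
      \<open>8 * a * l\<close>.\<close>
    have "3 + L + l + 3 / 2 + g \<le> c + (3 + 8 * a) * l"
      unfolding g_def c_def by (simp add: algebra_simps)
    also have "\<dots> \<le> c * (2 * l) + (3 + 8 * a) * l"
      using mult_left_mono[OF l c0] by simp
    also have "\<dots> = rate_constant a (\<sigma>\<^sup>2) B * l"
      using \<sigma> by (simp add: rate_constant_def Let_def c_def L_def c1_def algebra_simps)
    finally show "3 + L + l + 3 / 2 + g \<le> rate_constant a (\<sigma>\<^sup>2) B * l" .
  qed (use mp in auto)
  finally show ?thesis by (simp add: l_def N_def mult_ac)
qed

section \<open>The concentration bound\<close>

text \<open>The number \<open>\<tau> = n * \<epsilon>\<close> bounds the cost of the comparison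
  measure and is also the threshold in the good event. The total is at most
  \<open>\<tau> + \<alpha> * (2 * \<tau>) + ln \<tau>\<close>, which
  \<open>ln \<tau> \<le> \<tau>\<close> turns into \<open>2 * (\<alpha> + 1) * \<tau>\<close>;
  dividing by \<open>n * (1 - \<alpha>)\<close> gives the stated factor.\<close>

lemma good_event_bound:
  fixes m p n K r :: nat and a b B \<sigma> \<alpha> \<epsilon> :: real
  assumes m: "1 \<le> m" and p: "1 \<le> p" and n: "1 \<le> n" and K: "1 \<le> K" "K \<le> min m p" and r: "1 \<le> r" "r \<le> K"
    and a: "0 < a" and \<sigma>: "0 < \<sigma>" and B: "0 < B" and \<alpha>: "0 < \<alpha>" "\<alpha> < 1" and N2: "2 \<le> n * m * p"
    and b: "b = B\<^sup>2 / (512 * real (n * m * p) ^ 4 * (real (max m p) * real K)\<^sup>2)"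
    and UV: "(U0, V0) \<in> matrix_class m p K r B" and M0: "M0 = mult_transpose m p K U0 V0"
    and \<epsilon>: "\<epsilon> = eps_rate (rate_constant a (\<sigma>\<^sup>2) B) r m p n"
    and X: "X \<in> good_event m p n K a b \<sigma> \<alpha> M0 (real n * \<epsilon>)"
    and post: "is_variational_approx m p n K a b \<sigma> \<alpha> X \<rho>"
  shows "(\<integral>\<^sup>+ M. ennreal (renyi_dist m p \<alpha> \<sigma> M M0) \<partial>induced_law m p K \<rho>)
    \<le> ennreal (2 * (\<alpha> + 1) / (1 - \<alpha>) * \<epsilon>)"
proof -
  define \<tau> where "\<tau> = real n * \<epsilon>"
  define N where "N = real (n * m * p)"
  define \<delta> where "\<delta> = 1 / (real m + real p)"
  define s where "s = B / (1 + 6 * B\<^sup>2 / \<sigma> * real (n * m * p))"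
  define v where "v = \<sigma> / (4 * real K * real n * (real m + real p))"
  define \<eta> where "\<eta> = 1 / (2 * (real m + real p))"
  \<comment> \<open>\<open>s\<close> and \<open>t\<close> are small enough to keep \<open>M\<close> within \<open>\<sigma>/n\<close> of \<open>M0\<close>, and \<open>v = \<eta> t\<^sup>2\<close> makes truncation at \<open>t\<close>
    cost at most \<open>1/(m + p)\<close> per entry.\<close>
  define t where "t = sqrt (\<sigma> / (2 * real K * real n))"
  have N: "2 \<le> N" using N2 unfolding N_def by (metis of_nat_le_iff of_nat_numeral)
  have mp: "2 \<le> real m + real p" using m p by simp
  have Kn: "1 \<le> real K" "1 \<le> real n" using K n by auto
  have b0: "0 < b" unfolding b using B m p n K by (intro divide_pos_pos mult_pos_pos zero_less_power) auto
  have \<tau>_eq: "\<tau> = rate_constant a (\<sigma>\<^sup>2) B * real r * (real m + real p) * ln N"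
    using n by (simp add: \<tau>_def \<epsilon> eps_rate_def N_def)
  \<comment> \<open>Needed to absorb the constant in the noise term and to bound
    \<open>ln \<tau>\<close> by \<open>\<tau>\<close>.\<close>
  have \<tau>1: "1 \<le> \<tau>"
  proof -
    have "2 / 3 \<le> ln N" using ln2_ge_two_thirds N ln_mono[of 2 N] by linarith
    then have "12 * 1 * 2 * (2 / 3) \<le> \<tau>"
      unfolding \<tau>_eq using rate_constant_ge[OF a _ B, of "\<sigma>\<^sup>2"] \<sigma> r mp by (intro mult_mono) auto
    then show ?thesis by simp
  qed
  have x0: "0 < 6 * B\<^sup>2 / \<sigma> * N" using B \<sigma> N by simp
  then have s: "0 < s" "s \<le> B"
    using B unfolding s_def N_def[symmetric] by (auto simp: divide_le_eq)
  \<comment> \<open>The summand 1 in the denominator of \<open>s\<close> ensures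
    \<open>s \<le> B\<close>; dropping it yields this second property.\<close>
  have s2: "6 * B * N * s \<le> \<sigma>"
  proof -
    have "s \<le> B / (6 * B\<^sup>2 / \<sigma> * N)"
      unfolding s_def N_def[symmetric] using x0 B by (intro divide_left_mono mult_pos_pos[OF add_pos_pos]) auto
    then have "6 * B * N * s \<le> 6 * B * N * (B / (6 * B\<^sup>2 / \<sigma> * N))"
      using B N by (intro mult_left_mono) auto
    also have "\<dots> = \<sigma>" using B N \<sigma> by (simp add: power2_eq_square)
    finally show ?thesis .
  qed
  have v: "0 < v" unfolding v_def using \<sigma> Kn mp by auto
  have t: "0 < t" and t2: "t\<^sup>2 = \<sigma> / (2 * real K * real n)" unfolding t_def using \<sigma> Kn by auto
  have \<eta>: "v / t\<^sup>2 \<le> \<eta>" "\<eta> \<le> 1 / 2"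
    unfolding t2 v_def \<eta>_def using \<sigma> Kn mp by (auto simp: field_simps)
  have \<delta>: "0 < \<delta>" "\<delta> \<le> 1" using mp by (auto simp: \<delta>_def)
  have radius: "real K * (3 * B * s + t\<^sup>2) \<le> \<sigma> / real n"
  proof -
    have "real K * real n \<le> N"
    proof -
      have "K * n \<le> m * n * p" using K p by (simp add: le_trans[of K m "m * p"] mult.commute mult.left_commute)
      then show ?thesis unfolding N_def of_nat_mult[symmetric] of_nat_le_iff by (simp add: mult_ac)
    qed
    then have "(real K * real n) * (6 * B * s) \<le> N * (6 * B * s)"
      using B s by (intro mult_right_mono) auto
    also have "\<dots> \<le> \<sigma>" using s2 by (simp add: mult_ac)
    finally have "real K * (3 * B * s) \<le> \<sigma> / (2 * real n)"
      using Kn by (simp add: field_simps)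
    moreover have "real K * t\<^sup>2 = \<sigma> / (2 * real n)" unfolding t2 using Kn by simp
    moreover have "\<sigma> / (2 * real n) + \<sigma> / (2 * real n) = \<sigma> / real n" by simp
    ultimately show ?thesis unfolding distrib_left by linarith
  qed
  obtain h :: "parameter \<Rightarrow> real" where h: "h \<in> borel_measurable (param_lebesgue m p K)" "\<And>\<theta>. 0 \<le> h \<theta>"
      "density (param_lebesgue m p K) h \<in> mean_field m p K"
    and hR: "\<And>\<theta>. \<theta> \<in> space (param_lebesgue m p K) \<Longrightarrow>
       h \<theta> \<le> exp ((real m + real p) * (\<Sum>k<K. if k < r then 3 + ln (B / s) else 2 * \<eta> + \<delta> / 2) +
         (\<Sum>k<K. ln (Gamma a) + (a + 1) * ln 2 + a * ln ((if k < r then B\<^sup>2 else v) / b)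
            + b / (if k < r then B\<^sup>2 else v) - ln \<delta>)) * prior_density m p K a b \<theta>"
    and hd: "\<And>\<theta> i j. \<theta> \<in> space (param_lebesgue m p K) \<Longrightarrow> h \<theta> \<noteq> 0 \<Longrightarrow> i < m \<Longrightarrow> j < p \<Longrightarrow>
      \<bar>param_matrix m p K \<theta> i j - mult_transpose m p K U0 V0 i j\<bar> \<le> real K * (3 * B * s + t\<^sup>2)"
    by (rule reference_density[OF UV a b0 s v t \<eta> \<delta>]) (rule that)
  have cost: "(real m + real p) * (\<Sum>k<K. if k < r then 3 + ln (B / s) else 2 * \<eta> + \<delta> / 2) +
         (\<Sum>k<K. ln (Gamma a) + (a + 1) * ln 2 + a * ln ((if k < r then B\<^sup>2 else v) / b)
            + b / (if k < r then B\<^sup>2 else v) - ln \<delta>) \<le> \<tau>"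
    unfolding \<tau>_eq N_def s_def v_def \<eta>_def \<delta>_def
    by (rule reference_cost_le[OF m p n K r a \<sigma> B N2 b])
  have X': "X \<in> space (sample_law m p n \<sigma> M0)" "tilted_integral m p n K a b \<sigma> \<alpha> M0 X \<le> ennreal \<tau>"
      "absolute_noise n M0 X \<le> real n * \<sigma> * \<tau>"
    using X by (auto simp: good_event_def \<tau>_def)
  have "(\<integral>\<^sup>+ \<theta>. ennreal (real n * (1 - \<alpha>) * renyi_dist m p \<alpha> \<sigma> (param_matrix m p K \<theta>) M0) \<partial>\<rho>)
    \<le> ennreal (\<tau> + \<alpha> * (2 * \<tau>) + ln \<tau>)"
  proof (rule variational_approx_bound[OF m p a b0 \<sigma> \<alpha> X'(1) post h, where \<delta> = "\<sigma> / real n"])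
    fix \<theta> assume \<theta>: "\<theta> \<in> space (param_lebesgue m p K)"
    then show "h \<theta> \<le> exp \<tau> * prior_density m p K a b \<theta>"
      using cost prior_density_pos[OF a b0 \<theta>] by (intro order_trans[OF hR[OF \<theta>] mult_right_mono]) auto
    show "\<bar>param_matrix m p K \<theta> i j - M0 i j\<bar> \<le> \<sigma> / real n" if "h \<theta> \<noteq> 0" "i < m" "j < p" for i j
      unfolding M0 by (rule order_trans[OF hd[OF \<theta> that] radius])
  next
    \<comment> \<open>With radius \<open>\<sigma> / n\<close> and total noise at most
      \<open>n * \<sigma> * \<tau>\<close>, the factors \<open>n\<close> cancel and
      \<open>T = 2 * \<tau>\<close> is admissible.\<close>
    have "real n * (\<sigma> / real n)\<^sup>2 + 2 * (\<sigma> / real n) * absolute_noise n M0 X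
       \<le> \<sigma>\<^sup>2 + 2 * (\<sigma> / real n) * (real n * \<sigma> * \<tau>)"
    proof (intro add_mono mult_left_mono X'(3))
      have "real n * (\<sigma> / real n)\<^sup>2 = \<sigma>\<^sup>2 / real n" using Kn by (simp add: power2_eq_square)
      also have "\<dots> \<le> \<sigma>\<^sup>2" using Kn mult_left_mono[OF Kn(2), of "\<sigma>\<^sup>2"] by (simp add: divide_le_eq)
      finally show "real n * (\<sigma> / real n)\<^sup>2 \<le> \<sigma>\<^sup>2" .
    qed (use \<sigma> in auto)
    also have "\<dots> = (1 + 2 * \<tau>) * \<sigma>\<^sup>2" using Kn by (simp add: power2_eq_square algebra_simps)
    also have "\<dots> \<le> (2 * (2 * \<tau>)) * \<sigma>\<^sup>2" using \<tau>1 by (intro mult_right_mono) auto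
    finally show "(real n * (\<sigma> / real n)\<^sup>2 + 2 * (\<sigma> / real n) * absolute_noise n M0 X) / (2 * \<sigma>\<^sup>2) \<le> 2 * \<tau>"
      using \<sigma> by (simp add: divide_le_eq mult_ac)
  next
    show "0 < \<tau>" using \<tau>1 by simp
  qed (rule X'(2))
  also have "\<dots> \<le> ennreal (2 * (\<alpha> + 1) * \<tau>)"
  proof (rule ennreal_leI)
    have "ln \<tau> \<le> \<tau>" using ln_le_minus_one[of \<tau>] \<tau>1 by simp
    then show "\<tau> + \<alpha> * (2 * \<tau>) + ln \<tau> \<le> 2 * (\<alpha> + 1) * \<tau>" by (simp add: algebra_simps)
  qed
  finally have bound: "(\<integral>\<^sup>+ \<theta>. ennreal (real n * (1 - \<alpha>) * renyi_dist m p \<alpha> \<sigma> (param_matrix m p K \<theta>) M0) \<partial>\<rho>)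
    \<le> ennreal (2 * (\<alpha> + 1) * \<tau>)" .
  have c: "0 < real n * (1 - \<alpha>)" using Kn \<alpha> by simp
  have \<rho>: "\<rho> \<in> mean_field m p K"
    using post unfolding is_variational_approx_def is_arg_min_def by simp
  have meas: "(\<lambda>\<theta>. renyi_dist m p \<alpha> \<sigma> (param_matrix m p K \<theta>) M0) \<in> borel_measurable \<rho>"
    using borel_measurable_renyi_dist[of m p "param_matrix m p K" "param_lebesgue m p K" \<alpha> \<sigma> M0]
      borel_measurable_param_matrix[of _ m _ p K] mean_field_prob_space(2)[OF \<rho>]
    by (simp cong: measurable_cong_sets)
  have "(\<integral>\<^sup>+ M. ennreal (renyi_dist m p \<alpha> \<sigma> M M0) \<partial>induced_law m p K \<rho>)
    = (\<integral>\<^sup>+ \<theta>. ennreal (1 / (real n * (1 - \<alpha>))) *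
        ennreal (real n * (1 - \<alpha>) * renyi_dist m p \<alpha> \<sigma> (param_matrix m p K \<theta>) M0) \<partial>\<rho>)"
    unfolding nn_integral_induced_law[OF \<rho>]
    using n \<alpha> renyi_nonneg[OF m p \<alpha>] by (intro nn_integral_cong) (simp add: ennreal_mult[symmetric])
  also have "\<dots> = ennreal (1 / (real n * (1 - \<alpha>))) *
      (\<integral>\<^sup>+ \<theta>. ennreal (real n * (1 - \<alpha>) * renyi_dist m p \<alpha> \<sigma> (param_matrix m p K \<theta>) M0) \<partial>\<rho>)"
    by (rule nn_integral_cmult) (use meas in measurable)
  also have "\<dots> \<le> ennreal (1 / (real n * (1 - \<alpha>))) * ennreal (2 * (\<alpha> + 1) * \<tau>)"
    by (rule mult_left_mono[OF bound]) simp
  also have "\<dots> = ennreal (1 / (real n * (1 - \<alpha>)) * (2 * (\<alpha> + 1) * \<tau>))"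
    using c \<alpha> \<tau>1 by (intro ennreal_mult[symmetric]) auto
  also have "1 / (real n * (1 - \<alpha>)) * (2 * (\<alpha> + 1) * \<tau>) = 2 * (\<alpha> + 1) / (1 - \<alpha>) * \<epsilon>"
    using Kn \<alpha> by (simp add: \<tau>_def field_simps)
  finally show ?thesis .
qed

theorem theorem4p3:
  shows "\<exists>D :: real \<Rightarrow> real \<Rightarrow> real \<Rightarrow> real.
    (\<forall>a s B. 0 < a \<longrightarrow> 0 < s \<longrightarrow> 0 < B \<longrightarrow> 0 < D a s B) \<and>
    (\<forall>(m::nat) (p::nat) (n::nat) (K::nat) (r::nat) (a::real) (b::real) (B::real) (\<sigma>::real)
       (\<alpha>::real) (M0::mat)
       (post :: (nat \<Rightarrow> observation) \<Rightarrow> parameter measure) (\<epsilon>::real).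
      1 \<le> m \<longrightarrow> 1 \<le> p \<longrightarrow> 1 \<le> n \<longrightarrow> 1 \<le> K \<longrightarrow> K \<le> min m p \<longrightarrow> 1 \<le> r \<longrightarrow> r \<le> K \<longrightarrow>
      0 < a \<longrightarrow> 0 < \<sigma> \<longrightarrow> 0 < B \<longrightarrow> 0 < \<alpha> \<longrightarrow> \<alpha> < 1 \<longrightarrow>
      b = B\<^sup>2 / (512 * real (n * m * p) ^ 4 * (real (max m p) * real K)\<^sup>2) \<longrightarrow>
      (\<exists>(U, V) \<in> matrix_class m p K r B. M0 = mult_transpose m p K U V) \<longrightarrow>
      (\<forall>X \<in> space (sample_law m p n \<sigma> M0). is_variational_approx m p n K a b \<sigma> \<alpha> X (post X)) \<longrightarrow>
      \<epsilon> = eps_rate (D a (\<sigma>\<^sup>2) B) r m p n \<longrightarrow>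
      (\<exists>A \<in> sets (sample_law m p n \<sigma> M0).
         A \<subseteq> {X \<in> space (sample_law m p n \<sigma> M0).
           (\<integral>\<^sup>+ M. ennreal (renyi_dist m p \<alpha> \<sigma> M M0) \<partial>(induced_law m p K (post X)))
             \<le> ennreal (2 * (\<alpha> + 1) / (1 - \<alpha>) * \<epsilon>)} \<and>
         1 - 2 / ereal (real n * \<epsilon>) \<le> ereal (measure (sample_law m p n \<sigma> M0) A)))"
proof (intro exI[of _ rate_constant] conjI allI impI)
  fix a s B :: real
  assume "0 < a" "0 < s" "0 < B"
  then show "0 < rate_constant a s B" using rate_constant_ge by fastforce
next
  fix m p n K r :: nat and a b B \<sigma> \<alpha> :: real and M0 :: mat
    and post :: "(nat \<Rightarrow> observation) \<Rightarrow> parameter measure" and \<epsilon> :: real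
  assume m: "1 \<le> m" and p: "1 \<le> p" and n: "1 \<le> n" and K: "1 \<le> K" "K \<le> min m p" and r: "1 \<le> r" "r \<le> K"
    and a: "0 < a" and \<sigma>: "0 < \<sigma>" and B: "0 < B" and \<alpha>: "0 < \<alpha>" "\<alpha> < 1"
    and b: "b = B\<^sup>2 / (512 * real (n * m * p) ^ 4 * (real (max m p) * real K)\<^sup>2)"
    and "\<exists>(U, V) \<in> matrix_class m p K r B. M0 = mult_transpose m p K U V"
    and post: "\<forall>X \<in> space (sample_law m p n \<sigma> M0). is_variational_approx m p n K a b \<sigma> \<alpha> X (post X)"
    and \<epsilon>: "\<epsilon> = eps_rate (rate_constant a (\<sigma>\<^sup>2) B) r m p n"
  then obtain U0 V0 where UV: "(U0, V0) \<in> matrix_class m p K r B" "M0 = mult_transpose m p K U0 V0" by blast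
  show "\<exists>A \<in> sets (sample_law m p n \<sigma> M0).
         A \<subseteq> {X \<in> space (sample_law m p n \<sigma> M0).
           (\<integral>\<^sup>+ M. ennreal (renyi_dist m p \<alpha> \<sigma> M M0) \<partial>(induced_law m p K (post X)))
             \<le> ennreal (2 * (\<alpha> + 1) / (1 - \<alpha>) * \<epsilon>)} \<and>
         1 - 2 / ereal (real n * \<epsilon>) \<le> ereal (measure (sample_law m p n \<sigma> M0) A)"
  proof (cases "2 \<le> n * m * p")
    case False
    have "1 * 1 * 1 \<le> n * m * p" using m p n by (intro mult_le_mono) auto
    then have "n * m * p = 1" using False by linarith
    \<comment> \<open>Since \<open>ln 1 = 0\<close>. In \<open>ereal\<close>, \<open>2 / 0\<close>
      is infinite and the required probability is minus infinity, so the empty event will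
      do.\<close>
    then have "\<epsilon> = 0" unfolding \<epsilon> eps_rate_def by simp
    then show ?thesis by (intro bexI[of _ "{}"]) (auto simp: one_ereal_def)
  next
    case True
    define \<tau> where "\<tau> = real n * \<epsilon>"
    have "0 < ln (real (n * m * p))"
      using True less_le_trans[of 1 2 "n * m * p"] by (intro ln_gt_zero) (simp del: of_nat_mult)
    then have \<tau>: "0 < \<tau>"
      using rate_constant_ge[OF a _ B, of "\<sigma>\<^sup>2"] \<sigma> r m p n
      unfolding \<tau>_def \<epsilon> eps_rate_def by (intro mult_pos_pos divide_pos_pos) auto
    have b0: "0 < b" unfolding b using B m p n K by (intro divide_pos_pos mult_pos_pos zero_less_power) auto
    \<comment> \<open>The samples satisfying the bound need not form a measurable set, as nothing is
      assumed on the map \<open>post\<close>; the good event is a measurable subset of them.\<close>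
    let ?A = "good_event m p n K a b \<sigma> \<alpha> M0 \<tau>"
    show ?thesis
    proof (intro bexI[of _ ?A] conjI subsetI CollectI)
      show "?A \<in> sets (sample_law m p n \<sigma> M0)" by (rule good_event_prob(1)[OF m p n a b0 \<sigma> \<alpha> \<tau>])
      have "1 - 2 / \<tau> \<le> measure (sample_law m p n \<sigma> M0) ?A" by (rule good_event_prob(2)[OF m p n a b0 \<sigma> \<alpha> \<tau>])
      then show "1 - 2 / ereal (real n * \<epsilon>) \<le> ereal (measure (sample_law m p n \<sigma> M0) ?A)"
        using \<tau> unfolding \<tau>_def[symmetric] by (simp add: one_ereal_def numeral_eq_ereal)
      fix X assume X: "X \<in> ?A"
      then show XS: "X \<in> space (sample_law m p n \<sigma> M0)" by (simp add: good_event_def)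
      show "(\<integral>\<^sup>+ M. ennreal (renyi_dist m p \<alpha> \<sigma> M M0) \<partial>(induced_law m p K (post X)))
             \<le> ennreal (2 * (\<alpha> + 1) / (1 - \<alpha>) * \<epsilon>)"
        by (rule good_event_bound[OF m p n K r a \<sigma> B \<alpha> True b UV \<epsilon> X[unfolded \<tau>_def] bspec[OF post XS]])
    qed
  qed
qed

end
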